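(* Let $a,b,c,n$ be positive integers with $a+b=n$, $c=n-3$ and $b>n-c=3$, and let $\mathfrak{g}=\mathfrak{p}_n^{\mathrm D}\frac{a|b}{c}$ (a type-D seaweed subalgebra of $\mathfrak{so}(2n)$ with tail configuration III and tail of size two). Suppose $\gcd(a+b,b+c)=1$, and let $\Delta$ be the delta of the type-A seaweed $\mathfrak{p}_n^{\mathrm A}\frac{a|b}{c|3}$. Then $\mathfrak{g}$ is Frobenius if and only if $$0<\xi(n,\Delta)<0.5,\qquad\text{where}\quad \xi(n,\Delta)=\frac{\Delta^{\varphi(n)-1}}{n}-\left\lfloor\frac{\Delta^{\varphi(n)-1}}{n}\right\rfloor$$ and $\varphi$ is the Euler totient function.
   Context: All Lie algebras are over $\mathbb{C}$ with commutator bracket. The index of a Lie algebra $\mathfrak{g}$ is $\min_{f\in\mathfrak{g}^*}\dim\ker B_f$, where $B_f(x,y)=f([x,y])$; $\mathfrak{g}$ is Frobenius if its index is $0$. Type-D seaweeds. $\mathfrak{so}(2n)$ is the Lie algebra of $2n\times 2n$ complex matrices $M$ with $M=-\widehat{M}$, where $\widehat{M}$ is the transpose of $M$ with respect to the antidiagonal. For sequences of positive integers $\underline{a}=(a_1,\dots,a_m)$, $\underline{b}=(b_1,\dots,b_r)$ with $n\ge\sum a_i\ge\sum b_j$, let $X_{\underline a}$ be the space of block-diagonal $2n\times 2n$ matrices with consecutive diagonal blocks of sizes $a_1,\dots,a_m,\,2(n-\sum a_i),\,a_m,\dots,a_1$, and similarly $X_{\underline b}$. Let $\mathscr L$, $\mathscr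 U$ be the lower and upper triangular matrices (diagonal included). The type-D seaweed $\mathfrak{p}_n^{\mathrm D}\frac{a_1|\cdots|a_m}{b_1|\cdots|b_r}$ is the set of matrices in $\mathfrak{so}(2n)$ lying in the span of $(X_{\underline a}\cap\mathscr L)\cup(X_{\underline b}\cap\mathscr U)$. Its tail configuration is III when $\sum a_i=n$ and $n-\sum b_j$ is odd; its tail is then the set of vertices $\{v_{s+1},\dots,v_{n-1}\}$ with $s=\sum b_j$. Delta of $\mathfrak{p}_n^{\mathrm A}\frac{a|b}{c|d}$ (with $a+b=c+d=n$). On vertices $1,\dots,n$ let $t$ be the map reversing each of the two consecutive blocks of sizes $a,b$: $t(i)=a+1-i$ for $i\le a$ and $t(i)=2a+b+1-i$ for $i>a$. Let $\beta$ be the map reversing each of the consecutive blocks of sizes $c,d$: $\beta(i)=c+1-i$ for $i\le c$ and $\beta(i)=2c+d+1-i$ for $i>c$. The residue of $t(\beta(i))-i$ modulo $n$ is the same for all $i$; the delta $\Delta\in\{0,1,\dots,n-1\}$ is this common residue. *)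

theory Defs
  imports
    "Jordan_Normal_Form.VS_Connect"
    "HOL-Number_Theory.Totient"
begin

section \<open>Index of a matrix Lie algebra\<close>

abbreviation cmat_space :: "nat \<Rightarrow> (complex, complex mat) module" where
  "cmat_space N \<equiv> module_mat TYPE(complex) N N"

definition lie_bracket :: "complex mat \<Rightarrow> complex mat \<Rightarrow> complex mat" where
  "lie_bracket x y = x * y - y * x"

text \<open>
  Elements of the dual space are represented by total functions on matrices; only their
  restrictions to \<open>g\<close> matter.
\<close>

definition linear_functional :: "complex mat set \<Rightarrow> (complex mat \<Rightarrow> complex) \<Rightarrow> bool" where
  "linear_functional g f \<longleftrightarrow>
     (\<forall>x\<in>g. \<forall>y\<in>g. f (x + y) = f x + f y) \<and> (\<forall>c. \<forall>x\<in>g. f (c \<cdot>\<^sub>m x) = c * f x)"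

definition form_kernel :: "complex mat set \<Rightarrow> (complex mat \<Rightarrow> complex) \<Rightarrow> complex mat set" where
  "form_kernel g f = {x \<in> g. \<forall>y\<in>g. f (lie_bracket x y) = 0}"

definition subspace_dim :: "nat \<Rightarrow> complex mat set \<Rightarrow> nat" where
  "subspace_dim N W = vectorspace.dim class_ring (cmat_space N\<lparr>carrier := W\<rparr>)"

text \<open>Here \<open>g\<close> is meant to be a Lie subalgebra of the complex \<open>N \<times> N\<close> matrices.\<close>

definition lie_index :: "nat \<Rightarrow> complex mat set \<Rightarrow> nat" where
  "lie_index N g = (LEAST k. \<exists>f. linear_functional g f \<and> k = subspace_dim N (form_kernel g f))"

definition frobenius :: "nat \<Rightarrow> complex mat set \<Rightarrow> bool" where
  "frobenius N g \<longleftrightarrow> lie_index N g = 0"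

section \<open>Seaweed subalgebras of type D\<close>

definition antidiag_transpose :: "complex mat \<Rightarrow> complex mat" where
  "antidiag_transpose M =
     mat (dim_col M) (dim_row M) (\<lambda>(i, j). M $$ (dim_row M - 1 - j, dim_col M - 1 - i))"

definition so_even :: "nat \<Rightarrow> complex mat set" where
  "so_even n = {M \<in> carrier_mat (2 * n) (2 * n). M = - antidiag_transpose M}"

definition sym_blocks :: "nat \<Rightarrow> nat list \<Rightarrow> nat list" where
  "sym_blocks n as = as @ [2 * (n - sum_list as)] @ rev as"

definition block_diagonal :: "nat \<Rightarrow> nat list \<Rightarrow> complex mat set" where
  "block_diagonal n as =
     {diag_block_mat Bs | Bs. map dim_row Bs = sym_blocks n as \<and> map dim_col Bs = sym_blocks n as}"

definition lower_triangular :: "complex mat \<Rightarrow> bool" where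
  "lower_triangular M \<longleftrightarrow> upper_triangular (transpose_mat M)"

definition seaweed_D :: "nat \<Rightarrow> nat list \<Rightarrow> nat list \<Rightarrow> complex mat set" where
  "seaweed_D n as bs =
     so_even n \<inter>
     LinearCombinations.module.span class_ring (cmat_space (2 * n))
       ({M \<in> block_diagonal n as. lower_triangular M} \<union>
        {M \<in> block_diagonal n bs. upper_triangular M})"

section \<open>Delta of a type-A seaweed\<close>

text \<open>
  For \<open>1 \<le> i \<le> p + q\<close>, the map reversing each of the consecutive blocks \<open>1, \<dots>, p\<close> and
  \<open>p + 1, \<dots>, p + q\<close>.
\<close>

definition block_reverse :: "nat \<Rightarrow> nat \<Rightarrow> nat \<Rightarrow> nat" where
  "block_reverse p q i = (if i \<le> p then p + 1 - i else 2 * p + q + 1 - i)"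

definition delta_A :: "nat \<Rightarrow> nat \<Rightarrow> nat \<Rightarrow> nat \<Rightarrow> nat" where
  "delta_A a b c d =
     (THE r. r < a + b \<and>
       (\<forall>i\<in>{1..a + b}.
          (int (block_reverse a b (block_reverse c d i)) - int i) mod int (a + b) = int r))"

definition xi :: "nat \<Rightarrow> nat \<Rightarrow> real" where
  "xi n r = real (r ^ (totient n - 1)) / real n - of_int \<lfloor>real (r ^ (totient n - 1)) / real n\<rfloor>"

end

theory Submission
  imports Defs "HOL-Library.Function_Algebras" "HOL-Computational_Algebra.Formal_Power_Series"
    "HOL-Number_Theory.Residues"
begin

text \<open>Elements of \<open>g\<close> are pairs \<open>(A, B)\<close> of a matrix \<open>A\<close> in the type-A seaweed \<open>q = (a|b)/(c|3)\<close> and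
  an alternating matrix \<open>B\<close> on the last three indices. Put \<open>\<Delta> = a + 3\<close> and let \<open>e\<close> be its inverse modulo \<open>n\<close>,
  so that the condition on \<open>\<xi>\<close> says \<open>2 e < n\<close>. A nondegenerate functional is nonzero on the alternating part, and
  transvections normalise it to a multiple of \<open>B (n - 3) (n - 2)\<close>; by the relations this imposes on \<open>A\<close>, the
  form of such a functional is nondegenerate iff its restriction to the seaweed \<open>p = (a|b)/(c|2|1)\<close> has only
  scalar matrices in its kernel. Following the meander of \<open>p\<close> in steps of \<open>e\<close> modulo \<open>n\<close> shows that it is
  a single path if \<open>2 e < n\<close>, and a path and a cycle otherwise. For a path, the sum of the coordinate
  functions of the arcs works, because its form has a unique nonzero transversal: the multiplicity
  of every arc is determined by the cuts of the path, and the longest arcs come first. For a path and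
  a cycle, the two components and a deformation \<open>S + t F\<close> over formal power series show that no functional
  \<open>F\<close> on \<open>p\<close> has only scalars in its kernel.\<close>

text \<open>The inequality \<open>2 * e < n\<close> records which of two vertices comes first on a
  path. The meander of \<open>(a|b)/(c|3)\<close> is a single path starting at \<open>n - 2\<close>,
  on which \<open>n - 3\<close> and \<open>n - 1\<close> are neighbours. Passing to
  \<open>(a|b)/(c|2|1)\<close> deletes the edge between these two and joins \<open>n - 3\<close> to
  the starting point. If \<open>n - 1\<close> precedes \<open>n - 3\<close>, the two pieces are
  glued into one path; otherwise the initial piece is closed into a cycle. Sufficiency needs one
  good functional, whereas necessity must defeat every functional F. The way out is a special
  functional S, the sum of the coordinates of all arcs but the new one. The projection onto one
  component lies in its kernel, and bracketing with S is invertible between the components, so the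
  projection can be carried along S + t F for any F. A formal series cannot be evaluated at a value
  of t, hence the argument on its coefficients. Pairing with the alternating part imposes three
  conditions on A: two cut \<open>(a|b)/(c|3)\<close> down to \<open>(a|b)/(c|2|1)\<close>, and the
  third, trace zero on the indices \<open>n - 3\<close> and \<open>n - 2\<close>, is what removes
  the scalars.\<close>

section \<open>Linear systems with a unique nonzero transversal\<close>

text \<open>Every other summand of the Leibniz expansion has a zero factor, so nothing can cancel
  the one that is left.\<close>

lemma det_unique_transversal:
  fixes M :: "'a :: idom mat"
  assumes M: "M \<in> carrier_mat N N" and q: "q permutes {0..<N}"
    and nz: "\<And>k. k < N \<Longrightarrow> M $$ (k, q k) \<noteq> 0"
    and uniq: "\<And>p. p permutes {0..<N} \<Longrightarrow> (\<And>k. k < N \<Longrightarrow> M $$ (k, p k) \<noteq> 0) \<Longrightarrow> p = q"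
  shows "det M \<noteq> 0"
proof -
  have "det M = (\<Sum>p\<in>{p. p permutes {0..<N}}. signof p * (\<Prod>k = 0..<N. M $$ (k, p k)))"
    by (rule det_def'[OF M])
  also have "\<dots> = (\<Sum>p\<in>{q}. signof p * (\<Prod>k = 0..<N. M $$ (k, p k)))"
  proof (rule sum.mono_neutral_right)
    show "finite {p. p permutes {0..<N}}" by (simp add: finite_permutations)
    show "{q} \<subseteq> {p. p permutes {0..<N}}" using q by simp
    show "\<forall>p\<in>{p. p permutes {0..<N}} - {q}. signof p * (\<Prod>k = 0..<N. M $$ (k, p k)) = 0"
    proof
      fix p assume p: "p \<in> {p. p permutes {0..<N}} - {q}"
      then have "\<exists>k<N. M $$ (k, p k) = 0" using uniq by blast
      then have "(\<Prod>k = 0..<N. M $$ (k, p k)) = 0" by auto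
      then show "signof p * (\<Prod>k = 0..<N. M $$ (k, p k)) = 0" by simp
    qed
  qed
  finally have "det M = signof q * (\<Prod>k = 0..<N. M $$ (k, q k))" by simp
  moreover have "(\<Prod>k = 0..<N. M $$ (k, q k)) \<noteq> 0" using nz by auto
  moreover have "signof q \<noteq> (0 :: 'a)" by (simp add: sign_def)
  ultimately show ?thesis by simp
qed

text \<open>In the applications the indices are positions of a matrix, so the system is carried to a
  square matrix by an enumeration \<open>h\<close> of \<open>I\<close>. One inverse matrix gives
  both conclusions: solvability serves the case of a path and a cycle, injectivity the case of a
  single path.\<close>

lemma unique_transversal_system:
  fixes B :: "'i \<Rightarrow> 'i \<Rightarrow> 'a :: field"
  assumes fin: "finite I" and tau: "\<tau> permutes I"
    and nz: "\<And>i. i \<in> I \<Longrightarrow> B i (\<tau> i) \<noteq> 0"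
    and uniq: "\<And>\<sigma>. \<sigma> permutes I \<Longrightarrow> (\<And>i. i \<in> I \<Longrightarrow> B i (\<sigma> i) \<noteq> 0) \<Longrightarrow> \<sigma> = \<tau>"
  shows unique_transversal_solvable: "\<exists>x. \<forall>i\<in>I. (\<Sum>j\<in>I. B i j * x j) = r i"
    and unique_transversal_injective:
      "(\<And>i. i \<in> I \<Longrightarrow> (\<Sum>j\<in>I. B i j * x j) = 0) \<Longrightarrow> j \<in> I \<Longrightarrow> x j = 0"
proof -
  define N where "N = card I"
  obtain h where h: "bij_betw h {0..<N} I"
    using ex_bij_betw_nat_finite[OF fin] unfolding N_def by blast
  define g where "g = inv_into {0..<N} h"
  have g: "bij_betw g I {0..<N}" unfolding g_def by (rule bij_betw_inv_into[OF h])
  have hI: "h k \<in> I" if "k < N" for k using h that by (auto simp: bij_betw_def)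
  have gN: "g i < N" if "i \<in> I" for i using g that by (auto simp: bij_betw_def)
  have gh: "g (h k) = k" if "k < N" for k
    using h that unfolding g_def by (simp add: bij_betw_inv_into_left)
  have hg: "h (g i) = i" if "i \<in> I" for i
    using h that unfolding g_def by (simp add: bij_betw_inv_into_right)
  have inv_g: "inv_into I g k = h k" if "k < N" for k
    using g gh hI that by (metis bij_betw_inv_into_left)
  define M where "M = mat N N (\<lambda>(k, l). B (h k) (h l))"
  have M: "M \<in> carrier_mat N N" unfolding M_def by simp
  define q where "q k = (if k \<in> {0..<N} then g (\<tau> (inv_into I g k)) else k)" for k
  have q: "q permutes {0..<N}" unfolding q_def by (rule permutes_bij_inv_into[OF tau g])
  have tauI: "\<tau> i \<in> I" if "i \<in> I" for i using tau that by (simp add: permutes_in_image)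
  have "det M \<noteq> 0"
  proof (rule det_unique_transversal[OF M q])
    fix k assume k: "k < N"
    then have "q k = g (\<tau> (h k))" by (simp add: q_def inv_g)
    then show "M $$ (k, q k) \<noteq> 0" using nz[OF hI[OF k]] tauI[OF hI[OF k]]
      by (simp add: M_def k gN hg)
  next
    fix p assume p: "p permutes {0..<N}" and pnz: "\<And>k. k < N \<Longrightarrow> M $$ (k, p k) \<noteq> 0"
    define \<sigma> where "\<sigma> i = (if i \<in> I then h (p (inv_into {0..<N} h i)) else i)" for i
    have \<sigma>: "\<sigma> permutes I" unfolding \<sigma>_def by (rule permutes_bij_inv_into[OF p h])
    have pN: "p k < N" if "k < N" for k using p that permutes_in_image[OF p, of k] by simp
    have "\<sigma> = \<tau>"
    proof (rule uniq[OF \<sigma>])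
      fix i assume i: "i \<in> I"
      have "M $$ (g i, p (g i)) \<noteq> 0" by (rule pnz[OF gN[OF i]])
      then show "B i (\<sigma> i) \<noteq> 0"
        using i by (simp add: M_def gN pN hg \<sigma>_def g_def[symmetric])
    qed
    show "p = q"
    proof
      fix k
      show "p k = q k"
      proof (cases "k < N")
        case True
        then have "\<tau> (h k) = h (p k)"
          unfolding \<open>\<sigma> = \<tau>\<close>[symmetric] \<sigma>_def by (simp add: hI g_def[symmetric] gh)
        then show ?thesis using True by (simp add: q_def inv_g gh pN)
      next
        case False
        then show ?thesis using permutes_not_in[OF p] permutes_not_in[OF q] by simp
      qed
    qed
  qed
  then obtain A where A: "A \<in> carrier_mat N N" and AM: "A * M = 1\<^sub>m N" and MA: "M * A = 1\<^sub>m N"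
    using det_non_zero_imp_unit[OF M, of "()"] unfolding Units_def ring_mat_def by auto
  have reindex: "(\<Sum>j\<in>I. B i j * x j) = (\<Sum>l<N. B i (h l) * x (h l))" for i x
    using sum.reindex_bij_betw[OF h, of "\<lambda>j. B i j * x j"] by (simp add: atLeast0LessThan)
  have Mv: "(M *\<^sub>v v) $ k = (\<Sum>l<N. B (h k) (h l) * v $ l)" if "v \<in> carrier_vec N" "k < N" for v k
    using that by (simp add: M_def scalar_prod_def atLeast0LessThan)
  show "\<exists>x. \<forall>i\<in>I. (\<Sum>j\<in>I. B i j * x j) = r i"
  proof -
    define R where "R = vec N (\<lambda>k. r (h k))"
    define v where "v = A *\<^sub>v R"
    have v: "v \<in> carrier_vec N" using A by (simp add: v_def R_def)
    have "M *\<^sub>v v = R" unfolding v_def using M A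
      by (simp add: assoc_mult_mat_vec[symmetric, of _ N N _ N] MA R_def)
    then have "(\<Sum>j\<in>I. B i j * (v $ g j)) = r i" if "i \<in> I" for i
      using Mv[OF v gN[OF that]] that
      by (simp add: reindex gh hg R_def gN)
    then show ?thesis by (intro exI[of _ "\<lambda>j. v $ g j"]) simp
  qed
  show "x j = 0" if x: "\<And>i. i \<in> I \<Longrightarrow> (\<Sum>j\<in>I. B i j * x j) = 0" and j: "j \<in> I"
  proof -
    define v where "v = vec N (\<lambda>k. x (h k))"
    have v: "v \<in> carrier_vec N" by (simp add: v_def)
    have "M *\<^sub>v v = 0\<^sub>v N"
    proof (rule eq_vecI)
      fix k assume "k < dim_vec (0\<^sub>v N :: 'a vec)"
      then show "(M *\<^sub>v v) $ k = 0\<^sub>v N $ k"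
        using x[OF hI[of k]] Mv[OF v, of k] by (simp add: reindex) (simp add: v_def)
    qed (simp add: M_def)
    then have "A *\<^sub>v (M *\<^sub>v v) = 0\<^sub>v N" using A by (intro eq_vecI) auto
    moreover have "A *\<^sub>v (M *\<^sub>v v) = v" using A M v
      by (simp add: assoc_mult_mat_vec[symmetric, of _ N N _ N] AM)
    ultimately have "v $ g j = 0" using gN[OF j] by simp
    then show ?thesis using gN[OF j] by (simp add: v_def hg j)
  qed
qed

text \<open>The multiplicity of every arc in a transversal is fixed by the weights \<open>c\<close>, so a transversal
  is determined by descending induction on the length of the arcs.\<close>

lemma transversal_unique_by_weights:
  fixes B :: "'i \<Rightarrow> 'i \<Rightarrow> 'a :: zero" and c :: "'g \<Rightarrow> 'i \<Rightarrow> int" and len :: "'g \<Rightarrow> nat"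
  assumes fin: "finite I" and tau: "\<tau> permutes I"
    and own: "\<And>i. i \<in> I \<Longrightarrow> own i \<in> G"
    and lenb: "\<And>g. g \<in> G \<Longrightarrow> len g \<le> L"
    and own_tau: "\<And>i. i \<in> I \<Longrightarrow> own (\<tau> i) = own i"
    and c_tau: "\<And>i d. i \<in> I \<Longrightarrow> d \<in> G \<Longrightarrow> c d i + c d (\<tau> i) = (if d = own i then 1 else 0)"
    and B: "\<And>i j. i \<in> I \<Longrightarrow> j \<in> I \<Longrightarrow> B i j \<noteq> 0 \<Longrightarrow>
       \<exists>g\<in>G. (\<forall>d\<in>G. c d i + c d j = (if d = g then 1 else 0)) \<and>
         (j = \<tau> i \<and> own i = g \<or> len (own i) > len g \<or> len (own j) > len g)"
    and sig: "\<sigma> permutes I" and nz: "\<And>i. i \<in> I \<Longrightarrow> B i (\<sigma> i) \<noteq> 0"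
  shows "\<sigma> = \<tau>"
proof -
  have sI: "\<sigma> i \<in> I" if "i \<in> I" for i using sig that by (simp add: permutes_in_image)
  define Q where "Q i g \<longleftrightarrow> g \<in> G \<and> (\<forall>d\<in>G. c d i + c d (\<sigma> i) = (if d = g then 1 else 0)) \<and>
         (\<sigma> i = \<tau> i \<and> own i = g \<or> len (own i) > len g \<or> len (own (\<sigma> i)) > len g)" for i g
  have "\<exists>g. Q i g" if i: "i \<in> I" for i
    using B[OF i sI[OF i] nz[OF i]] unfolding Q_def by blast
  then obtain lab where lab: "\<And>i. i \<in> I \<Longrightarrow> Q i (lab i)" by metis
  have lab1: "\<And>d. d \<in> G \<Longrightarrow> c d i + c d (\<sigma> i) = (if d = lab i then 1 else 0)"
    and lab2: "\<sigma> i = \<tau> i \<and> own i = lab i \<or> len (own i) > len (lab i) \<or> len (own (\<sigma> i)) > len (lab i)"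
    if "i \<in> I" for i using lab[OF that] unfolding Q_def by blast+
  have lab_own: "own j = lab j" if j: "j \<in> I" and eq: "\<sigma> j = \<tau> j" for j
    using lab1[OF j own[OF j]] c_tau[OF j own[OF j]] eq by (simp split: if_splits)
  \<comment> \<open>A permutation meets every index once as an argument and once as a value, so this
    total is the same for all permutations. In \<open>count\<close> this turns the weights into
    equal multiplicities for \<open>\<sigma>\<close> and \<open>\<tau>\<close>.\<close>
  have twice: "(\<Sum>i\<in>I. c d i + c d (\<rho> i)) = 2 * (\<Sum>i\<in>I. c d i)" if "\<rho> permutes I" for d \<rho>
    using sum.permute[OF that, of "c d"] by (simp add: sum.distrib comp_def)
  have count: "card {i \<in> I. lab i = g} = card {i \<in> I. own i = g}" if g: "g \<in> G" for g
  proof -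
    have ind: "(\<Sum>i\<in>I. if g = f i then 1 else 0 :: int) = int (card {i \<in> I. f i = g})" for f
    proof -
      have "(\<Sum>i\<in>I. if g = f i then 1 else 0 :: int) = (\<Sum>i\<in>{i \<in> I. g = f i}. 1)"
        by (rule sum.inter_filter[symmetric, OF fin])
      also have "{i \<in> I. g = f i} = {i \<in> I. f i = g}" by auto
      finally show ?thesis by simp
    qed
    have "(\<Sum>i\<in>I. c g i + c g (\<sigma> i)) = (\<Sum>i\<in>I. if g = lab i then 1 else 0)"
      by (rule sum.cong) (use lab1 g in auto)
    moreover have "(\<Sum>i\<in>I. c g i + c g (\<tau> i)) = (\<Sum>i\<in>I. if g = own i then 1 else 0)"
      by (rule sum.cong) (use c_tau g in auto)
    ultimately show ?thesis using twice[OF sig, of g] twice[OF tau, of g] by (simp add: ind)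
  qed
  have main: "\<forall>g\<in>G. L - len g = m \<longrightarrow> (\<forall>i\<in>I. own i = g \<longrightarrow> \<sigma> i = \<tau> i)" for m
  proof (induction m rule: less_induct)
    case (less m)
    show ?case
    proof (intro ballI impI)
      fix g i assume g: "g \<in> G" and m: "L - len g = m" and i: "i \<in> I" "own i = g"
      have longer: "\<sigma> j = \<tau> j" if j: "j \<in> I" and l: "len (own j) > len g" for j
        using less.IH[of "L - len (own j)"] own[OF j] lenb[OF own[OF j]] lenb[OF g] m l j by auto
      have sub: "\<sigma> j = \<tau> j \<and> own j = g" if j: "j \<in> I" and lj: "lab j = g" for j
      proof -
        consider "\<sigma> j = \<tau> j" "own j = g" | "len (own j) > len g" | "len (own (\<sigma> j)) > len g"
          using lab2[OF j] lj by auto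
        then show ?thesis
        proof cases
          case 2
          have "\<sigma> j = \<tau> j" by (rule longer[OF j 2])
          then have "own j = g"
            using lab_own[OF j] lj by simp
          then show ?thesis using 2 by simp
        next
          case 3
          \<comment> \<open>The index that \<open>\<tau>\<close> sends to \<open>\<sigma> j\<close>
            has the same long owner as \<open>\<sigma> j\<close>. The induction hypothesis fixes
            \<open>\<sigma> b\<close>, and injectivity of \<open>\<sigma>\<close> forces
            \<open>b = j\<close>.\<close>
          define b where "b = inv_into UNIV \<tau> (\<sigma> j)"
          have b: "b \<in> I" and tb: "\<tau> b = \<sigma> j"
            using tau sI[OF j] unfolding b_def
            by (simp_all add: permutes_inv permutes_in_image permutes_inverses)
          have ob: "own b = own (\<sigma> j)" using own_tau[OF b] tb by simp
          have "\<sigma> b = \<tau> b" by (rule longer[OF b]) (use ob 3 in simp)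
          then have "b = j" using tb injD[OF permutes_inj[OF sig]] by simp
          then have "\<sigma> j = \<tau> j" using tb by simp
          then have "own j = g"
            using lab_own[OF j] lj by simp
          then show ?thesis using \<open>\<sigma> j = \<tau> j\<close> by simp
        qed simp
      qed
      \<comment> \<open>One inclusion is \<open>sub\<close>; equal cardinalities give the other, so
        that \<open>sub\<close> applies to every index owned by \<open>g\<close>.\<close>
      have "{j \<in> I. lab j = g} = {j \<in> I. own j = g}"
      proof (rule card_subset_eq)
        show "finite {j \<in> I. own j = g}" using fin by simp
        show "{j \<in> I. lab j = g} \<subseteq> {j \<in> I. own j = g}" using sub by auto
        show "card {j \<in> I. lab j = g} = card {j \<in> I. own j = g}" by (rule count[OF g])
      qed
      then show "\<sigma> i = \<tau> i" using sub i by auto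
    qed
  qed
  show ?thesis
  proof
    fix i show "\<sigma> i = \<tau> i"
    proof (cases "i \<in> I")
      case True
      then show ?thesis using main own by blast
    next
      case False
      then show ?thesis using permutes_not_in[OF sig] permutes_not_in[OF tau] by simp
    qed
  qed
qed

section \<open>Arcs of two block reversals and the positions they own\<close>

text \<open>Blocks enter only through their labels \<open>tb\<close>, \<open>bb\<close> and the
  antitone involutions \<open>t\<close>, \<open>b\<close> on them. This keeps the block sizes out of
  the combinatorics.\<close>

locale block_reversals =
  fixes n :: nat and tb bb t b :: "nat \<Rightarrow> nat"
  assumes t_less: "i < n \<Longrightarrow> t i < n" and t_t: "i < n \<Longrightarrow> t (t i) = i"
    and tb_t: "i < n \<Longrightarrow> tb (t i) = tb i"
    and t_anti: "i < j \<Longrightarrow> j < n \<Longrightarrow> tb i = tb j \<Longrightarrow> t j < t i"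
    and b_less: "i < n \<Longrightarrow> b i < n" and b_b: "i < n \<Longrightarrow> b (b i) = i"
    and bb_b: "i < n \<Longrightarrow> bb (b i) = bb i"
    and b_anti: "i < j \<Longrightarrow> j < n \<Longrightarrow> bb i = bb j \<Longrightarrow> b j < b i"
begin

definition low :: "nat \<Rightarrow> nat \<Rightarrow> bool" where
  "low i j \<longleftrightarrow> j < i \<and> i < n \<and> tb i = tb j"

definition upp :: "nat \<Rightarrow> nat \<Rightarrow> bool" where
  "upp i j \<longleftrightarrow> i < j \<and> j < n \<and> bb i = bb j"

definition is_arc :: "nat \<times> nat \<Rightarrow> bool" where
  "is_arc = (\<lambda>(i, j). j < i \<and> i < n \<and> j = t i \<or> i < j \<and> j < n \<and> j = b i)"

definition non_arc :: "nat \<times> nat \<Rightarrow> bool" where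
  "non_arc = (\<lambda>(i, j). low i j \<and> j \<noteq> t i \<or> upp i j \<and> j \<noteq> b i)"

text \<open>The arcs of one block are concentric. Of the two arcs ending at \<open>i\<close> and at
  \<open>j\<close>, the owner is the outer one, whose span contains both indices.\<close>

definition owner :: "nat \<times> nat \<Rightarrow> nat \<times> nat" where
  "owner = (\<lambda>(i, j). if j < i then (if t i < j then (i, t i) else (t j, j))
     else (if j < b i then (i, b i) else (b j, j)))"

text \<open>The position that completes a position to its owner: in one of the two orders, the
  matrix units of both multiply to the matrix unit of the owner.\<close>

definition partner :: "nat \<times> nat \<Rightarrow> nat \<times> nat" where
  "partner = (\<lambda>(i, j). if j < i then (if t i < j then (j, t i) else (t j, i))
     else (if j < b i then (j, b i) else (b j, i)))"

definition span_len :: "nat \<times> nat \<Rightarrow> nat" where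
  "span_len = (\<lambda>(i, j). if j < i then i - j else j - i)"

text \<open>The functional that adds up the coordinates in \<open>G\<close>, evaluated on the
  commutator of the matrix units at \<open>(i, j)\<close> and \<open>(p, q)\<close>.\<close>

definition arc_form :: "(nat \<times> nat) set \<Rightarrow> nat \<times> nat \<Rightarrow> nat \<times> nat \<Rightarrow> complex" where
  "arc_form G = (\<lambda>(i, j) (p, q). of_bool (j = p \<and> (i, q) \<in> G) - of_bool (q = i \<and> (p, j) \<in> G))"

lemma low_cases:
  assumes "low i j" "j \<noteq> t i"
  obtains "t i < j" "low j (t i)" "t i < t j" "t j < i" | "j < t i" "low (t j) i" "i < t j" "t i < t j"
proof -
  have ij: "j < i" "i < n" "tb i = tb j" and jn: "j < n" using assms by (auto simp: low_def)
  have a: "t i < t j" by (rule t_anti) (use ij in auto)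
  consider "t i < j" | "j < t i" using assms(2) by linarith
  then show ?thesis
  proof cases
    case 1
    then have "t j < t (t i)" by (intro t_anti) (use ij jn in \<open>auto simp: tb_t\<close>)
    then show ?thesis using that(1) 1 ij jn a by (auto simp: low_def tb_t t_t)
  next
    case 2
    then have "t (t i) < t j" by (intro t_anti) (use ij jn in \<open>auto simp: tb_t t_less\<close>)
    then show ?thesis using that(2) 2 ij jn a by (auto simp: low_def tb_t t_t t_less)
  qed
qed

lemma upp_cases:
  assumes "upp i j" "j \<noteq> b i"
  obtains "j < b i" "upp j (b i)" "b j < b i" "i < b j" | "b i < j" "upp (b j) i" "b j < i" "b j < b i"
proof -
  have ij: "i < j" "j < n" "bb i = bb j" and jn: "i < n" using assms by (auto simp: upp_def)
  have a: "b j < b i" by (rule b_anti) (use ij in auto)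
  consider "b i < j" | "j < b i" using assms(2) by linarith
  then show ?thesis
  proof cases
    case 1
    then have "b j < b (b i)" by (intro b_anti) (use ij jn in \<open>auto simp: bb_b\<close>)
    then show ?thesis using that(2) 1 ij jn a by (auto simp: upp_def bb_b b_b)
  next
    case 2
    then have "b (b i) < b j" by (intro b_anti) (use ij jn in \<open>auto simp: bb_b b_less\<close>)
    then show ?thesis using that(1) 2 ij jn a by (auto simp: upp_def bb_b b_b b_less)
  qed
qed

lemma non_arcE:
  assumes "non_arc x"
  obtains i j where "x = (i, j)" "low i j" "j \<noteq> t i" | i j where "x = (i, j)" "upp i j" "j \<noteq> b i"
  using assms by (cases x) (auto simp: non_arc_def)

lemma partner_partner:
  assumes "non_arc x"
  shows "partner (partner x) = x" and "owner (partner x) = owner x" and "partner x \<noteq> x"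
    and "partner x = (i, j) \<Longrightarrow> x = (p, q) \<Longrightarrow>
      owner x = (i, q) \<and> j = p \<or> owner x = (p, j) \<and> q = i"
proof -
  have "partner (partner x) = x \<and> owner (partner x) = owner x \<and> partner x \<noteq> x \<and>
    (partner x = (i, j) \<longrightarrow> x = (p, q) \<longrightarrow> owner x = (i, q) \<and> j = p \<or> owner x = (p, j) \<and> q = i)"
    using assms
  proof (cases rule: non_arcE)
    case (1 i j)
    then have "i < n" "j < n" "j < i" by (auto simp: low_def)
    from 1(2,3) show ?thesis
      by (cases rule: low_cases)
        (use \<open>i < n\<close> \<open>j < n\<close> \<open>j < i\<close> 1(1) in \<open>auto simp: partner_def owner_def t_t\<close>)
  next
    case (2 i j)
    then have "i < n" "j < n" "i < j" by (auto simp: upp_def)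
    from 2(2,3) show ?thesis
      by (cases rule: upp_cases)
        (use \<open>i < n\<close> \<open>j < n\<close> \<open>i < j\<close> 2(1) in \<open>auto simp: partner_def owner_def b_b\<close>)
  qed
  then show "partner (partner x) = x" "owner (partner x) = owner x" "partner x \<noteq> x"
    "partner x = (i, j) \<Longrightarrow> x = (p, q) \<Longrightarrow> owner x = (i, q) \<and> j = p \<or> owner x = (p, j) \<and> q = i"
    by auto
qed

text \<open>If \<open>m\<close> lies between \<open>i\<close> and \<open>q\<close>, the two
  positions split the arc and are partners. If \<open>m\<close> lies outside, one of the two
  positions lies in the block of the arc and reaches beyond it; as the arcs there are concentric,
  its owner is longer.\<close>

lemma arc_triangle:
  assumes x: "non_arc (i, m)" and y: "non_arc (m, q)" and g: "is_arc (i, q)"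
  shows "(m, q) = partner (i, m) \<and> owner (i, m) = (i, q) \<or>
    span_len (owner (i, m)) > span_len (i, q) \<or> span_len (owner (m, q)) > span_len (i, q)"
proof -
  have im: "i \<noteq> m" "m \<noteq> q" "m < n" "i < n" "q < n"
    using x y by (auto simp: non_arc_def low_def upp_def)
  consider "q < i" "q = t i" | "i < q" "q = b i" using g by (auto simp: is_arc_def)
  then show ?thesis
  proof cases
    case 1
    consider "q < m" "m < i" | "i < m" | "m < q" using im 1 by linarith
    then show ?thesis
    proof cases
      case a: 1
      then show ?thesis using 1 by (simp add: partner_def owner_def)
    next
      case a: 2
      have l: "low m q" "q \<noteq> t m" using y a 1 by (auto simp: non_arc_def upp_def)
      then have "tb i = tb m" using 1 im by (auto simp: low_def tb_t)
      then have "t m < t i" using a im by (intro t_anti)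
      then show ?thesis using a 1 by (auto simp: owner_def span_len_def)
    next
      case a: 3
      have l: "low i m" "m \<noteq> t i" using x a 1 by (auto simp: non_arc_def upp_def)
      then have "tb m = tb q" using 1 im by (auto simp: low_def tb_t)
      then have "t q < t m" using a im by (intro t_anti)
      then show ?thesis using a 1 im by (auto simp: owner_def span_len_def t_t)
    qed
  next
    case 2
    consider "i < m" "m < q" | "m < i" | "q < m" using im 2 by linarith
    then show ?thesis
    proof cases
      case a: 1
      then show ?thesis using 2 by (simp add: partner_def owner_def)
    next
      case a: 2
      have l: "upp m q" "q \<noteq> b m" using y a 2 by (auto simp: non_arc_def low_def)
      then have "bb m = bb i" using 2 im by (auto simp: upp_def bb_b)
      then have "b i < b m" using a im by (intro b_anti)
      then show ?thesis using a 2 by (auto simp: owner_def span_len_def)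
    next
      case a: 3
      have l: "upp i m" "m \<noteq> b i" using x a 2 by (auto simp: non_arc_def low_def)
      then have "bb q = bb m" using 2 im by (auto simp: upp_def bb_b)
      then have "b m < b q" using a im by (intro b_anti)
      then show ?thesis using a 2 im by (auto simp: owner_def span_len_def b_b)
    qed
  qed
qed

lemma owner_is_arc:
  assumes "non_arc x" shows "is_arc (owner x)"
  using assms
proof (cases rule: non_arcE)
  case (1 i j)
  then have "i < n" "j < n" "j < i" by (auto simp: low_def)
  from 1(2,3) show ?thesis
    by (cases rule: low_cases)
      (use \<open>i < n\<close> \<open>j < n\<close> \<open>j < i\<close> 1(1) in \<open>auto simp: is_arc_def owner_def t_t t_less\<close>)
next
  case (2 i j)
  then have "i < n" "j < n" "i < j" by (auto simp: upp_def)
  from 2(2,3) show ?thesis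
    by (cases rule: upp_cases)
      (use \<open>i < n\<close> \<open>j < n\<close> \<open>i < j\<close> 2(1) in \<open>auto simp: is_arc_def owner_def b_b b_less\<close>)
qed

text \<open>The weights \<open>c\<close> are the cuts of the forest \<open>G\<close>: \<open>c d\<close> changes only along the arc \<open>d\<close>.\<close>

lemma arc_form_nondegenerate:
  fixes c :: "nat \<times> nat \<Rightarrow> nat \<Rightarrow> int"
  assumes I: "\<And>x. x \<in> I \<Longrightarrow> non_arc x \<and> partner x \<in> I \<and> owner x \<in> G"
    and G: "\<And>g. g \<in> G \<Longrightarrow> is_arc g"
    and c: "\<And>d i j. d \<in> G \<Longrightarrow> (i, j) \<in> G \<Longrightarrow> c d i - c d j = (if d = (i, j) then 1 else 0)"
  shows arc_form_solvable: "\<exists>x. \<forall>i\<in>I. (\<Sum>j\<in>I. arc_form G i j * x j) = r i"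
    and arc_form_injective:
      "(\<And>i. i \<in> I \<Longrightarrow> (\<Sum>j\<in>I. arc_form G i j * x j) = 0) \<Longrightarrow> j \<in> I \<Longrightarrow> x j = 0"
proof -
  have "I \<subseteq> {..<n} \<times> {..<n}" using I by (fastforce simp: non_arc_def low_def upp_def)
  then have fin: "finite I" by (rule finite_subset) simp
  define \<tau> where "\<tau> x = (if x \<in> I then partner x else x)" for x
  have tt: "\<tau> (\<tau> x) = x" for x using I partner_partner(1) by (auto simp: \<tau>_def)
  have tau: "\<tau> permutes I"
    unfolding permutes_def by (metis tt \<tau>_def)
  \<comment> \<open>As a difference of a function of vertices, \<open>C d\<close> is additive on
    composable positions. A pair whose product is the arc \<open>g\<close> therefore has total
    weight 1 if \<open>d = g\<close> and 0 otherwise.\<close>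
  define C where "C d = (\<lambda>(i, j). c d i - c d j)" for d
  have C_partner: "C d x + C d (partner x) = (if d = owner x then 1 else 0)"
    if x: "x \<in> I" and d: "d \<in> G" for d x
  proof -
    obtain i j p q where eq: "partner x = (i, j)" "x = (p, q)" by fastforce
    from partner_partner(4)[OF _ eq] I[OF x]
    consider "owner x = (i, q)" "j = p" | "owner x = (p, j)" "q = i" by blast
    then show ?thesis
    proof cases
      case 1
      then have "(i, q) \<in> G" using I[OF x] by simp
      with c[OF d this] show ?thesis unfolding eq(1) unfolding C_def eq(2) using 1 eq by simp
    next
      case 2
      then have "(p, j) \<in> G" using I[OF x] by simp
      with c[OF d this] show ?thesis unfolding eq(1) unfolding C_def eq(2) using 2 eq by simp
    qed
  qed
  have triangle: "\<exists>g\<in>G. (\<forall>d\<in>G. C d (i, m) + C d (m, q) = (if d = g then 1 else 0)) \<and>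
         ((m, q) = \<tau> (i, m) \<and> owner (i, m) = g \<or> span_len (owner (i, m)) > span_len g \<or>
          span_len (owner (m, q)) > span_len g)"
    if "(i, m) \<in> I" "(m, q) \<in> I" "(i, q) \<in> G" for i m q
  proof (intro bexI[of _ "(i, q)"] conjI ballI)
    show "C d (i, m) + C d (m, q) = (if d = (i, q) then 1 else 0)" if "d \<in> G" for d
      using c[OF that \<open>(i, q) \<in> G\<close>] by (simp add: C_def)
    show "(m, q) = \<tau> (i, m) \<and> owner (i, m) = (i, q) \<or> span_len (owner (i, m)) > span_len (i, q) \<or>
          span_len (owner (m, q)) > span_len (i, q)"
      using arc_triangle[of i m q] I[OF that(1)] I[OF that(2)] G[OF that(3)] that(1) by (simp add: \<tau>_def)
  qed (rule that(3))
  have swap: "x = \<tau> y \<Longrightarrow> y \<in> I \<Longrightarrow> owner y = g \<Longrightarrow> y = \<tau> x \<and> owner x = g" for x y g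
    using I partner_partner(1,2) by (auto simp: \<tau>_def)
  have edge: "\<exists>g\<in>G. (\<forall>d\<in>G. C d x + C d y = (if d = g then 1 else 0)) \<and>
         (y = \<tau> x \<and> owner x = g \<or> span_len (owner x) > span_len g \<or> span_len (owner y) > span_len g)"
    if x: "x \<in> I" and y: "y \<in> I" and nz: "arc_form G x y \<noteq> 0" for x y
  proof -
    obtain i j p q where eq: "x = (i, j)" "y = (p, q)" by fastforce
    have "j = p \<and> (i, q) \<in> G \<or> q = i \<and> (p, j) \<in> G"
      using nz unfolding eq arc_form_def by (auto split: if_splits)
    then show ?thesis
    proof (elim disjE conjE)
      assume "j = p" "(i, q) \<in> G"
      then show ?thesis using triangle[of i j q] x y unfolding eq by simp
    next
      assume q: "q = i" and pj: "(p, j) \<in> G"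
      from triangle[of p i j] x y pj obtain g where g: "g \<in> G"
        "\<forall>d\<in>G. C d y + C d x = (if d = g then 1 else 0)"
        "x = \<tau> y \<and> owner y = g \<or> span_len (owner y) > span_len g \<or> span_len (owner x) > span_len g"
        unfolding eq q by blast
      have "\<forall>d\<in>G. C d x + C d y = (if d = g then 1 else 0)" using g(2) by (simp add: add.commute)
      then show ?thesis using g(1,3) swap[OF _ y] by blast
    qed
  qed
  have nz: "arc_form G x (\<tau> x) \<noteq> 0" if x: "x \<in> I" for x
  proof -
    obtain i j p q where eq: "partner x = (i, j)" "x = (p, q)" by fastforce
    have na: "non_arc x" using I[OF x] by simp
    have "p \<noteq> q" using na eq by (auto simp: non_arc_def low_def upp_def)
    moreover have "i \<noteq> j" using I[of "partner x"] I[OF x] eq by (auto simp: non_arc_def low_def upp_def)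
    moreover have "owner x \<in> G" using I[OF x] by simp
    moreover have "(k, k) \<notin> G" for k using G[of "(k, k)"] by (auto simp: is_arc_def)
    ultimately show ?thesis
      using partner_partner(4)[OF na eq] x eq(1)
      unfolding \<tau>_def eq(2) by (auto simp: arc_form_def)
  qed
  have uniq: "\<sigma> = \<tau>" if s: "\<sigma> permutes I" and "\<And>x. x \<in> I \<Longrightarrow> arc_form G x (\<sigma> x) \<noteq> 0" for \<sigma>
  proof (rule transversal_unique_by_weights[where own = owner and c = C and len = span_len and L = n
        and G = G and B = "arc_form G" and I = I, OF fin tau])
    show "span_len g \<le> n" if "g \<in> G" for g
      using G[OF that] by (auto simp: is_arc_def span_len_def)
    show "owner (\<tau> x) = owner x" if "x \<in> I" for x
      using that I partner_partner(2) by (simp add: \<tau>_def)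
  qed (use I C_partner edge that in \<open>auto simp: \<tau>_def\<close>)
  show "\<exists>x. \<forall>i\<in>I. (\<Sum>j\<in>I. arc_form G i j * x j) = r i"
    by (rule unique_transversal_solvable[where B = "arc_form G" and I = I and \<tau> = \<tau>, OF fin tau nz uniq])
  show "x j = 0" if "\<And>i. i \<in> I \<Longrightarrow> (\<Sum>j\<in>I. arc_form G i j * x j) = 0" "j \<in> I"
    by (rule unique_transversal_injective[where B = "arc_form G" and I = I and \<tau> = \<tau>, OF fin tau nz uniq that])
qed

end

section \<open>The meander of the seaweed p\<close>

locale seaweed_meander =
  fixes a b n e :: nat
  assumes a_pos: "0 < a" and b_gt: "3 < b" and n_eq: "n = a + b"
    and e_less: "e < n" and e_inv: "[int e * (int a + 3) = 1] (mod int n)"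
begin

text \<open>Vertices are numbered from 0 here, but from 1 in \<open>block_reverse\<close>.\<close>

definition top_rev :: "nat \<Rightarrow> nat" where
  "top_rev i = (if i < a then a - 1 - i else 2 * a + b - 1 - i)"

definition bot_rev :: "nat \<Rightarrow> nat" where
  "bot_rev i = (if i < n - 3 then n - 4 - i else if i < n - 1 then 2 * n - 5 - i else i)"

definition top_block :: "nat \<Rightarrow> nat" where
  "top_block i = (if i < a then 0 else 1)"

definition bot_block :: "nat \<Rightarrow> nat" where
  "bot_block i = (if i < n - 3 then 0 else if i < n - 1 then 1 else 2)"

lemma n_ge: "5 \<le> n" using a_pos b_gt n_eq by simp

sublocale block_reversals n top_block bot_block top_rev bot_rev
proof
  fix i j :: nat
  show "top_rev i < n" "top_rev (top_rev i) = i" "top_block (top_rev i) = top_block i" if "i < n"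
    using that n_eq unfolding top_rev_def top_block_def by auto
  show "bot_rev i < n" "bot_rev (bot_rev i) = i" "bot_block (bot_rev i) = bot_block i" if "i < n"
    using that n_ge unfolding bot_rev_def bot_block_def by auto
  show "top_rev j < top_rev i" if "i < j" "j < n" "top_block i = top_block j"
    using that n_eq unfolding top_rev_def top_block_def by (auto split: if_splits)
  show "bot_rev j < bot_rev i" if "i < j" "j < n" "bot_block i = bot_block j"
    using that n_ge unfolding bot_rev_def bot_block_def by (auto split: if_splits)
qed

text \<open>Both reversals are reflections of the cyclic group of order \<open>n\<close>; in the coordinate \<open>J\<close> they
  are \<open>x \<mapsto> -1 - x\<close> and \<open>x \<mapsto> -x\<close>, so the meander visits \<open>0, -1, 1, -2, 2, \<dots>\<close> in this order.\<close>

definition J :: "nat \<Rightarrow> nat" where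
  "J i = nat (((- 2 - int i) * int e) mod int n)"

definition pos :: "nat \<Rightarrow> nat" where
  "pos i = (if 2 * J i < n then 2 * J i else 2 * (n - J i) - 1)"

lemma J_less: "J i < n"
proof -
  have "((- 2 - int i) * int e) mod int n < int n" using n_ge by simp
  then show ?thesis using n_ge unfolding J_def by (simp add: nat_less_iff)
qed

lemma int_J: "int (J i) = ((- 2 - int i) * int e) mod int n"
  using n_ge unfolding J_def by simp

lemma J_cong: "[int (J i) = (- 2 - int i) * int e] (mod int n)"
  unfolding int_J by (simp add: cong_def)

lemma J_eqI:
  assumes "[x = (- 2 - int i) * int e] (mod int n)" "0 \<le> x" "x < int n"
  shows "int (J i) = x"
  using assms unfolding int_J cong_def by simp

text \<open>Multiplication by \<open>a + 3\<close> undoes the factor \<open>e\<close>.\<close>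

lemma J_inj:
  assumes "J i = J j" "i < n" "j < n" shows "i = j"
proof -
  have "[(- 2 - int i) * int e = (- 2 - int j) * int e] (mod int n)"
    using J_cong[of i] J_cong[of j] assms(1) by (simp add: cong_def)
  then have "[(- 2 - int i) * int e * (int a + 3) = (- 2 - int j) * int e * (int a + 3)] (mod int n)"
    by (rule cong_scalar_right)
  moreover have "[(- 2 - int k) * int e * (int a + 3) = - 2 - int k] (mod int n)" for k
    using cong_scalar_left[OF e_inv, of "- 2 - int k"] by (simp add: mult.assoc)
  ultimately have "[- 2 - int i = - 2 - int j] (mod int n)"
    by (meson cong_sym cong_trans)
  then have "[- 2 - int i + (2 + int i + int j) = - 2 - int j + (2 + int i + int j)] (mod int n)"
    by (intro cong_add cong_refl)
  then have "[int j = int i] (mod int n)" by simp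
  then show ?thesis using assms by (simp add: cong_def)
qed

lemma cong_mult_e:
  assumes "[x = y] (mod int n)" "[z = y * int e] (mod int n)"
  shows "[z = x * int e] (mod int n)"
  using cong_trans[OF assms(2) cong_sym[OF cong_scalar_right[OF assms(1), of "int e"]]] .

text \<open>Both branches of \<open>top_rev\<close> are \<open>a - 1 - i\<close> modulo
  \<open>n\<close>. About the centre -2 this is negation up to a shift by \<open>a + 3\<close>, and
  the factor \<open>e\<close> turns that shift into a shift by 1.\<close>

lemma J_top:
  assumes i: "i < n" shows "J (top_rev i) = n - 1 - J i"
proof -
  have 1: "[- 2 - int (top_rev i) = int i + 2 - (int a + 3)] (mod int n)"
  proof (cases "i < a")
    case True
    then have "int (top_rev i) = int a - 1 - int i" by (simp add: top_rev_def)
    then show ?thesis by (simp add: cong_def)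
  next
    case False
    then have "int (top_rev i) = int a + int n - 1 - int i"
      using i a_pos unfolding top_rev_def by (simp add: n_eq)
    then have eq: "- 2 - int (top_rev i) = int i + 2 - (int a + 3) - int n" by simp
    show ?thesis unfolding eq by (simp add: cong_iff_dvd_diff)
  qed
  have "[int n - 1 - int (J i) = 0 - 1 - (- 2 - int i) * int e] (mod int n)"
    by (intro cong_diff J_cong cong_refl) (simp add: cong_def)
  also have "[0 - 1 - (- 2 - int i) * int e = 0 - int e * (int a + 3) - (- 2 - int i) * int e] (mod int n)"
    by (intro cong_diff cong_sym[OF e_inv] cong_refl)
  also have "0 - int e * (int a + 3) - (- 2 - int i) * int e = (int i + 2 - (int a + 3)) * int e"
    by (simp add: algebra_simps)
  finally have "[int n - 1 - int (J i) = (- 2 - int (top_rev i)) * int e] (mod int n)"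
    by (rule cong_mult_e[OF 1])
  then have "int (J (top_rev i)) = int n - 1 - int (J i)"
    by (rule J_eqI) (use J_less[of i] in auto)
  then show ?thesis using J_less[of i] by linarith
qed

lemma J_0: "J (n - 2) = 0"
proof -
  have "int (J (n - 2)) = 0"
  proof (rule J_eqI)
    have "(- 2 - int (n - 2)) * int e = (- int e) * int n" using n_ge by (simp add: algebra_simps)
    then show "[0 = (- 2 - int (n - 2)) * int e] (mod int n)" by (simp add: cong_def)
  qed (use n_ge in auto)
  then show ?thesis by simp
qed

lemma J_n3: "J (n - 3) = e"
proof -
  have "int (J (n - 3)) = int e"
  proof (rule J_eqI)
    have eq: "(- 2 - int (n - 3)) * int e = int e + (- int e) * int n" using n_ge by (simp add: algebra_simps)
    show "[int e = (- 2 - int (n - 3)) * int e] (mod int n)" unfolding eq by (simp add: cong_iff_dvd_diff)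
  qed (use e_less in auto)
  then show ?thesis by simp
qed

lemma e_pos: "0 < e"
proof (rule ccontr)
  assume "\<not> 0 < e"
  then have "[0 = 1] (mod int n)" using e_inv by simp
  then show False using n_ge by (simp add: cong_def)
qed

lemma J_n1: "J (n - 1) = n - e"
proof -
  have "int (J (n - 1)) = int n - int e"
  proof (rule J_eqI)
    have "(- 2 - int (n - 1)) * int e = int n - int e + (- int e - 1) * int n"
      using n_ge by (simp add: algebra_simps)
    then show "[int n - int e = (- 2 - int (n - 1)) * int e] (mod int n)" by (simp add: cong_def)
  qed (use e_less e_pos in auto)
  then show ?thesis using e_less by linarith
qed

lemma J_pos: "i < n \<Longrightarrow> i \<noteq> n - 2 \<Longrightarrow> 0 < J i"
  using J_inj[of i "n - 2"] J_0 n_ge by fastforce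

text \<open>On the large bottom block the reversal is \<open>- 4 - i\<close> modulo
  \<open>n\<close>, a reflection about -2, which is why \<open>J\<close> is centred there. The
  blocks of sizes two and one do not follow this reflection, so the last three vertices are treated
  in \<open>pos_tail\<close>.\<close>

lemma J_bot:
  assumes i: "i < n - 3" shows "J (bot_rev i) = n - J i"
proof -
  have eq: "- 2 - int (bot_rev i) = int i + 2 + (-1) * int n"
    using i by (simp add: bot_rev_def)
  have 1: "[- 2 - int (bot_rev i) = int i + 2] (mod int n)"
    unfolding eq by (simp add: cong_iff_dvd_diff)
  have "[int n - int (J i) = 0 - (- 2 - int i) * int e] (mod int n)"
    by (intro cong_diff J_cong) (simp add: cong_def)
  also have "0 - (- 2 - int i) * int e = (int i + 2) * int e" by (simp add: algebra_simps)
  finally have "[int n - int (J i) = (- 2 - int (bot_rev i)) * int e] (mod int n)"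
    by (rule cong_mult_e[OF 1])
  then have "int (J (bot_rev i)) = int n - int (J i)"
    by (rule J_eqI) (use J_less[of i] J_pos[of i] i in auto)
  then show ?thesis using J_less[of i] by linarith
qed

lemma pos_double: "2 * J i < n \<Longrightarrow> pos i = 2 * J i" "\<not> 2 * J i < n \<Longrightarrow> Suc (pos i) = 2 * (n - J i)"
  using J_less[of i] by (simp_all add: pos_def)

lemma even_pos: "even (pos i) \<longleftrightarrow> 2 * J i < n"
proof (cases "2 * J i < n")
  case False
  then have "even (Suc (pos i))" using pos_double(2)[of i] by simp
  then show ?thesis using False by simp
qed (simp add: pos_double)

lemma pos_inj:
  assumes "pos i = pos j" "i < n" "j < n" shows "i = j"
proof -
  have "J i = J j"
    using assms(1) even_pos[of i] even_pos[of j] pos_double[of i] pos_double[of j] J_less[of i] J_less[of j]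
    by (cases "even (pos i)") auto
  then show ?thesis by (rule J_inj[OF _ assms(2,3)])
qed

lemma pos_top:
  assumes "i < n" "top_rev i \<noteq> i"
  shows "pos (top_rev i) = (if even (pos i) then pos i + 1 else pos i - 1)"
proof -
  have "J (top_rev i) \<noteq> J i" using assms J_inj[of "top_rev i" i] t_less by auto
  then show ?thesis
    using J_top[OF assms(1)] J_less[of i] pos_double[of i] pos_double[of "top_rev i"] even_pos[of i]
    by (cases "2 * J i < n"; cases "2 * J (top_rev i) < n") auto
qed

lemma pos_bot:
  assumes "i < n - 3" "bot_rev i \<noteq> i"
  shows "pos (bot_rev i) = (if even (pos i) then pos i - 1 else pos i + 1)" and "0 < pos i"
proof -
  have i: "i < n" using assms by simp
  have "J (bot_rev i) \<noteq> J i" using assms J_inj[of "bot_rev i" i] b_less[OF i] i by auto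
  moreover have "0 < J i" using J_pos[OF i] assms(1) by simp
  ultimately show "pos (bot_rev i) = (if even (pos i) then pos i - 1 else pos i + 1)" "0 < pos i"
    using J_bot[OF assms(1)] J_less[of i] pos_double[of i] pos_double[of "bot_rev i"] even_pos[of i]
    by (cases "2 * J i < n"; cases "2 * J (bot_rev i) < n"; auto)+
qed

text \<open>A vertex fixed by the top reversal has \<open>2 * J i = n - 1\<close>, hence an even
  place. In the next lemma a vertex fixed by the bottom reversal has \<open>2 * J i = n\<close>,
  hence an odd place.\<close>

lemma top_rev_odd: "i < n \<Longrightarrow> odd (pos i) \<Longrightarrow> top_rev i \<noteq> i"
  using J_top[of i] J_less[of i] even_pos[of i] by auto

lemma bot_rev_even: "i < n - 3 \<Longrightarrow> even (pos i) \<Longrightarrow> bot_rev i \<noteq> i"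
  using J_bot[of i] J_less[of i] J_pos[of i] even_pos[of i] by auto

lemma pos_n2: "pos (n - 2) = 0" using n_ge by (simp add: pos_def J_0)

text \<open>The vertices \<open>n - 3\<close> and \<open>n - 1\<close> have opposite coordinates
  \<open>e\<close> and \<open>n - e\<close>, so they are neighbours in the order of
  \<open>pos\<close>; which one comes first depends on the smaller coordinate. This is the only
  point at which the two cases of the theorem separate.\<close>

lemma pos_tail:
  shows "2 * e < n \<Longrightarrow> pos (n - 3) = 2 * e" and "2 * e < n \<Longrightarrow> pos (n - 1) = 2 * e - 1"
    and "n < 2 * e \<Longrightarrow> pos (n - 3) = 2 * (n - e) - 1" and "n < 2 * e \<Longrightarrow> pos (n - 1) = 2 * (n - e)"
  using e_less e_pos by (auto simp: pos_def J_n3 J_n1 simp del: One_nat_def)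

text \<open>The arcs below are those of \<open>a|b\<close> over \<open>c|2|1\<close>; \<open>\<kappa>\<close> is the arc of the block of size two.\<close>

abbreviation \<kappa> :: "nat \<times> nat" where "\<kappa> \<equiv> (n - 3, n - 2)"

lemma is_arc_cases:
  assumes "is_arc (i, j)"
  obtains "j < i" "i < n" "j = top_rev i" | "i < j" "j < n - 3" "j = bot_rev i" | "(i, j) = \<kappa>"
proof -
  have "j < i \<and> i < n \<and> j = top_rev i \<or> i < j \<and> j < n \<and> j = bot_rev i"
    using assms by (auto simp: is_arc_def)
  moreover have "j < n - 3 \<or> (i, j) = \<kappa>" if "i < j" "j < n" "j = bot_rev i"
    using that n_ge by (auto simp: bot_rev_def split: if_splits)
  ultimately show ?thesis using that by blast
qed

lemma kappa_is_arc: "is_arc \<kappa>"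
  using n_ge by (auto simp: is_arc_def bot_rev_def)

lemma arc_pos:
  assumes "is_arc (i, j)" "(i, j) \<noteq> \<kappa>"
  shows "j < i \<Longrightarrow> \<exists>m. {pos i, pos j} = {2 * m, 2 * m + 1}"
    and "i < j \<Longrightarrow> \<exists>m. {pos i, pos j} = {2 * m + 1, 2 * m + 2} \<and> i < n - 3 \<and> j < n - 3"
proof -
  show "\<exists>m. {pos i, pos j} = {2 * m, 2 * m + 1}" if "j < i"
    using assms(1)
  proof (cases rule: is_arc_cases)
    case 1
    then have p: "pos j = (if even (pos i) then pos i + 1 else pos i - 1)"
      using pos_top[of i] by auto
    show ?thesis
    proof (cases "even (pos i)")
      case True
      then obtain m where "pos i = 2 * m" by (elim evenE)
      then show ?thesis using p by (intro exI[of _ m]) auto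
    next
      case False
      then obtain m where "pos i = 2 * m + 1" by (elim oddE)
      then show ?thesis using p by (intro exI[of _ m]) auto
    qed
  qed (use that n_ge in auto)
  show "\<exists>m. {pos i, pos j} = {2 * m + 1, 2 * m + 2} \<and> i < n - 3 \<and> j < n - 3" if "i < j"
    using assms(1)
  proof (cases rule: is_arc_cases)
    case 2
    then have p: "pos j = (if even (pos i) then pos i - 1 else pos i + 1)" and z: "0 < pos i"
      and ij: "i < n - 3 \<and> j < n - 3"
      using pos_bot[of i] by auto
    show ?thesis
    proof (cases "even (pos i)")
      case True
      then obtain m where "pos i = 2 * m" by (elim evenE)
      then show ?thesis using p z ij by (intro exI[of _ "m - 1"]) (auto simp: algebra_simps)
    next
      case False
      then obtain m where "pos i = 2 * m + 1" by (elim oddE)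
      then show ?thesis using p ij by (intro exI[of _ m]) auto
    qed
  qed (use that assms(2) in auto)
qed

text \<open>The indicator of the part of the linear order \<open>q\<close> beyond the edge
  \<open>d\<close>. The sign makes the value at the first end of \<open>d\<close> exceed the value
  at the second end by 1, whichever way \<open>d\<close> points.\<close>

definition cut :: "(nat \<Rightarrow> nat) \<Rightarrow> nat \<times> nat \<Rightarrow> nat \<Rightarrow> int" where
  "cut q d v = (case d of (i, j) \<Rightarrow>
     if q j < q i then of_bool (q i \<le> q v) else - of_bool (q j \<le> q v))"

lemma cut_arc:
  assumes inj: "\<And>i j. q i = q j \<Longrightarrow> i < n \<Longrightarrow> j < n \<Longrightarrow> i = j"
    and adj: "\<And>i j. (i, j) \<in> G \<Longrightarrow> i < n \<and> j < n \<and> (j, i) \<notin> G \<and> (q i = Suc (q j) \<or> q j = Suc (q i))"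
    and d: "d \<in> G" and ij: "(i, j) \<in> G"
  shows "cut q d i - cut q d j = (if d = (i, j) then 1 else 0)"
proof -
  obtain k l where kl: "d = (k, l)" by (cases d)
  have eq: "d = (i, j) \<longleftrightarrow> q i = q k \<and> q j = q l"
    using inj[of i k] inj[of j l] adj[OF ij] adj[OF d[unfolded kl]] by (auto simp: kl)
  have ne: "\<not> (q i = q l \<and> q j = q k)"
    using inj[of i l] inj[of j k] adj[OF ij] adj[OF d[unfolded kl]] d kl by auto
  consider "q i = Suc (q j)" "q k = Suc (q l)" | "q j = Suc (q i)" "q k = Suc (q l)"
    | "q i = Suc (q j)" "q l = Suc (q k)" | "q j = Suc (q i)" "q l = Suc (q k)"
    using adj[OF ij] adj[OF d[unfolded kl]] by blast
  then show ?thesis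
    unfolding eq unfolding cut_def kl prod.case by cases (use ne in \<open>auto simp: of_bool_def\<close>)
qed

lemma pair_div2:
  fixes x y m :: nat
  shows "{x, y} = {2 * m, 2 * m + 1} \<Longrightarrow> x div 2 = y div 2"
    and "{x, y} = {2 * m + 1, 2 * m + 2} \<Longrightarrow> x div 2 \<noteq> y div 2"
  by (auto simp: doubleton_eq_iff)

text \<open>Two vertices cannot be joined by both a top and a bottom arc, because such arcs join
  different pairs of neighbouring places. The arc \<open>\<kappa>\<close> is exempt: it doubles a
  top arc when the cycle has length two.\<close>

lemma arc_asym:
  assumes "is_arc (i, j)" "(i, j) \<noteq> \<kappa>" "(j, i) \<noteq> \<kappa>" shows "\<not> is_arc (j, i)"
proof
  assume ji: "is_arc (j, i)"
  have *: False if u: "is_arc (k, l)" "(k, l) \<noteq> \<kappa>" and v: "is_arc (l, k)" "(l, k) \<noteq> \<kappa>" and kl: "k < l" for k l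
  proof -
    obtain m where "{pos k, pos l} = {2 * m + 1, 2 * m + 2}" using arc_pos(2)[OF u kl] by blast
    moreover obtain m' where "{pos l, pos k} = {2 * m', 2 * m' + 1}" using arc_pos(1)[OF v kl] by blast
    ultimately show False using pair_div2 by metis
  qed
  have "i \<noteq> j" using assms(1) by (auto simp: is_arc_def)
  then show False using *[OF assms(1,2) ji assms(3)] *[OF ji assms(3,1,2)] by linarith
qed

lemma arc_less: "is_arc (i, j) \<Longrightarrow> i < n \<and> j < n \<and> i \<noteq> j"
  by (auto simp: is_arc_def)

lemma adjacent_if:
  "{x, y} = {2 * m, 2 * m + 1} \<or> {x, y} = {2 * m + 1, 2 * m + 2} \<Longrightarrow> x = Suc y \<or> y = Suc (x :: nat)"
  by (auto simp: doubleton_eq_iff)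

lemma arc_adjacent: "is_arc (i, j) \<Longrightarrow> (i, j) \<noteq> \<kappa> \<Longrightarrow> pos i = Suc (pos j) \<or> pos j = Suc (pos i)"
  using arc_pos[of i j] arc_less[of i j] adjacent_if by (metis linorder_neqE_nat)

subsection \<open>The case of a single path\<close>

text \<open>For \<open>2 * e < n\<close> the edge between the places \<open>2 * e - 1\<close> and
  \<open>2 * e\<close> is missing, while \<open>\<kappa>\<close> joins place 0 to place
  \<open>2 * e\<close>. The path therefore runs through the initial piece backwards and continues in
  the old order.\<close>

definition path_pos :: "nat \<Rightarrow> nat" where
  "path_pos i = (if pos i < 2 * e then 2 * e - 1 - pos i else pos i)"

lemma path_pos_inj: "path_pos i = path_pos j \<Longrightarrow> i < n \<Longrightarrow> j < n \<Longrightarrow> i = j"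
  by (rule pos_inj) (auto simp: path_pos_def split: if_splits)

text \<open>Top arcs stay within a pair of places \<open>2 * k\<close>, \<open>2 * k + 1\<close>, so
  only a bottom arc at the vertex of place \<open>2 * m\<close> could cross. That vertex is among
  the last three, where \<open>\<kappa>\<close> is the only bottom arc.\<close>

lemma no_crossing:
  assumes "is_arc (i, j)" "(i, j) \<noteq> \<kappa>" and m: "pos v = 2 * m" "0 < m" "v < n"
    and w: "pos w = 2 * m - 1" "w < n"
    and vw: "n - 3 \<le> v" 
  shows "pos i < 2 * m \<longleftrightarrow> pos j < 2 * m"
proof (rule ccontr)
  assume cross: "\<not> ?thesis"
  consider "j < i" | "i < j" using arc_less[OF assms(1)] by linarith
  then show False
  proof cases
    case 1
    then obtain k where "{pos i, pos j} = {2 * k, 2 * k + 1}" using arc_pos(1)[OF assms(1,2)] by blast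
    then have "pos i div 2 = pos j div 2" by (rule pair_div2)
    moreover have "p < 2 * m \<longleftrightarrow> p div 2 < m" for p :: nat by linarith
    ultimately show False using cross by simp
  next
    case 2
    then obtain k where k: "{pos i, pos j} = {2 * k + 1, 2 * k + 2}" and ij: "i < n - 3" "j < n - 3"
      using arc_pos(2)[OF assms(1,2)] by blast
    have "pos i = 2 * m \<or> pos j = 2 * m"
    proof -
      consider "pos i = 2 * k + 1" "pos j = 2 * k + 2" | "pos i = 2 * k + 2" "pos j = 2 * k + 1"
        using k by (auto simp: doubleton_eq_iff)
      then show ?thesis by cases (use cross in linarith)+
    qed
    then have "i = v \<or> j = v" using pos_inj[of i v] pos_inj[of j v] m arc_less[OF assms(1)] by auto
    then show False using vw ij by auto
  qed
qed

lemma path_arc_adjacent: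
  assumes e: "2 * e < n" and g: "is_arc (i, j)"
  shows "path_pos i = Suc (path_pos j) \<or> path_pos j = Suc (path_pos i)"
proof (cases "(i, j) = \<kappa>")
  case True
  then show ?thesis using pos_n2 pos_tail(1)[OF e] e_pos by (auto simp: path_pos_def)
next
  case False
  have "pos i < 2 * e \<longleftrightarrow> pos j < 2 * e"
    by (rule no_crossing[OF g False, of "n - 3" _ "n - 1"]) (use e_pos pos_tail(1,2)[OF e] n_ge in auto)
  then show ?thesis using arc_adjacent[OF g False] unfolding path_pos_def by auto
qed

lemma path_arc_asym:
  assumes e: "2 * e < n" and g: "is_arc (i, j)" shows "\<not> is_arc (j, i)"
proof
  assume g': "is_arc (j, i)"
  have *: False if u: "is_arc (n - 2, n - 3)"
  proof -
    have "\<exists>m. {pos (n - 2), pos (n - 3)} = {2 * m, 2 * m + 1}"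
      using arc_pos(1)[OF u] n_ge by auto
    then show False using pos_n2 pos_tail(1)[OF e] e_pos by (auto simp: doubleton_eq_iff)
  qed
  show False using arc_asym[OF g] g g' * by blast
qed

lemma path_cut:
  assumes "2 * e < n" "is_arc d" "is_arc (i, j)"
  shows "cut path_pos d i - cut path_pos d j = (if d = (i, j) then 1 else 0)"
proof (rule cut_arc[where G = "{d. is_arc d}"])
  show "k < n \<and> l < n \<and> (l, k) \<notin> {d. is_arc d} \<and>
      (path_pos k = Suc (path_pos l) \<or> path_pos l = Suc (path_pos k))" if "(k, l) \<in> {d. is_arc d}" for k l
    using that arc_less[of k l] path_arc_adjacent[OF assms(1), of k l] path_arc_asym[OF assms(1), of k l]
    by simp
qed (use assms in \<open>auto intro: path_pos_inj\<close>)

lemma is_arc_top: "i < n \<Longrightarrow> top_rev i \<noteq> i \<Longrightarrow> is_arc (i, top_rev i) \<or> is_arc (top_rev i, i)"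
  using t_t[of i] t_less[of i] by (auto simp: is_arc_def)

lemma is_arc_bot: "i < n \<Longrightarrow> bot_rev i \<noteq> i \<Longrightarrow> is_arc (i, bot_rev i) \<or> is_arc (bot_rev i, i)"
  using b_b[of i] b_less[of i] by (auto simp: is_arc_def)

text \<open>Every vertex has an arc to an earlier place, top arcs serving the odd places and bottom
  arcs the even ones. The exceptions are the start \<open>n - 2\<close> and the vertex
  \<open>n - 3\<close>, which \<open>\<kappa>\<close> joins directly to the start.\<close>

lemma path_connected:
  fixes h :: "nat \<Rightarrow> 'x"
  assumes e: "2 * e < n" and h: "\<And>i j. is_arc (i, j) \<Longrightarrow> h i = h j"
  shows "i < n \<Longrightarrow> h i = h (n - 2)"
proof (induction "pos i" arbitrary: i rule: less_induct)
  case less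
  have h': "h i = h j" if "is_arc (i, j) \<or> is_arc (j, i)" for i j using h that by metis
  consider "odd (pos i)" | "pos i = 0" | "even (pos i)" "0 < pos i" by auto
  then show ?case
  proof cases
    case 1
    have ne: "top_rev i \<noteq> i" by (rule top_rev_odd[OF less.prems 1])
    have "pos (top_rev i) < pos i" using pos_top[OF less.prems ne] 1 by (auto elim: oddE)
    then have "h (top_rev i) = h (n - 2)" by (rule less.hyps) (rule t_less[OF less.prems])
    then show ?thesis using h'[OF is_arc_top[OF less.prems ne]] by simp
  next
    case 2
    then have "i = n - 2" using pos_inj[of i "n - 2"] less.prems pos_n2 n_ge by simp
    then show ?thesis by simp
  next
    case 3
    show ?thesis
    proof (cases "i < n - 3")
      case True
      have ne: "bot_rev i \<noteq> i" by (rule bot_rev_even[OF True 3(1)])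
      have "pos (bot_rev i) < pos i" using pos_bot[OF True ne] 3 by auto
      then have "h (bot_rev i) = h (n - 2)" by (rule less.hyps) (rule b_less[OF less.prems])
      then show ?thesis using h'[OF is_arc_bot[OF less.prems ne]] by simp
    next
      case False
      have "i \<noteq> n - 2" using 3 pos_n2 by auto
      moreover have "i \<noteq> n - 1" using 3(1) pos_tail(2)[OF e] e_pos by auto
      ultimately have "i = n - 3" using False less.prems by linarith
      then show ?thesis using h[OF kappa_is_arc] by simp
    qed
  qed
qed

subsection \<open>The case of a path and a cycle\<close>

text \<open>The vertices off the cycle: the cycle fills the places before that of
  \<open>n - 1\<close>, which is \<open>2 * (n - e)\<close>.\<close>

definition side :: "nat \<Rightarrow> bool" where
  "side i \<longleftrightarrow> 2 * (n - e) \<le> pos i"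

lemma side_arc:
  assumes e: "n < 2 * e" and g: "is_arc (i, j)" shows "side i \<longleftrightarrow> side j"
proof (cases "(i, j) = \<kappa>")
  case True
  then show ?thesis using pos_n2 pos_tail(3)[OF e] e_less by (auto simp: side_def)
next
  case False
  have "pos i < 2 * (n - e) \<longleftrightarrow> pos j < 2 * (n - e)"
    by (rule no_crossing[OF g False, of "n - 1" _ "n - 3"])
      (use e_less pos_tail(3,4)[OF e] n_ge in auto)
  then show ?thesis unfolding side_def by auto
qed

lemma side_tail: "n < 2 * e \<Longrightarrow> \<not> side (n - 2) \<and> \<not> side (n - 3) \<and> side (n - 1)"
  using pos_n2 pos_tail(3,4) e_less by (auto simp: side_def)

text \<open>Without \<open>\<kappa>\<close> the cycle is opened, and the remaining arcs join
  neighbours in the linear order \<open>pos\<close>; a cycle itself would have no cuts.\<close>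

lemma cycle_cut:
  assumes "is_arc d" "d \<noteq> \<kappa>" "is_arc (i, j)" "(i, j) \<noteq> \<kappa>"
  shows "cut pos d i - cut pos d j = (if d = (i, j) then 1 else 0)"
proof (rule cut_arc[where G = "{d. is_arc d \<and> d \<noteq> \<kappa>}"])
  show "k < n \<and> l < n \<and> (l, k) \<notin> {d. is_arc d \<and> d \<noteq> \<kappa>} \<and>
      (pos k = Suc (pos l) \<or> pos l = Suc (pos k))" if "(k, l) \<in> {d. is_arc d \<and> d \<noteq> \<kappa>}" for k l
    using that arc_less[of k l] arc_adjacent[of k l] arc_asym[of k l] by blast
qed (use assms in \<open>auto intro: pos_inj\<close>)

text \<open>A block of size two has no position above the diagonal besides its arc. Hence every
  owner survives when \<open>\<kappa>\<close> is dropped from the set of arcs.\<close>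

lemma owner_ne_kappa:
  assumes "non_arc x" shows "owner x \<noteq> \<kappa>"
  using assms
proof (cases rule: non_arcE)
  case (1 i j)
  from 1(2,3) show ?thesis
    by (cases rule: low_cases) (use 1(1,2) n_ge in \<open>auto simp: owner_def low_def\<close>)
next
  case (2 i j)
  from 2(2,3) show ?thesis
    by (cases rule: upp_cases) (use 2(1,2) n_ge in \<open>auto simp: owner_def upp_def\<close>)
qed

end

section \<open>Matrices as functions, conjugation, and fixed points of formal power series\<close>

definition mm :: "nat \<Rightarrow> (nat \<Rightarrow> nat \<Rightarrow> 'a) \<Rightarrow> (nat \<Rightarrow> nat \<Rightarrow> 'a) \<Rightarrow> nat \<Rightarrow> nat \<Rightarrow> 'a :: comm_ring_1" where
  "mm n A B i j = (\<Sum>k<n. A i k * B k j)"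

lemma mm_assoc: "mm n (mm n A B) C = mm n A (mm n B C)"
proof (intro ext)
  fix i j
  have "mm n (mm n A B) C i j = (\<Sum>l<n. \<Sum>k<n. A i k * B k l * C l j)"
    by (simp add: mm_def sum_distrib_right)
  also have "\<dots> = (\<Sum>k<n. \<Sum>l<n. A i k * B k l * C l j)" by (rule sum.swap)
  also have "\<dots> = mm n A (mm n B C) i j" by (simp add: mm_def sum_distrib_left mult.assoc)
  finally show "mm n (mm n A B) C i j = mm n A (mm n B C) i j" .
qed

lemma mm_distrib:
  "mm n (A + B) C = mm n A C + mm n B C" "mm n A (B + C) = mm n A B + mm n A C"
  "mm n (A - B) C = mm n A C - mm n B C" "mm n A (B - C) = mm n A B - mm n A C"
  "mm n 0 A = 0" "mm n A 0 = 0" "mm n (- A) B = - mm n A B" "mm n A (- B) = - mm n A B"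
  by (auto intro!: ext simp: mm_def algebra_simps sum.distrib sum_subtractf sum_negf)

text \<open>\<open>conj_by n x M\<close> is \<open>(1 + x) M (1 - x)\<close>; for \<open>x\<^sup>2 = 0\<close> it is a conjugation.\<close>

definition conj_by :: "nat \<Rightarrow> (nat \<Rightarrow> nat \<Rightarrow> 'a) \<Rightarrow> (nat \<Rightarrow> nat \<Rightarrow> 'a) \<Rightarrow> nat \<Rightarrow> nat \<Rightarrow> 'a :: comm_ring_1" where
  "conj_by n x M = M + mm n x M - mm n M x - mm n x (mm n M x)"

text \<open>Since \<open>(1 + x) (1 - x) = 1\<close>, this is the invariance of the commutator under
  conjugation.\<close>

lemma commutator_conj_by:
  assumes x: "mm n x x = 0" and Z_def: "Z = conj_by n (- x) K" and \<Psi>_def: "\<Psi> = conj_by n x \<Phi>"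
  shows "mm n Z \<Phi> - mm n \<Phi> Z = conj_by n (- x) (mm n K \<Psi> - mm n \<Psi> K)"
proof -
  have xx: "mm n x (mm n x A) = 0" for A
    using x by (metis mm_assoc mm_distrib(5))
  have xx': "mm n A (mm n x x) = 0" for A using x by (simp add: mm_distrib)
  show ?thesis
    unfolding Z_def \<Psi>_def conj_by_def
    by (simp add: mm_distrib mm_assoc x xx xx')
qed

definition fps_agree :: "nat \<Rightarrow> 'a fps \<Rightarrow> 'a :: comm_ring_1 fps \<Rightarrow> bool" where
  "fps_agree m f g \<longleftrightarrow> (\<forall>k<m. fps_nth f k = fps_nth g k)"

lemma fps_agree_refl: "fps_agree m f f" by (simp add: fps_agree_def)

lemma fps_agree_arith:
  assumes "fps_agree m f f'" "fps_agree m g g'"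
  shows "fps_agree m (f + g) (f' + g')" "fps_agree m (f - g) (f' - g')" "fps_agree m (f * g) (f' * g')"
    "fps_agree m (- f) (- f')"
  using assms by (auto simp: fps_agree_def fps_mult_nth intro!: sum.cong)

lemma fps_agree_sum: "(\<And>i. i \<in> A \<Longrightarrow> fps_agree m (f i) (g i)) \<Longrightarrow> fps_agree m (sum f A) (sum g A)"
  by (induction A rule: infinite_finite_induct) (auto intro: fps_agree_arith fps_agree_refl)

text \<open>By \<open>causal\<close> the coefficient of degree \<open>m\<close> of
  \<open>H \<xi>\<close> depends only on the lower coefficients of \<open>\<xi>\<close>, so the
  coefficients are determined one after another. Iterating from 0, the \<open>k\<close>-th iterate
  is correct below degree \<open>k\<close>. The solution operator \<open>T\<close> may be an
  arbitrary choice, without linearity.\<close>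

lemma fps_fixpoint:
  fixes H :: "('i \<Rightarrow> 'a :: comm_ring_1 fps) \<Rightarrow> 'i \<Rightarrow> 'a fps" and T :: "('i \<Rightarrow> 'a) \<Rightarrow> 'i \<Rightarrow> 'a"
  assumes causal: "\<And>\<xi> \<xi>' m i. (\<And>j. fps_agree m (\<xi> j) (\<xi>' j)) \<Longrightarrow> fps_agree (Suc m) (H \<xi> i) (H \<xi>' i)"
  obtains \<xi> where "\<And>m i. fps_nth (\<xi> i) m = T (\<lambda>j. fps_nth (H \<xi> j) m) i"
proof -
  define step where "step \<xi> i = Abs_fps (\<lambda>m. T (\<lambda>j. fps_nth (H \<xi> j) m) i)" for \<xi> i
  define it where "it = (\<lambda>k. (step ^^ k) 0)"
  have it_Suc: "it (Suc k) = step (it k)" for k by (simp add: it_def)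
  have agree_step: "fps_agree (Suc m) (step \<xi> i) (step \<xi>' i)"
    if ag: "\<And>j. fps_agree m (\<xi> j) (\<xi>' j)" for m \<xi> \<xi>' i
  proof -
    have "fps_nth (H \<xi> l) k = fps_nth (H \<xi>' l) k" if "k < Suc m" for l k
      using causal[OF ag, where i = l] that by (simp add: fps_agree_def)
    then show ?thesis by (simp add: fps_agree_def step_def)
  qed
  have agree1: "fps_agree k (it k i) (it (Suc k) i)" for k i
  proof (induction k arbitrary: i)
    case 0
    show ?case by (simp add: fps_agree_def)
  next
    case (Suc k)
    then show ?case unfolding it_Suc[of k] it_Suc[of "Suc k"] by (intro agree_step) 
  qed
  have agree: "fps_agree k (it k i) (it (k + l) i)" for k l i
  proof (induction l)
    case (Suc l)
    have "fps_agree k (it (k + l) i) (it (k + Suc l) i)"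
      using agree1[of "k + l" i] by (simp add: fps_agree_def)
    with Suc show ?case by (simp add: fps_agree_def)
  qed (simp add: fps_agree_refl)
  define \<xi> where "\<xi> i = Abs_fps (\<lambda>m. fps_nth (it (Suc m) i) m)" for i
  have \<xi>: "fps_agree k (\<xi> i) (it k i)" for k i
    unfolding fps_agree_def
  proof (intro allI impI)
    fix m assume "m < k"
    then obtain l where "k = Suc m + l" using less_imp_Suc_add by fastforce
    then show "fps_nth (\<xi> i) m = fps_nth (it k i) m"
      using agree[of "Suc m" i l] by (simp add: \<xi>_def fps_agree_def)
  qed
  have "fps_nth (\<xi> i) m = T (\<lambda>j. fps_nth (H \<xi> j) m) i" for m i
  proof -
    have "fps_nth (\<xi> i) m = fps_nth (step (it m) i) m" by (simp add: \<xi>_def it_Suc)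
    also have "\<dots> = fps_nth (step \<xi> i) m"
      using agree_step[of m "it m" \<xi> i] \<xi>[of m] by (simp add: fps_agree_def)
    finally show ?thesis by (simp add: step_def)
  qed
  then show ?thesis by (rule that)
qed

lemma fps_agree_X: "fps_agree m f g \<Longrightarrow> fps_agree (Suc m) (fps_X * f) (fps_X * g)"
  by (auto simp: fps_agree_def less_Suc_eq_0_disj)

lemma fps_agree_mm:
  assumes "\<And>i j. fps_agree m (A i j) (A' i j)" "\<And>i j. fps_agree m (B i j) (B' i j)"
  shows "fps_agree m (mm n A B i j) (mm n A' B' i j)"
  unfolding mm_def by (intro fps_agree_sum fps_agree_arith assms)

lemma fps_agree_conj_by:
  assumes "\<And>i j. fps_agree m (x i j) (x' i j)"
  shows "fps_agree m (conj_by n x M i j) (conj_by n x' M i j)"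
  unfolding conj_by_def plus_fun_apply minus_apply
  by (intro fps_agree_arith fps_agree_mm fps_agree_refl assms)

text \<open>There is one vector more than there are coordinates. A zero row pads the coordinate
  matrix to a square, singular one.\<close>

lemma exists_linear_relation:
  fixes z :: "nat \<Rightarrow> nat \<Rightarrow> 'a :: field"
  obtains c where "\<exists>m\<le>K. c m \<noteq> 0" "\<And>r. r < K \<Longrightarrow> (\<Sum>m\<le>K. c m * z m r) = 0"
proof -
  define A where "A = mat (Suc K) (Suc K) (\<lambda>(r, m). if r < K then z m r else 0)"
  have A: "A \<in> carrier_mat (Suc K) (Suc K)" by (simp add: A_def)
  have "transpose_mat A *\<^sub>v unit_vec (Suc K) K = 0\<^sub>v (Suc K)"
    by (rule eq_vecI) (auto simp: A_def)
  moreover have "unit_vec (Suc K) K \<noteq> (0\<^sub>v (Suc K) :: 'a vec)"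
    by simp
  ultimately have "det (transpose_mat A) = 0"
    using A by (subst det_0_iff_vec_prod_zero_field[of _ "Suc K"]) (auto intro!: exI[of _ "unit_vec (Suc K) K"])
  then have "det A = 0" using det_transpose[OF A] by simp
  then obtain v where v: "v \<in> carrier_vec (Suc K)" "v \<noteq> 0\<^sub>v (Suc K)" and Av: "A *\<^sub>v v = 0\<^sub>v (Suc K)"
    using det_0_iff_vec_prod_zero_field[OF A] by blast
  show ?thesis
  proof (rule that[of "\<lambda>m. v $ m"])
    show "\<exists>m\<le>K. v $ m \<noteq> 0"
    proof (rule ccontr)
      assume "\<not> ?thesis"
      then have "v = 0\<^sub>v (Suc K)" using v(1) by (intro eq_vecI) auto
      then show False using v(2) by simp
    qed
    fix r assume r: "r < K"
    have "(A *\<^sub>v v) $ r = (\<Sum>m\<le>K. z m r * v $ m)"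
      using r v(1) by (simp add: A_def scalar_prod_def atLeast0LessThan lessThan_Suc_atMost)
    then show "(\<Sum>m\<le>K. v $ m * z m r) = 0" using r by (simp add: Av mult.commute)
  qed
qed

section \<open>Degeneracy of a functional by deformation\<close>

locale matrix_pattern =
  fixes n :: nat and R :: "nat \<Rightarrow> nat \<Rightarrow> bool"
  assumes R_less: "R i j \<Longrightarrow> i < n \<and> j < n" and R_refl: "i < n \<Longrightarrow> R i i"
    and R_trans: "R i j \<Longrightarrow> R j k \<Longrightarrow> R i k"
begin

text \<open>A functional on the matrices with pattern \<open>R\<close> is given by a matrix \<open>F\<close> through
  \<open>A \<mapsto> \<Sum> F i j * A i j\<close>, hence the transposed pattern: the transpose of \<open>Z\<close> lies in the kernel of the
  form of \<open>F\<close> iff the commutator of \<open>Z\<close> and \<open>F\<close> vanishes on \<open>R\<close>.\<close>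

definition supported :: "(nat \<Rightarrow> nat \<Rightarrow> 'a :: comm_ring_1) \<Rightarrow> bool" where
  "supported Z \<longleftrightarrow> (\<forall>i j. Z i j \<noteq> 0 \<longrightarrow> R j i)"

definition form_ker :: "(nat \<Rightarrow> nat \<Rightarrow> 'a :: comm_ring_1) \<Rightarrow> (nat \<Rightarrow> nat \<Rightarrow> 'a) \<Rightarrow> bool" where
  "form_ker F Z \<longleftrightarrow> supported Z \<and> (\<forall>p q. R p q \<longrightarrow> mm n Z F p q = mm n F Z p q)"

definition scalar :: "(nat \<Rightarrow> nat \<Rightarrow> 'a :: comm_ring_1) \<Rightarrow> bool" where
  "scalar Z \<longleftrightarrow> (\<exists>c. \<forall>i<n. \<forall>j<n. Z i j = (if i = j then c else 0))"

lemma supported_mm: "supported A \<Longrightarrow> supported B \<Longrightarrow> supported (mm n A B)"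
  unfolding supported_def mm_def
proof (intro allI impI)
  fix i j assume A: "\<forall>i j. A i j \<noteq> 0 \<longrightarrow> R j i" and B: "\<forall>i j. B i j \<noteq> 0 \<longrightarrow> R j i"
    and nz: "(\<Sum>k<n. A i k * B k j) \<noteq> 0"
  then obtain k where "A i k * B k j \<noteq> 0" by (meson sum.neutral)
  then have "A i k \<noteq> 0" "B k j \<noteq> 0" by auto
  then have "R k i" "R j k" using A B by auto
  then show "R j i" using R_trans by blast
qed

lemma supported_add: "supported A \<Longrightarrow> supported B \<Longrightarrow> supported (A + B)"
  and supported_diff: "supported A \<Longrightarrow> supported B \<Longrightarrow> supported (A - B)"
  and supported_minus: "supported A \<Longrightarrow> supported (- A)"
  unfolding supported_def by (auto, metis add_0, metis diff_self) 

lemma supported_conj_by: "supported x \<Longrightarrow> supported M \<Longrightarrow> supported (conj_by n x M)"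
  unfolding conj_by_def by (intro supported_add supported_diff supported_mm)

text \<open>Matrices vanishing on \<open>R\<close> represent the zero functional, and supported
  matrices carry the transposed pattern; by transitivity they act on the former from both sides.
  This allows conjugating an equation that holds only on \<open>R\<close>.\<close>

lemma vanishing_mm:
  assumes "supported x" "\<And>p q. R p q \<Longrightarrow> M p q = 0" "R p q"
  shows "mm n x M p q = 0" "mm n M x p q = 0"
  unfolding mm_def using assms R_trans unfolding supported_def
  by (intro sum.neutral ballI; metis mult_zero_left mult_zero_right)+

lemma vanishing_conj_by:
  assumes "supported x" "\<And>p q. R p q \<Longrightarrow> M p q = 0" "R p q"
  shows "conj_by n x M p q = 0"
  using vanishing_mm[OF assms] vanishing_mm(1)[OF assms(1) vanishing_mm(2)[OF assms(1,2)] assms(3)] assms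
  by (simp add: conj_by_def)

text \<open>The coefficients of a formal kernel vector \<open>z\<close> of \<open>S + t F\<close> form an infinite chain
  \<open>[z\<^sub>m, S] = - [z\<^sub>m\<^sub>-\<^sub>1, F]\<close>. If the form of \<open>F\<close> were nondegenerate modulo scalars, a linear relation
  among the \<open>z\<^sub>m\<close> could be shifted down until \<open>z\<^sub>0\<close> itself is scalar.\<close>

lemma chain_imp_degenerate:
  fixes S F :: "nat \<Rightarrow> nat \<Rightarrow> 'a :: field"
  assumes supp: "\<And>m. supported (z m)"
    and z0: "\<And>p q. R p q \<Longrightarrow> mm n (z 0) S p q = mm n S (z 0) p q"
    and zm: "\<And>m p q. R p q \<Longrightarrow> mm n (z (Suc m)) S p q - mm n S (z (Suc m)) p q =
        mm n F (z m) p q - mm n (z m) F p q"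
    and nonscalar: "\<not> scalar (z 0)"
  shows "\<exists>Z. form_ker F Z \<and> \<not> scalar Z"
proof (rule ccontr)
  assume "\<not> ?thesis"
  then have ker: "scalar Z" if "form_ker F Z" for Z using that by blast
  obtain c where c: "\<exists>m\<le>n * n. c m \<noteq> 0"
    and rel: "\<And>r. r < n * n \<Longrightarrow> (\<Sum>m\<le>n * n. c m * z m (r div n) (r mod n)) = 0"
    using exists_linear_relation[where K = "n * n" and z = "\<lambda>m r. z m (r div n) (r mod n)"] by blast
  define M where "M = Max {m. m \<le> n * n \<and> c m \<noteq> 0}"
  have fin: "finite {m. m \<le> n * n \<and> c m \<noteq> 0}" by simp
  have "M \<in> {m. m \<le> n * n \<and> c m \<noteq> 0}" unfolding M_def using c by (intro Max_in) auto
  then have M: "M \<le> n * n" "c M \<noteq> 0" by auto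
  have beyond: "c m = 0" if "m \<le> n * n" "M < m" for m
  proof (rule ccontr)
    assume "c m \<noteq> 0"
    then have "m \<le> M" unfolding M_def using that(1) by (intro Max_ge[OF fin]) simp
    then show False using that(2) by simp
  qed
  \<comment> \<open>Here \<open>W 0\<close> is the relation itself, hence 0, and \<open>W M\<close>
    is \<open>c M * z 0\<close>.\<close>
  define W where "W l i j = (\<Sum>m\<in>{l..M}. c m * z (m - l) i j)" for l i j
  have W_supp: "supported (W l)" for l
    unfolding supported_def
  proof (intro allI impI)
    fix i j assume "W l i j \<noteq> 0"
    then obtain m where "c m * z (m - l) i j \<noteq> 0" unfolding W_def by (meson sum.neutral)
    then show "R j i" using supp unfolding supported_def by auto
  qed
  have W_mm: "mm n (W l) A p q = (\<Sum>m\<in>{l..M}. c m * mm n (z (m - l)) A p q)"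
    "mm n A (W l) p q = (\<Sum>m\<in>{l..M}. c m * mm n A (z (m - l)) p q)" for l A p q
  proof -
    have "mm n (W l) A p q = (\<Sum>k<n. \<Sum>m\<in>{l..M}. c m * z (m - l) p k * A k q)"
      by (simp add: mm_def W_def sum_distrib_right)
    also have "\<dots> = (\<Sum>m\<in>{l..M}. \<Sum>k<n. c m * z (m - l) p k * A k q)" by (rule sum.swap)
    finally show "mm n (W l) A p q = (\<Sum>m\<in>{l..M}. c m * mm n (z (m - l)) A p q)"
      by (simp add: mm_def sum_distrib_left mult.assoc)
    have "mm n A (W l) p q = (\<Sum>k<n. \<Sum>m\<in>{l..M}. c m * (A p k * z (m - l) k q))"
      by (simp add: mm_def W_def sum_distrib_left mult.left_commute)
    also have "\<dots> = (\<Sum>m\<in>{l..M}. \<Sum>k<n. c m * (A p k * z (m - l) k q))" by (rule sum.swap)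
    finally show "mm n A (W l) p q = (\<Sum>m\<in>{l..M}. c m * mm n A (z (m - l)) p q)"
      by (simp add: mm_def sum_distrib_left)
  qed
  have W_step: "mm n (W l) S p q - mm n S (W l) p q = mm n F (W (Suc l)) p q - mm n (W (Suc l)) F p q"
    if "R p q" "l \<le> M" for l p q
  proof -
    define g where "g m = mm n (z m) S p q - mm n S (z m) p q" for m
    define h where "h m = mm n F (z m) p q - mm n (z m) F p q" for m
    have "g 0 = 0" using z0[OF that(1)] by (simp add: g_def)
    have gh: "g (Suc m) = h m" for m using zm[OF that(1)] by (simp add: g_def h_def)
    have "mm n (W l) S p q - mm n S (W l) p q = (\<Sum>m\<in>{l..M}. c m * g (m - l))"
      by (simp add: W_mm g_def sum_subtractf right_diff_distrib)
    also have "\<dots> = c l * g (l - l) + (\<Sum>m\<in>{Suc l..M}. c m * g (m - l))"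
      using that(2) by (subst sum.atLeast_Suc_atMost) auto
    also have "\<dots> = (\<Sum>m\<in>{Suc l..M}. c m * g (m - l))" using \<open>g 0 = 0\<close> by simp
    also have "\<dots> = (\<Sum>m\<in>{Suc l..M}. c m * h (m - Suc l))"
      by (intro sum.cong refl) (metis Suc_diff_le atLeastAtMost_iff diff_Suc_Suc gh)
    also have "\<dots> = mm n F (W (Suc l)) p q - mm n (W (Suc l)) F p q"
      by (simp add: W_mm h_def sum_subtractf right_diff_distrib)
    finally show ?thesis .
  qed
  have W_scalar: "scalar (W l)" if "l \<le> M" for l
    using that
  proof (induction l)
    case 0
    have "W 0 i j = 0" if "i < n" "j < n" for i j
    proof -
      have "i * n + j < n * n"
      proof -
        have "i * n + j < Suc i * n" using that by simp
        also have "\<dots> \<le> n * n" using that by (intro mult_le_mono1) simp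
        finally show ?thesis .
      qed
      from rel[OF this] have "(\<Sum>m\<le>n * n. c m * z m i j) = 0" using that by simp
      moreover have "(\<Sum>m\<le>n * n. c m * z m i j) = (\<Sum>m\<in>{0..M}. c m * z m i j)"
        using M(1) beyond by (intro sum.mono_neutral_right) auto
      ultimately show ?thesis by (simp add: W_def)
    qed
    then show ?case unfolding scalar_def by (intro exI[of _ 0]) simp
  next
    case (Suc l)
    then obtain d where d: "\<And>i j. i < n \<Longrightarrow> j < n \<Longrightarrow> W l i j = (if i = j then d else 0)"
      unfolding scalar_def by auto
    \<comment> \<open>A scalar \<open>W l\<close> commutes with \<open>S\<close>, so by
      \<open>W_step\<close> the next one commutes with \<open>F\<close> on \<open>R\<close>.\<close>
    have "form_ker F (W (Suc l))"
      unfolding form_ker_def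
    proof (intro conjI allI impI)
      fix p q assume pq: "R p q"
      then have "p < n" "q < n" using R_less by auto
      then have "mm n (W l) S p q = d * S p q" "mm n S (W l) p q = S p q * d"
        unfolding mm_def using d by (simp_all add: sum.delta sum.delta' if_distrib[of "\<lambda>x. x * _"] if_distrib[of "\<lambda>x. _ * x"] cong: if_cong)
      then have "mm n (W l) S p q - mm n S (W l) p q = 0" by simp
      then show "mm n (W (Suc l)) F p q = mm n F (W (Suc l)) p q"
        using W_step[OF pq, of l] Suc.prems by simp
    qed (rule W_supp)
    then show ?case by (rule ker)
  qed
  from W_scalar[of M] obtain d where d: "\<And>i j. i < n \<Longrightarrow> j < n \<Longrightarrow> c M * z 0 i j = (if i = j then d else 0)"
    unfolding scalar_def W_def by auto
  have "scalar (z 0)"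
    unfolding scalar_def
  proof (intro exI allI impI)
    fix i j assume "i < n" "j < n"
    then show "z 0 i j = (if i = j then d / c M else 0)"
      using d[of i j] M(2) by (auto simp: field_simps split: if_splits)
  qed
  then show False using nonscalar by simp
qed

text \<open>The projection onto \<open>side\<close> commutes with \<open>S\<close>. Since bracketing
  with \<open>S\<close> is solvable between the sides, formal corrections exist to all orders for S
  + t F: conjugation by \<open>1 + x\<close> removes one off-diagonal block, and adding
  \<open>y\<close> to the projection compensates for the other. Conjugated back, this is a formal
  kernel element with nonscalar constant term.\<close>

lemma deformation_degenerate:
  fixes S F :: "nat \<Rightarrow> nat \<Rightarrow> 'a :: field" and side :: "nat \<Rightarrow> bool"
  assumes S: "\<And>i j. S i j \<noteq> 0 \<Longrightarrow> side i = side j"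
    and solvable: "\<And>r. \<exists>\<xi>. (\<forall>i j. \<xi> i j \<noteq> 0 \<longrightarrow> R j i \<and> side i \<noteq> side j) \<and>
      (\<forall>p q. R p q \<longrightarrow> side p \<noteq> side q \<longrightarrow> mm n \<xi> S p q - mm n S \<xi> p q = r (p, q))"
    and sides: "v < n" "side v" "w < n" "\<not> side w"
  shows "\<exists>Z. form_ker F Z \<and> \<not> scalar Z"
proof -
  define good where "good r \<xi> \<longleftrightarrow> (\<forall>i j. \<xi> (i, j) \<noteq> 0 \<longrightarrow> R j i \<and> side i \<noteq> side j) \<and>
      (\<forall>p q. R p q \<longrightarrow> side p \<noteq> side q \<longrightarrow>
        mm n (curry \<xi>) S p q - mm n S (curry \<xi>) p q = r (p, q))" for r \<xi> :: "nat \<times> nat \<Rightarrow> 'a"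
  have ex: "\<exists>\<xi>. good r \<xi>" for r
  proof -
    obtain \<xi> where "(\<forall>i j. \<xi> i j \<noteq> 0 \<longrightarrow> R j i \<and> side i \<noteq> side j) \<and>
      (\<forall>p q. R p q \<longrightarrow> side p \<noteq> side q \<longrightarrow> mm n \<xi> S p q - mm n S \<xi> p q = r (p, q))"
      using solvable by blast
    then show ?thesis unfolding good_def by (intro exI[of _ "\<lambda>(i, j). \<xi> i j"]) (simp add: curry_def)
  qed
  \<comment> \<open>A chosen solution of the homogeneous system need not be 0. Forcing
    \<open>T\<close> to send 0 to 0 makes \<open>\<xi>\<close> start in degree 1, so that the
    constant term of the kernel element is the projection.\<close>
  define T where "T r = (if r = (\<lambda>_. 0) then (\<lambda>_. 0) else SOME \<xi>. good r \<xi>)" for r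
  have T: "good r (T r)" for r
  proof (cases "r = (\<lambda>_. 0)")
    case True
    then show ?thesis by (simp add: T_def good_def mm_def)
  next
    case False
    then show ?thesis unfolding T_def using someI_ex[OF ex[of r]] by simp
  qed
  define S' F' where "S' i j = fps_const (S i j)" and "F' i j = fps_const (F i j)" for i j
  define xp yp :: "(nat \<times> nat \<Rightarrow> 'a fps) \<Rightarrow> nat \<Rightarrow> nat \<Rightarrow> 'a fps"
    where "xp \<xi> i j = (if side j then \<xi> (i, j) else 0)" and "yp \<xi> i j = (if side j then 0 else \<xi> (i, j))"
    for \<xi> i j
  define C where "C \<xi> = conj_by n (xp \<xi>) F'" for \<xi>
  \<comment> \<open>On the block with \<open>side q\<close> the equation for \<open>\<xi>\<close>
    will say that the conjugate \<open>\<Psi>\<close> vanishes (\<open>E1\<close>), on the opposite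
    block that the corrected projection commutes with \<open>\<Psi>\<close> (\<open>E2\<close>). The
    terms moved to this side all carry the factor \<open>fps_X\<close>, which is what makes
    \<open>H\<close> causal.\<close>
  define H where "H \<xi> = (\<lambda>(p, q). if side q then fps_X * - C \<xi> p q
      else if side p then fps_X * - (C \<xi> p q + mm n (yp \<xi>) (C \<xi>) p q - mm n (C \<xi>) (yp \<xi>) p q) else 0)" for \<xi>
  have causal: "fps_agree (Suc m) (H \<xi> i) (H \<xi>' i)" if ag: "\<And>j. fps_agree m (\<xi> j) (\<xi>' j)" for \<xi> \<xi>' m i
  proof -
    have x: "fps_agree m (xp \<xi> i j) (xp \<xi>' i j)" and y: "fps_agree m (yp \<xi> i j) (yp \<xi>' i j)" for i j
      using ag by (simp_all add: xp_def yp_def fps_agree_refl)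
    have C: "fps_agree m (C \<xi> i j) (C \<xi>' i j)" for i j
      unfolding C_def by (intro fps_agree_conj_by x)
    show ?thesis
      unfolding H_def by (auto split: prod.split simp: fps_agree_refl
          intro!: fps_agree_X fps_agree_arith(4) fps_agree_arith(1,2) fps_agree_mm C y
          simp del: mult_minus_right)
  qed
  obtain \<xi> where \<xi>: "\<And>m i. fps_nth (\<xi> i) m = T (\<lambda>j. fps_nth (H \<xi> j) m) i"
    using fps_fixpoint[of H T, OF causal] by blast
  have supp_\<xi>: "R j i \<and> side i \<noteq> side j" if nz: "\<xi> (i, j) \<noteq> 0" for i j
  proof -
    obtain m where "fps_nth (\<xi> (i, j)) m \<noteq> 0" using nz by (auto simp: fps_eq_iff)
    then show ?thesis using T[of "\<lambda>j. fps_nth (H \<xi> j) m"] unfolding \<xi> good_def by blast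
  qed
  have solve: "mm n (curry \<xi>) S' p q - mm n S' (curry \<xi>) p q = H \<xi> (p, q)"
    if pq: "R p q" "side p \<noteq> side q" for p q
  proof (rule fps_ext)
    fix m
    have "fps_nth (mm n (curry \<xi>) S' p q - mm n S' (curry \<xi>) p q) m =
        mm n (curry (T (\<lambda>j. fps_nth (H \<xi> j) m))) S p q - mm n S (curry (T (\<lambda>j. fps_nth (H \<xi> j) m))) p q"
      by (simp add: mm_def S'_def fps_sum_nth \<xi>)
    also have "\<dots> = fps_nth (H \<xi> (p, q)) m"
      using T[of "\<lambda>j. fps_nth (H \<xi> j) m"] pq unfolding good_def by blast
    finally show "fps_nth (mm n (curry \<xi>) S' p q - mm n S' (curry \<xi>) p q) m = fps_nth (H \<xi> (p, q)) m" .
  qed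
  have \<xi>0: "fps_nth (\<xi> i) 0 = 0" for i
  proof -
    have "(\<lambda>j. fps_nth (H \<xi> j) 0) = (\<lambda>_. 0)" by (auto simp: H_def fun_eq_iff)
    then show ?thesis unfolding \<xi> by (simp add: T_def)
  qed
  define x y where "x = xp \<xi>" and "y = yp \<xi>"
  have x: "R j i \<and> \<not> side i \<and> side j" if "x i j \<noteq> 0" for i j
    using that supp_\<xi>[of i j] by (auto simp: x_def xp_def split: if_splits)
  have y: "R j i \<and> side i \<and> \<not> side j" if "y i j \<noteq> 0" for i j
    using that supp_\<xi>[of i j] by (auto simp: y_def yp_def split: if_splits)
  have x0: "x i j = 0" if "side i \<or> \<not> side j" for i j using x that by blast
  have y0: "y i j = 0" if "\<not> side i \<or> side j" for i j using y that by blast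
  have S0: "S' i j = 0" if "side i \<noteq> side j" for i j using S that by (auto simp: S'_def)
  have \<xi>_xy: "curry \<xi> = x + y" by (auto simp: x_def y_def xp_def yp_def fun_eq_iff)
  have supp_x: "supported x" and supp_y: "supported y" using x y unfolding supported_def by blast+
  have xx: "mm n x x = 0"
  proof (intro ext)
    fix i j show "mm n x x i j = 0 i j"
      unfolding mm_def zero_fun_apply by (intro sum.neutral ballI) (use x0 in auto)
  qed
  define \<Phi> where "\<Phi> i j = S' i j + fps_X * F' i j" for i j
  define \<Psi> where "\<Psi> = conj_by n x \<Phi>"
  define CS where "CS = conj_by n x S'"
  have \<Psi>: "\<Psi> p q = CS p q + fps_X * C \<xi> p q" for p q
  proof -
    have 1: "mm n A \<Phi> i j = mm n A S' i j + fps_X * mm n A F' i j" for A i j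
      by (simp add: mm_def \<Phi>_def sum.distrib sum_distrib_left algebra_simps)
    have 2: "mm n \<Phi> A i j = mm n S' A i j + fps_X * mm n F' A i j" for A i j
      by (simp add: mm_def \<Phi>_def sum.distrib sum_distrib_left algebra_simps)
    have 3: "mm n x (mm n \<Phi> x) i j = mm n x (mm n S' x) i j + fps_X * mm n x (mm n F' x) i j" for i j
      unfolding mm_def[of n x "mm n \<Phi> x"] mm_def[of n x "mm n S' x"] mm_def[of n x "mm n F' x"] 2
      by (simp add: sum_distrib_left sum.distrib algebra_simps)
    show ?thesis
      unfolding \<Psi>_def CS_def C_def conj_by_def x_def[symmetric]
      by (simp add: 1 2 3 \<Phi>_def algebra_simps)
  qed
  have mm0: "mm n A B p q = 0" if "\<And>k. A p k = 0 \<or> B k q = 0" for A B :: "nat \<Rightarrow> nat \<Rightarrow> 'a fps" and p q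
    unfolding mm_def by (intro sum.neutral ballI) (use that in auto)
  have xS: "mm n x S' p q = 0" if "side p \<or> \<not> side q" for p q
    by (rule mm0) (use x0 S0 that in blast)
  have Sx: "mm n S' x p q = 0" if "side p \<or> \<not> side q" for p q
    by (rule mm0) (use x0 S0 that in blast)
  have xSx: "mm n x (mm n S' x) p q = 0" for p q
    by (rule mm0) (use x0 Sx in blast)
  have CS1: "CS p q = mm n x S' p q - mm n S' x p q" if "\<not> side p" "side q" for p q
    using that by (simp add: CS_def conj_by_def xSx S0)
  have CS2: "CS p q = S' p q" if "side p \<or> \<not> side q" for p q
    using that by (simp add: CS_def conj_by_def xSx xS Sx)
  have yz: "mm n y A p q = 0" if "\<not> side p" for A p q by (rule mm0) (use y0 that in blast)
  have zy: "mm n A y p q = 0" if "side q" for A p q by (rule mm0) (use y0 that in blast)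
  have xz: "mm n x A p q = 0" if "side p" for A p q by (rule mm0) (use x0 that in blast)
  have zx: "mm n A x p q = 0" if "\<not> side q" for A p q by (rule mm0) (use x0 that in blast)
  have E1: "\<Psi> p q = 0" if pq: "R p q" "\<not> side p" "side q" for p q
    using solve[OF pq(1)] pq
    by (simp add: \<xi>_xy mm_distrib yz zy H_def \<Psi> CS1)
  have E2: "\<Psi> p q + mm n y \<Psi> p q - mm n \<Psi> y p q = 0" if pq: "R p q" "side p" "\<not> side q" for p q
  proof -
    have "mm n y \<Psi> p q = mm n y CS p q + fps_X * mm n y (C \<xi>) p q"
      by (simp add: mm_def \<Psi> sum.distrib sum_distrib_left algebra_simps)
    moreover have "mm n \<Psi> y p q = mm n CS y p q + fps_X * mm n (C \<xi>) y p q"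
      by (simp add: mm_def \<Psi> sum.distrib sum_distrib_left algebra_simps)
    moreover have "mm n y CS p q = mm n y S' p q"
      unfolding mm_def by (intro sum.cong refl) (use CS2 pq in auto)
    moreover have "mm n CS y p q = mm n S' y p q"
      unfolding mm_def by (intro sum.cong refl) (use CS2 pq in auto)
    moreover have "mm n y S' p q - mm n S' y p q =
        fps_X * - (C \<xi> p q + mm n y (C \<xi>) p q - mm n (C \<xi>) y p q)"
      using solve[OF pq(1)] pq by (simp add: \<xi>_xy mm_distrib xz zx H_def y_def)
    moreover have "\<Psi> p q = fps_X * C \<xi> p q" using CS2[of p q] S0[of p q] pq by (simp add: \<Psi>)
    ultimately show ?thesis by (simp add: algebra_simps)
  qed
  define \<kappa> :: "nat \<Rightarrow> nat \<Rightarrow> 'a fps" where "\<kappa> i j = (if i = j \<and> i < n \<and> side i then 1 else 0)" for i j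
  \<comment> \<open>By \<open>E1\<close> the matrix \<open>\<Psi>\<close> is block triangular on
    \<open>R\<close>; \<open>y\<close> adapts the projection \<open>\<kappa>\<close> to the block
    that remains.\<close>
  define K where "K = \<kappa> + y"
  define M where "M = mm n K \<Psi> - mm n \<Psi> K"
  have M0: "M p q = 0" if pq: "R p q" for p q
  proof -
    have "p < n" "q < n" using R_less[OF pq] by auto
    have "mm n \<kappa> \<Psi> p q = (\<Sum>k<n. if k = p then (if side p then \<Psi> p q else 0) else 0)"
      unfolding mm_def \<kappa>_def using \<open>p < n\<close> by (intro sum.cong) auto
    then have k1: "mm n \<kappa> \<Psi> p q = (if side p then \<Psi> p q else 0)" using \<open>p < n\<close> by simp
    have "mm n \<Psi> \<kappa> p q = (\<Sum>k<n. if k = q then (if side q then \<Psi> p q else 0) else 0)"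
      unfolding mm_def \<kappa>_def using \<open>q < n\<close> by (intro sum.cong) auto
    then have k2: "mm n \<Psi> \<kappa> p q = (if side q then \<Psi> p q else 0)" using \<open>q < n\<close> by simp
    have y\<Psi>: "mm n y \<Psi> p q = 0" if "side q"
    proof (rule mm0)
      fix k show "y p k = 0 \<or> \<Psi> k q = 0"
        using E1[of k q] y[of p k] R_trans[of k p q] pq that by blast
    qed
    have \<Psi>y: "mm n \<Psi> y p q = 0" if "\<not> side p"
    proof (rule mm0)
      fix k show "\<Psi> p k = 0 \<or> y k q = 0"
        using E1[of p k] y[of k q] R_trans[of p q k] pq that by blast
    qed
    show ?thesis
    proof (cases "side p"; cases "side q")
      assume "side p" "side q"
      then show ?thesis using y\<Psi> zy by (simp add: M_def K_def mm_distrib k1 k2)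
    next
      assume "side p" "\<not> side q"
      then show ?thesis using E2[OF pq] by (simp add: M_def K_def mm_distrib k1 k2 algebra_simps)
    next
      assume "\<not> side p" "side q"
      then show ?thesis using E1[OF pq] yz zy by (simp add: M_def K_def mm_distrib k1 k2)
    next
      assume "\<not> side p" "\<not> side q"
      then show ?thesis using \<Psi>y yz by (simp add: M_def K_def mm_distrib k1 k2)
    qed
  qed
  define Z where "Z = conj_by n (- x) K"
  have supp_\<kappa>: "supported \<kappa>" unfolding supported_def \<kappa>_def using R_refl by auto
  have supp_Z: "supported Z"
    unfolding Z_def K_def by (intro supported_conj_by supported_minus supported_add supp_x supp_y supp_\<kappa>)
  have ker: "mm n Z \<Phi> p q - mm n \<Phi> Z p q = 0" if pq: "R p q" for p q
  proof -
    have "mm n Z \<Phi> p q - mm n \<Phi> Z p q = (mm n Z \<Phi> - mm n \<Phi> Z) p q" by simp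
    also have "\<dots> = conj_by n (- x) M p q"
      unfolding M_def by (simp only: commutator_conj_by[OF xx Z_def \<Psi>_def])
    also have "\<dots> = 0" by (rule vanishing_conj_by[OF supported_minus[OF supp_x] M0 pq])
    finally show ?thesis .
  qed
  define z where "z m i j = fps_nth (Z i j) m" for m i j
  have mz: "fps_nth (mm n Z \<Phi> p q - mm n \<Phi> Z p q) m =
      mm n (z m) S p q - mm n S (z m) p q +
      (case m of 0 \<Rightarrow> 0 | Suc k \<Rightarrow> mm n (z k) F p q - mm n F (z k) p q)" for m p q
  proof -
    have eq: "mm n Z \<Phi> p q - mm n \<Phi> Z p q = (mm n Z S' p q - mm n S' Z p q) +
        fps_X * (mm n Z F' p q - mm n F' Z p q)"
      by (simp add: mm_def \<Phi>_def sum.distrib sum_distrib_left algebra_simps)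
    have "fps_nth (mm n Z S' p q) k = mm n (z k) S p q" "fps_nth (mm n S' Z p q) k = mm n S (z k) p q"
      "fps_nth (mm n Z F' p q) k = mm n (z k) F p q" "fps_nth (mm n F' Z p q) k = mm n F (z k) p q" for k
      by (simp_all add: mm_def S'_def F'_def z_def fps_sum_nth)
    then show ?thesis unfolding eq by (simp split: nat.split)
  qed
  show ?thesis
  proof (rule chain_imp_degenerate)
    show "supported (z m)" for m
      using supp_Z unfolding supported_def z_def by (metis fps_zero_nth)
    show "mm n (z 0) S p q = mm n S (z 0) p q" if "R p q" for p q
      using mz[of p q 0] ker[OF that] by simp
    show "mm n (z (Suc m)) S p q - mm n S (z (Suc m)) p q = mm n F (z m) p q - mm n (z m) F p q"
      if "R p q" for m p q
      using mz[of p q "Suc m"] ker[OF that] by (simp add: algebra_simps)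
    have x00: "fps_nth (x i j) 0 = 0" and y00: "fps_nth (y i j) 0 = 0" for i j
      using \<xi>0 by (simp_all add: x_def y_def xp_def yp_def)
    have "fps_nth (mm n x A i j) 0 = 0" "fps_nth (mm n A x i j) 0 = 0" for A i j
      by (simp_all add: mm_def fps_sum_nth x00)
    then have z0: "z 0 i j = fps_nth (\<kappa> i j) 0" for i j
      by (simp add: z_def Z_def conj_by_def mm_distrib K_def y00)
    show "\<not> scalar (z 0)"
    proof
      assume "scalar (z 0)"
      then obtain c where "\<And>i j. i < n \<Longrightarrow> j < n \<Longrightarrow> z 0 i j = (if i = j then c else 0)"
        unfolding scalar_def by blast
      from this[of v v] this[of w w] show False using sides by (simp add: z0 \<kappa>_def)
    qed
  qed
qed

end

section \<open>The sum of the arc coordinates as a functional on p\<close>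

context block_reversals
begin

lemma partner_non_arc:
  assumes "non_arc x" shows "non_arc (partner x)"
  using assms
proof (cases rule: non_arcE)
  case (1 k l)
  from 1(2,3) show ?thesis
    by (cases rule: low_cases) (use 1 in \<open>auto simp: partner_def non_arc_def low_def t_t\<close>)
next
  case (2 k l)
  from 2(2,3) show ?thesis
    by (cases rule: upp_cases) (use 2 in \<open>auto simp: partner_def non_arc_def upp_def b_b\<close>)
qed

definition arc_mat :: "(nat \<times> nat) set \<Rightarrow> nat \<Rightarrow> nat \<Rightarrow> complex" where
  "arc_mat G i j = of_bool ((i, j) \<in> G)"

text \<open>This passes from systems indexed by positions to matrices: a row of the form is an entry
  of the commutator of the arc matrix with the transposed unknown.\<close>

lemma arc_form_sum:
  assumes I: "I \<subseteq> {..<n} \<times> {..<n}" and X: "\<And>i j. (i, j) \<notin> I \<Longrightarrow> X i j = 0" and pq: "p < n" "q < n"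
  shows "(\<Sum>y\<in>I. arc_form G (p, q) y * (case y of (i, j) \<Rightarrow> X i j)) =
    mm n (arc_mat G) (\<lambda>i j. X j i) p q - mm n (\<lambda>i j. X j i) (arc_mat G) p q"
proof -
  have "(\<Sum>y\<in>I. arc_form G (p, q) y * (case y of (i, j) \<Rightarrow> X i j)) =
      (\<Sum>y\<in>{..<n} \<times> {..<n}. arc_form G (p, q) y * (case y of (i, j) \<Rightarrow> X i j))"
    by (rule sum.mono_neutral_left) (use I X in auto)
  also have "\<dots> = (\<Sum>i<n. \<Sum>j<n. arc_form G (p, q) (i, j) * X i j)"
    by (simp add: sum.cartesian_product case_prod_unfold)
  also have "\<dots> = (\<Sum>i<n. \<Sum>j<n. (if i = q then arc_mat G p j * X i j else 0) -
      (if j = p then X i j * arc_mat G i q else 0))"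
    by (intro sum.cong refl) (auto simp: arc_form_def arc_mat_def)
  also have "\<dots> = (\<Sum>i<n. \<Sum>j<n. if i = q then arc_mat G p j * X i j else 0) -
      (\<Sum>i<n. \<Sum>j<n. if j = p then X i j * arc_mat G i q else 0)"
    by (simp add: sum_subtractf)
  also have "(\<Sum>i<n. \<Sum>j<n. if i = q then arc_mat G p j * X i j else 0) = (\<Sum>j<n. arc_mat G p j * X q j)"
  proof -
    have "(\<Sum>i<n. \<Sum>j<n. if i = q then arc_mat G p j * X i j else 0) =
        (\<Sum>i<n. if i = q then (\<Sum>j<n. arc_mat G p j * X q j) else 0)"
      by (intro sum.cong) auto
    then show ?thesis using pq by simp
  qed
  also have "(\<Sum>i<n. \<Sum>j<n. if j = p then X i j * arc_mat G i q else 0) = (\<Sum>i<n. X i p * arc_mat G i q)"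
    using pq by (intro sum.cong) auto
  finally show ?thesis by (simp add: mm_def)
qed

end

context seaweed_meander
begin

definition R :: "nat \<Rightarrow> nat \<Rightarrow> bool" where
  "R i j \<longleftrightarrow> i < n \<and> j < n \<and> (i = j \<or> low i j \<or> upp i j)"

lemma R_iff: "R i j \<longleftrightarrow> i < n \<and> j < n \<and> (i = j \<or> j < i \<and> (a \<le> j \<or> i < a) \<or>
    i < j \<and> (j < n - 3 \<or> i = n - 3 \<and> j = n - 2))"
  unfolding R_def low_def upp_def top_block_def bot_block_def using n_ge by auto

sublocale pat: matrix_pattern n R
proof
  show "R i j \<Longrightarrow> i < n \<and> j < n" for i j by (simp add: R_def)
  show "i < n \<Longrightarrow> R i i" for i by (simp add: R_def)
  show "R i j \<Longrightarrow> R j k \<Longrightarrow> R i k" for i j k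
    unfolding R_iff using b_gt n_eq by auto
qed

lemma R_cases:
  assumes "R i j"
  obtains "i = j" | "is_arc (i, j)" "i \<noteq> j" | "non_arc (i, j)" "\<not> is_arc (i, j)" "i \<noteq> j"
  using assms unfolding R_def low_def upp_def is_arc_def non_arc_def by auto

lemma non_arc_R: "non_arc (i, j) \<Longrightarrow> R i j \<and> \<not> is_arc (i, j) \<and> i \<noteq> j"
  by (auto simp: non_arc_def R_def low_def upp_def is_arc_def)

lemma is_arc_R: "is_arc (i, j) \<Longrightarrow> R i j"
  unfolding is_arc_def R_def low_def upp_def using tb_t bb_b by fastforce

text \<open>The positions between the two sides form a system of their own: no arc is among them,
  and they are closed under \<open>partner\<close> because an owner stays on one side. The
  transversal argument applies to this system alone and makes the deformation possible for every
  \<open>F\<close>.\<close>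

lemma cycle_degenerate:
  assumes e: "n < 2 * e"
  shows "\<exists>Z. pat.form_ker F Z \<and> \<not> pat.scalar (Z :: nat \<Rightarrow> nat \<Rightarrow> complex)"
proof -
  define G where "G = {d. is_arc d \<and> d \<noteq> \<kappa>}"
  define I where "I = {(i, j). R i j \<and> side i \<noteq> side j}"
  have I_non_arc: "non_arc (i, j)" if "(i, j) \<in> I" for i j
    using that side_arc[OF e, of i j] unfolding I_def by (auto elim: R_cases)
  have I_part: "non_arc x \<and> partner x \<in> I \<and> owner x \<in> G" if x: "x \<in> I" for x
  proof -
    obtain i j p q where eq: "partner x = (i, j)" "x = (p, q)" by fastforce
    have na: "non_arc x" using I_non_arc x eq by simp
    have arc: "is_arc (owner x)" by (rule owner_is_arc[OF na])
    have "non_arc (partner x)" by (rule partner_non_arc[OF na])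
    then have "R i j" using non_arc_R eq by simp
    moreover have "side i \<noteq> side j"
      using partner_partner(4)[OF na eq] arc side_arc[OF e] x unfolding I_def eq(2) by auto
    ultimately have "partner x \<in> I" unfolding eq(1) I_def by simp
    then show ?thesis using na arc owner_ne_kappa[OF na] by (simp add: G_def)
  qed
  have solv: "\<exists>x. \<forall>i\<in>I. (\<Sum>j\<in>I. arc_form G i j * x j) = r i" for r
  proof (rule arc_form_solvable[where c = "cut pos", OF I_part])
    show "is_arc g" if "g \<in> G" for g using that by (simp add: G_def)
    show "cut pos d i - cut pos d j = (if d = (i, j) then 1 else 0)" if "d \<in> G" "(i, j) \<in> G" for d i j
      using that cycle_cut by (simp add: G_def)
  qed
  have In: "I \<subseteq> {..<n} \<times> {..<n}" by (auto simp: I_def R_def)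
  show ?thesis
  proof (rule pat.deformation_degenerate[where side = side and S = "arc_mat G" and v = "n - 1" and w = "n - 2"])
    show "side i = side j" if "arc_mat G i j \<noteq> 0" for i j
      using that side_arc[OF e, of i j] by (auto simp: arc_mat_def G_def)
    show "\<exists>\<xi>. (\<forall>i j. \<xi> i j \<noteq> 0 \<longrightarrow> R j i \<and> side i \<noteq> side j) \<and>
        (\<forall>p q. R p q \<longrightarrow> side p \<noteq> side q \<longrightarrow>
          mm n \<xi> (arc_mat G) p q - mm n (arc_mat G) \<xi> p q = r (p, q))" for r
    proof -
      obtain x where x: "\<And>i. i \<in> I \<Longrightarrow> (\<Sum>j\<in>I. arc_form G i j * x j) = - r i"
        using solv[of "\<lambda>i. - r i"] by blast
      define X where "X i j = (if (i, j) \<in> I then x (i, j) else 0)" for i j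
      show ?thesis
      proof (intro exI[of _ "\<lambda>i j. X j i"] conjI allI impI)
        show "R j i" "side i \<noteq> side j" if "X j i \<noteq> 0" for i j
          using that by (auto simp: X_def I_def split: if_splits)
        fix p q assume pq: "R p q" "side p \<noteq> side q"
        then have pqI: "(p, q) \<in> I" by (simp add: I_def)
        have "(\<Sum>y\<in>I. arc_form G (p, q) y * (case y of (i, j) \<Rightarrow> X i j)) = - r (p, q)"
          unfolding x[OF pqI, symmetric] by (intro sum.cong refl) (auto simp: X_def)
        moreover have "(\<Sum>y\<in>I. arc_form G (p, q) y * (case y of (i, j) \<Rightarrow> X i j)) =
            mm n (arc_mat G) (\<lambda>i j. X j i) p q - mm n (\<lambda>i j. X j i) (arc_mat G) p q"
          by (rule arc_form_sum[OF In]) (use pq in \<open>auto simp: X_def R_def\<close>)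
        ultimately show "mm n (\<lambda>i j. X j i) (arc_mat G) p q - mm n (arc_mat G) (\<lambda>i j. X j i) p q = r (p, q)"
          by (simp add: algebra_simps)
      qed
    qed
  qed (use side_tail[OF e] n_ge in auto)
qed

text \<open>The entries are of three kinds. Those at arcs are isolated by a weighted trace, those at
  other off-diagonal positions vanish by the unique transversal, and then each arc equates the
  diagonal entries at its ends, which connectedness makes all equal.\<close>

lemma path_nondegenerate:
  assumes e: "2 * e < n" and ker: "pat.form_ker (arc_mat {d. is_arc d}) Z"
  shows "pat.scalar Z"
proof -
  define G where "G = {d. is_arc d}"
  define S where "S = arc_mat G"
  have supp: "R j i" if "Z i j \<noteq> 0" for i j using ker that unfolding pat.form_ker_def pat.supported_def by blast
  have comm: "mm n Z S p q = mm n S Z p q" if "R p q" for p q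
    using ker that unfolding pat.form_ker_def S_def G_def by blast
  have S: "S i j = of_bool (is_arc (i, j))" for i j by (simp add: S_def G_def arc_mat_def)
  have arc0: "Z l k = 0" if kl: "is_arc (k, l)" for k l
  proof -
    define c where "c v = (of_int (cut path_pos (k, l) v) :: complex)" for v
    have cc: "c i - c j = of_bool ((k, l) = (i, j))" if "is_arc (i, j)" for i j
      using path_cut[OF e kl that] unfolding c_def by (simp flip: of_int_diff)
    have entry: "(c p - c i) * S p i * Z i p = (if (p, i) = (k, l) then Z l k else 0)" for p i
    proof (cases "is_arc (p, i)")
      case True
      then show ?thesis using cc[OF True] by (auto simp: S)
    next
      case False
      then show ?thesis using kl by (auto simp: S)
    qed
    \<comment> \<open>The trace of the commutator against the diagonal matrix of \<open>c\<close>.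
      As \<open>c\<close> jumps only along the arc \<open>(k, l)\<close>, the entry of
      \<open>Z\<close> at this arc is all that remains.\<close>
    have "0 = (\<Sum>p<n. c p * (mm n S Z p p - mm n Z S p p))" using comm by (simp add: R_def)
    also have "\<dots> = (\<Sum>p<n. \<Sum>i<n. c p * (S p i * Z i p)) - (\<Sum>p<n. \<Sum>i<n. c p * (Z p i * S i p))"
      by (simp add: mm_def right_diff_distrib sum_subtractf sum_distrib_left)
    also have "(\<Sum>p<n. \<Sum>i<n. c p * (Z p i * S i p)) = (\<Sum>p<n. \<Sum>i<n. c i * (S p i * Z i p))"
      by (subst sum.swap) (simp add: mult.commute)
    also have "(\<Sum>p<n. \<Sum>i<n. c p * (S p i * Z i p)) - \<dots> = (\<Sum>p<n. \<Sum>i<n. (c p - c i) * S p i * Z i p)"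
      by (simp add: sum_subtractf[symmetric] algebra_simps)
    also have "\<dots> = (\<Sum>p<n. \<Sum>i<n. if (p, i) = (k, l) then Z l k else 0)"
      unfolding entry ..
    also have "\<dots> = (\<Sum>p<n. if p = k then (\<Sum>i<n. if i = l then Z l k else 0) else 0)"
      by (intro sum.cong refl) auto
    also have "\<dots> = Z l k" using arc_less[OF kl] by simp
    finally show ?thesis by simp
  qed
  define I where "I = {x. non_arc x}"
  have In: "I \<subseteq> {..<n} \<times> {..<n}" using non_arc_R by (auto simp: I_def R_def)
  have I_part: "non_arc x \<and> partner x \<in> I \<and> owner x \<in> G" if x: "x \<in> I" for x
  proof -
    have na: "non_arc x" using x by (simp add: I_def)
    have "non_arc (partner x)" by (rule partner_non_arc[OF na])
    then show ?thesis using na owner_is_arc[OF na] by (simp add: I_def G_def)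
  qed
  define X where "X i j = (if (i, j) \<in> I then Z j i else 0)" for i j
  have diag: "Z i j = X j i + (if i = j then Z i i else 0)" if "i < n" "j < n" for i j
  proof (cases "R j i")
    case True
    then show ?thesis
      by (cases rule: R_cases) (use arc0 non_arc_R in \<open>auto simp: X_def I_def\<close>)
  next
    case False
    then have "Z i j = 0" using supp by blast
    moreover have "i \<noteq> j" using False that by (auto simp: R_def)
    ultimately show ?thesis by (simp add: X_def)
  qed
  \<comment> \<open>The diagonal of \<open>Z\<close> contributes only where \<open>S\<close> is
    nonzero. At a non-arc this leaves an equation for \<open>X\<close> alone, and once
    \<open>X\<close> is 0 an arc gives an equation for the diagonal alone.\<close>
  have comm_diag: "mm n S Z p q - mm n Z S p q =
      (mm n S (\<lambda>i j. X j i) p q - mm n (\<lambda>i j. X j i) S p q) + S p q * (Z q q - Z p p)"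
    if "p < n" "q < n" for p q
  proof -
    have "S p k * Z k q = S p k * X q k + (if k = q then S p q * Z q q else 0)" if "k < n" for k
      unfolding diag[OF that \<open>q < n\<close>] by (simp add: distrib_left)
    then have "mm n S Z p q = (\<Sum>k<n. S p k * X q k + (if k = q then S p q * Z q q else 0))"
      by (simp add: mm_def)
    moreover have "Z p k * S k q = X k p * S k q + (if k = p then S p q * Z p p else 0)" if "k < n" for k
      unfolding diag[OF \<open>p < n\<close> that] by (simp add: distrib_right)
    then have "mm n Z S p q = (\<Sum>k<n. X k p * S k q + (if k = p then S p q * Z p p else 0))"
      by (simp add: mm_def)
    ultimately show ?thesis using that by (simp add: sum.distrib mm_def algebra_simps)
  qed
  have X0: "X i j = 0" for i j
  proof (cases "(i, j) \<in> I")
    case True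
    have "(case (i, j) of (i, j) \<Rightarrow> X i j) = 0"
    proof (rule arc_form_injective[where c = "cut path_pos" and G = G, OF I_part _ _ _ True])
      show "is_arc g" if "g \<in> G" for g using that by (simp add: G_def)
      show "cut path_pos d i - cut path_pos d j = (if d = (i, j) then 1 else 0)" if "d \<in> G" "(i, j) \<in> G" for d i j
        using that path_cut[OF e] by (simp add: G_def)
      show "(\<Sum>y\<in>I. arc_form G x y * (case y of (i, j) \<Rightarrow> X i j)) = 0" if x: "x \<in> I" for x
      proof -
        obtain p q where pq: "x = (p, q)" by (cases x)
        then have na: "non_arc (p, q)" using x by (simp add: I_def)
        then have "R p q" "\<not> is_arc (p, q)" and less: "p < n" "q < n"
          using non_arc_R by (auto simp: R_def)
        then have "mm n S (\<lambda>i j. X j i) p q - mm n (\<lambda>i j. X j i) S p q = 0"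
          using comm_diag[OF less] comm[of p q] by (simp add: S)
        then show ?thesis unfolding pq S_def
          by (subst arc_form_sum[OF In _ less]) (auto simp: X_def)
      qed
    qed
    then show ?thesis by simp
  qed (simp add: X_def)
  have "Z i i = Z j j" if ij: "is_arc (i, j)" for i j
    using comm_diag[of i j] comm[OF is_arc_R[OF ij]] arc_less[OF ij] ij by (simp add: X0 S mm_def)
  then have const: "Z i i = Z (n - 2) (n - 2)" if "i < n" for i
    using path_connected[OF e, of "\<lambda>i. Z i i" i] that by blast
  show ?thesis unfolding pat.scalar_def
  proof (intro exI allI impI)
    fix i j assume ij: "i < n" "j < n"
    show "Z i j = (if i = j then Z (n - 2) (n - 2) else 0)"
      unfolding diag[OF ij] X0 const[OF ij(1)] by simp
  qed
qed

end

section \<open>Index zero as the existence of a form with trivial kernel\<close>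

definition mat_subspace :: "nat \<Rightarrow> complex mat set \<Rightarrow> bool" where
  "mat_subspace N W \<longleftrightarrow> W \<subseteq> carrier_mat N N \<and> 0\<^sub>m N N \<in> W \<and>
     (\<forall>x\<in>W. \<forall>y\<in>W. x + y \<in> W) \<and> (\<forall>c. \<forall>x\<in>W. c \<cdot>\<^sub>m x \<in> W)"

lemma module_cmat: "Module.module class_ring (cmat_space N)"
  using matrix_vs[of N N, where 'a = complex] by (simp add: vectorspace_def)

lemma submodule_mat_iff: "LinearCombinations.submodule class_ring W (cmat_space N) \<longleftrightarrow> mat_subspace N W"
  unfolding LinearCombinations.submodule_def mat_subspace_def
  using module_cmat by (auto simp: module_mat_simps class_ring_simps)

lemma fin_dim_cmat: "vectorspace.fin_dim class_ring (cmat_space N)"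
proof -
  interpret V: vectorspace class_ring "cmat_space N" by (rule matrix_vs)
  define E where "E = (\<lambda>(i, j). mat N N (\<lambda>p. if p = (i, j) then 1 else 0 :: complex))"
  define A where "A = E ` ({..<N} \<times> {..<N})"
  have A: "A \<subseteq> carrier (cmat_space N)" by (auto simp: A_def E_def module_mat_simps)
  have sub: "mat_subspace N (V.span A)"
    using V.span_is_submodule[OF A] unfolding submodule_mat_iff .
  have in_span: "E p \<in> V.span A" if "p \<in> {..<N} \<times> {..<N}" for p
    using V.in_own_span[OF A] that unfolding A_def by blast
  have masked: "mat N N (\<lambda>p. if p \<in> S then M $$ p else 0) \<in> V.span A"
    if "S \<subseteq> {..<N} \<times> {..<N}" for S and M :: "complex mat"
  proof -
    have "finite S" using that by (rule finite_subset) simp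
    then show ?thesis using that
    proof (induction S)
      case empty
      have "mat N N (\<lambda>p. if p \<in> {} then M $$ p else 0) = 0\<^sub>m N N" by (rule eq_matI) auto
      then show ?case using sub by (simp add: mat_subspace_def)
    next
      case (insert q S)
      have "mat N N (\<lambda>p. if p \<in> insert q S then M $$ p else 0) =
          mat N N (\<lambda>p. if p \<in> S then M $$ p else 0) + (M $$ q) \<cdot>\<^sub>m E q"
        using insert.hyps by (intro eq_matI) (auto simp: E_def split: prod.split)
      moreover have "\<dots> \<in> V.span A"
        using sub insert in_span[of q] unfolding mat_subspace_def by blast
      ultimately show ?case by simp
    qed
  qed
  have "carrier_mat N N \<subseteq> V.span A"
  proof
    fix M :: "complex mat" assume "M \<in> carrier_mat N N"
    then have "M = mat N N (\<lambda>p. if p \<in> {..<N} \<times> {..<N} then M $$ p else 0)"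
      by (intro eq_matI) auto
    then show "M \<in> V.span A" using masked[OF order_refl, of M] by simp
  qed
  then have "V.gen_set A" using sub by (auto simp: mat_subspace_def module_mat_simps)
  then show ?thesis unfolding V.fin_dim_def using A by (intro exI[of _ A]) (simp add: A_def)
qed

text \<open>The dimension is a \<open>LEAST\<close> over the sizes of finite generating sets and
  says nothing until such a set is exhibited. A maximal independent subset of \<open>W\<close> is
  one; its size is bounded by the dimension of the ambient space.\<close>

lemma subspace_dim_0_iff:
  assumes W: "mat_subspace N W"
  shows "subspace_dim N W = 0 \<longleftrightarrow> W = {0\<^sub>m N N}"
proof -
  interpret V: vectorspace class_ring "cmat_space N" by (rule matrix_vs)
  have sm: "LinearCombinations.submodule class_ring W (cmat_space N)" using W by (simp add: submodule_mat_iff)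
  have "VectorSpace.subspace class_ring W (cmat_space N)" using sm V.vectorspace_axioms by (simp add: VectorSpace.subspace_def)
  then interpret W: vectorspace class_ring "V.vs W" by (rule V.subspace_is_vs)
  have WV: "W \<subseteq> carrier (cmat_space N)" using W by (simp add: mat_subspace_def module_mat_simps)
  have zero: "\<zero>\<^bsub>V.vs W\<^esub> = 0\<^sub>m N N" by (simp add: module_mat_simps)
  define P where "P k \<longleftrightarrow> (\<exists>A. finite A \<and> card A = k \<and> A \<subseteq> carrier (V.vs W) \<and> W.gen_set A)" for k
  have dim: "subspace_dim N W = (LEAST k. P k)"
    unfolding subspace_dim_def W.dim_def P_def ..
  have ex: "\<exists>k. P k"
  proof -
    have "finite A \<and> card A \<le> V.dim" if "A \<subseteq> W \<and> W.lin_indpt A" for A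
    proof -
      have "V.lin_indpt A" using that V.span_li_not_depend(2)[OF _ sm, of A] by simp
      then show ?thesis using V.li_le_dim[OF fin_dim_cmat, of A] that WV by auto
    qed
    moreover have "{} \<subseteq> W \<and> W.lin_indpt {}" by (auto simp: W.lin_dep_def)
    ultimately obtain A where "finite A" "maximal A (\<lambda>S. S \<subseteq> W \<and> W.lin_indpt S)"
      using maximal_exists[of "\<lambda>S. S \<subseteq> W \<and> W.lin_indpt S" V.dim "{}"] by blast
    then have "W.gen_set A" "A \<subseteq> W" using W.max_li_is_gen[of A] by (auto simp: maximal_def)
    then show ?thesis unfolding P_def using \<open>finite A\<close> by (intro exI[of _ "card A"] exI[of _ A]) simp
  qed
  have span_empty: "W.span {} = {0\<^sub>m N N}" using W.span_empty zero by simp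
  show ?thesis
  proof
    assume "subspace_dim N W = 0"
    then have "P 0" using LeastI_ex[OF ex] dim by simp
    then obtain A where "A = {}" "W.gen_set A" unfolding P_def by auto
    then show "W = {0\<^sub>m N N}" using span_empty by simp
  next
    assume "W = {0\<^sub>m N N}"
    then have "P 0" unfolding P_def using span_empty by (intro exI[of _ "{}"]) simp
    then show "subspace_dim N W = 0" unfolding dim by simp
  qed
qed

locale mat_lie_algebra =
  fixes N :: nat and g :: "complex mat set"
  assumes subspace: "mat_subspace N g"
    and bracket: "x \<in> g \<Longrightarrow> y \<in> g \<Longrightarrow> lie_bracket x y \<in> g"
begin

lemma g_carrier: "x \<in> g \<Longrightarrow> x \<in> carrier_mat N N"
  and g_zero: "0\<^sub>m N N \<in> g"
  and g_add: "x \<in> g \<Longrightarrow> y \<in> g \<Longrightarrow> x + y \<in> g"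
  and g_smult: "x \<in> g \<Longrightarrow> c \<cdot>\<^sub>m x \<in> g"
  using subspace by (auto simp: mat_subspace_def)

lemma lie_bracket_add_left:
  "x \<in> g \<Longrightarrow> x' \<in> g \<Longrightarrow> y \<in> g \<Longrightarrow> lie_bracket (x + x') y = lie_bracket x y + lie_bracket x' y"
  using g_carrier[of x] g_carrier[of x'] g_carrier[of y] unfolding lie_bracket_def
  by (simp add: add_mult_distrib_mat[of _ N N] mult_add_distrib_mat[of _ N N] del: Groups.diff_conv_add_uminus)
    (rule eq_matI; simp add: algebra_simps)

lemma lie_bracket_smult_left:
  "x \<in> g \<Longrightarrow> y \<in> g \<Longrightarrow> lie_bracket (c \<cdot>\<^sub>m x) y = c \<cdot>\<^sub>m lie_bracket x y"
  using g_carrier[of x] g_carrier[of y] unfolding lie_bracket_def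
  by (simp add: mult_smult_distrib[of _ N N _ N] mult_smult_assoc_mat[of _ N N _ N])
    (rule eq_matI; simp add: algebra_simps)

lemma lin_add: "linear_functional g f \<Longrightarrow> x \<in> g \<Longrightarrow> y \<in> g \<Longrightarrow> f (x + y) = f x + f y"
  and lin_smult: "linear_functional g f \<Longrightarrow> x \<in> g \<Longrightarrow> f (c \<cdot>\<^sub>m x) = c * f x"
  by (auto simp: linear_functional_def)

lemma lin_zero:
  assumes "linear_functional g f" shows "f (0\<^sub>m N N) = 0"
proof -
  have "0 \<cdot>\<^sub>m 0\<^sub>m N N = (0\<^sub>m N N :: complex mat)" by (rule eq_matI) auto
  then show ?thesis using lin_smult[OF assms g_zero, of 0] by simp
qed

lemma form_kernel_subspace:
  assumes f: "linear_functional g f" shows "mat_subspace N (form_kernel g f)"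
  unfolding mat_subspace_def form_kernel_def
proof (intro conjI ballI allI)
  show "{x \<in> g. \<forall>y\<in>g. f (lie_bracket x y) = 0} \<subseteq> carrier_mat N N" using g_carrier by auto
  have "lie_bracket (0\<^sub>m N N) y = 0\<^sub>m N N" if "y \<in> g" for y
    using g_carrier[OF that] unfolding lie_bracket_def by (simp add: minus_r_inv_mat)
  then show "0\<^sub>m N N \<in> {x \<in> g. \<forall>y\<in>g. f (lie_bracket x y) = 0}" using g_zero lin_zero[OF f] by simp
next
  fix x y assume "x \<in> {x \<in> g. \<forall>y\<in>g. f (lie_bracket x y) = 0}" "y \<in> {x \<in> g. \<forall>y\<in>g. f (lie_bracket x y) = 0}"
  then show "x + y \<in> {x \<in> g. \<forall>y\<in>g. f (lie_bracket x y) = 0}"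
    using g_add by (auto simp: lie_bracket_add_left lin_add[OF f] bracket)
next
  fix c x assume "x \<in> {x \<in> g. \<forall>y\<in>g. f (lie_bracket x y) = 0}"
  then show "c \<cdot>\<^sub>m x \<in> {x \<in> g. \<forall>y\<in>g. f (lie_bracket x y) = 0}"
    using g_smult by (auto simp: lie_bracket_smult_left lin_smult[OF f] bracket)
qed

text \<open>A minimum of naturals is 0 exactly when the value 0 occurs; the zero functional shows
  that the minimum is taken over a nonempty set.\<close>

lemma frobenius_iff:
  "frobenius N g \<longleftrightarrow> (\<exists>f. linear_functional g f \<and> (\<forall>x\<in>g. (\<forall>y\<in>g. f (lie_bracket x y) = 0) \<longrightarrow> x = 0\<^sub>m N N))"
proof -
  define P where "P k \<longleftrightarrow> (\<exists>f. linear_functional g f \<and> k = subspace_dim N (form_kernel g f))" for k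
  have "linear_functional g (\<lambda>_. 0)" by (simp add: linear_functional_def)
  then have ex: "\<exists>k. P k" unfolding P_def by blast
  have "frobenius N g \<longleftrightarrow> (LEAST k. P k) = 0" by (simp add: frobenius_def lie_index_def P_def)
  also have "\<dots> \<longleftrightarrow> P 0" using LeastI_ex[OF ex] by (metis Least_eq_0)
  also have "\<dots> \<longleftrightarrow> (\<exists>f. linear_functional g f \<and> form_kernel g f = {0\<^sub>m N N})"
    unfolding P_def using subspace_dim_0_iff[OF form_kernel_subspace] by metis
  also have "\<dots> \<longleftrightarrow> (\<exists>f. linear_functional g f \<and> (\<forall>x\<in>g. (\<forall>y\<in>g. f (lie_bracket x y) = 0) \<longrightarrow> x = 0\<^sub>m N N))"
  proof -
    have "form_kernel g f = {0\<^sub>m N N} \<longleftrightarrow> (\<forall>x\<in>g. (\<forall>y\<in>g. f (lie_bracket x y) = 0) \<longrightarrow> x = 0\<^sub>m N N)"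
      if "linear_functional g f" for f
    proof -
      have "0\<^sub>m N N \<in> form_kernel g f"
        using form_kernel_subspace[OF that] by (simp add: mat_subspace_def)
      then show ?thesis unfolding form_kernel_def by blast
    qed
    then show ?thesis by blast
  qed
  finally show ?thesis .
qed

text \<open>For \<open>X\<^sup>2 = 0\<close> the conjugation by \<open>1 + X\<close> is an automorphism of \<open>g\<close>, and
  \<open>- X M X = [X, [X, M]] / 2\<close>.\<close>

definition Ad :: "complex mat \<Rightarrow> complex mat \<Rightarrow> complex mat" where
  "Ad X M = (1\<^sub>m N + X) * M * (1\<^sub>m N - X)"

text \<open>Nondegeneracy is transported along the automorphism \<open>Ad X\<close>, with inverse
  given by \<open>- X\<close>. The last conclusion expresses the new functional through brackets
  only, since \<open>f\<close> is linear on \<open>g\<close> but not on arbitrary products of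
  matrices.\<close>

lemma Ad_nondegenerate:
  assumes f: "linear_functional g f"
    and nondeg: "\<And>x. x \<in> g \<Longrightarrow> (\<And>y. y \<in> g \<Longrightarrow> f (lie_bracket x y) = 0) \<Longrightarrow> x = 0\<^sub>m N N"
    and X: "X \<in> g" "X * X = 0\<^sub>m N N"
  obtains f' where "linear_functional g f'"
    and "\<And>x. x \<in> g \<Longrightarrow> (\<And>y. y \<in> g \<Longrightarrow> f' (lie_bracket x y) = 0) \<Longrightarrow> x = 0\<^sub>m N N"
    and "\<And>M. M \<in> g \<Longrightarrow> f' M = f M + f (lie_bracket X M) + 1/2 * f (lie_bracket X (lie_bracket X M))"
proof -
  have Xc: "X \<in> carrier_mat N N" by (rule g_carrier[OF X(1)])
  let ?I = "1\<^sub>m N :: complex mat"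
  have Ad_expand: "Ad Y M = M + lie_bracket Y M + (1/2) \<cdot>\<^sub>m lie_bracket Y (lie_bracket Y M)"
    if Y: "Y \<in> carrier_mat N N" "Y * Y = 0\<^sub>m N N" and M: "M \<in> carrier_mat N N" for Y M
  proof -
    have "Ad Y M = M + Y * M - M * Y - Y * M * Y"
      unfolding Ad_def using Y(1) M
      by (simp add: add_mult_distrib_mat[of _ N N _ _ N] mult_minus_distrib_mat[of _ N N _ N] assoc_mult_mat[of _ N N _ N _ N])
        (rule eq_matI; simp add: algebra_simps)
    moreover have "lie_bracket Y (lie_bracket Y M) = - 2 \<cdot>\<^sub>m (Y * M * Y)"
    proof -
      have 1: "Y * (Y * M) = 0\<^sub>m N N" using Y M by (simp add: assoc_mult_mat[symmetric, of _ N N _ N _ N])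
      have 2: "M * Y * Y = 0\<^sub>m N N" using Y M by (simp add: assoc_mult_mat[of _ N N _ N _ N])
      have "Y * (Y * M - M * Y) = - (Y * M * Y)"
        using Y M 1 by (simp add: mult_minus_distrib_mat[of _ N N _ N] assoc_mult_mat[of _ N N _ N _ N])
          (rule eq_matI; simp)
      moreover have "(Y * M - M * Y) * Y = Y * M * Y"
        using Y M 2 by (simp add: minus_mult_distrib_mat[of _ N N _ _ N]) (rule eq_matI; simp)
      ultimately show ?thesis unfolding lie_bracket_def using Y M by (intro eq_matI) auto
    qed
    ultimately show ?thesis
      unfolding lie_bracket_def[of Y M] using Y M by (intro eq_matI) auto
  qed
  have Ad_g: "Ad Y M \<in> g" if Y: "Y \<in> g" "Y * Y = 0\<^sub>m N N" and M: "M \<in> g" for Y M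
    unfolding Ad_expand[OF g_carrier[OF Y(1)] Y(2) g_carrier[OF M]]
    using Y M by (intro g_add g_smult bracket)
  have inv: "(?I - X) * (?I + X) = ?I" "(?I + X) * (?I - X) = ?I"
  proof -
    have "(?I - X) * (?I + X) = ?I + X - (X + X * X)"
      using Xc by (simp add: minus_mult_distrib_mat[of _ N N _ _ N] mult_add_distrib_mat[of _ N N _ N])
    then show "(?I - X) * (?I + X) = ?I" using X Xc by (auto intro!: eq_matI)
    have "(?I + X) * (?I - X) = ?I + X - (X + X * X)"
      using Xc by (simp add: add_mult_distrib_mat[of _ N N _ _ N] mult_minus_distrib_mat[of _ N N _ N])
    then show "(?I + X) * (?I - X) = ?I" using X Xc by (auto intro!: eq_matI)
  qed
  define E D where "E = ?I + X" and "D = ?I - X"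
  have E: "E \<in> carrier_mat N N" and D: "D \<in> carrier_mat N N" 
    unfolding E_def D_def by (rule add_carrier_mat[OF Xc], rule minus_carrier_mat[OF Xc])
  have DE: "D * E = ?I" "E * D = ?I" unfolding E_def D_def by (rule inv)+
  have Ad_eq: "Ad X M = E * M * D" for M by (simp add: Ad_def E_def D_def)
  have Ad_mult: "Ad X (x * y) = Ad X x * Ad X y" if "x \<in> carrier_mat N N" "y \<in> carrier_mat N N" for x y
  proof -
    have "Ad X x * Ad X y = E * x * (D * E) * y * D"
      unfolding Ad_eq using that E D by (simp add: assoc_mult_mat[of _ N N _ N _ N])
    then show ?thesis unfolding DE Ad_eq using that E D by (simp add: assoc_mult_mat[of _ N N _ N _ N])
  qed
  have Ad_minus: "Ad X (x - y) = Ad X x - Ad X y" if "x \<in> carrier_mat N N" "y \<in> carrier_mat N N" for x y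
    unfolding Ad_eq using that E D
    by (simp add: mult_minus_distrib_mat[of _ N N _ N] minus_mult_distrib_mat[of _ N N _ _ N])
  have Ad_bracket: "Ad X (lie_bracket x y) = lie_bracket (Ad X x) (Ad X y)"
    if "x \<in> carrier_mat N N" "y \<in> carrier_mat N N" for x y
    unfolding lie_bracket_def using that by (simp add: Ad_minus Ad_mult)
  define X' where "X' = - 1 \<cdot>\<^sub>m X"
  have X': "X' \<in> g" unfolding X'_def by (rule g_smult[OF X(1)])
  have X'X': "X' * X' = 0\<^sub>m N N"
    unfolding X'_def using Xc X by (simp add: mult_smult_distrib[of _ N N _ N] mult_smult_assoc_mat[of _ N N _ N])
  have "1\<^sub>m N + X' = D" "1\<^sub>m N - X' = E"
    unfolding X'_def D_def E_def using Xc by (auto intro!: eq_matI)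
  then have Ad'_eq: "Ad X' M = D * M * E" for M by (simp add: Ad_def)
  have cancel: "Ad X (Ad X' M) = M" "Ad X' (Ad X M) = M" if M: "M \<in> carrier_mat N N" for M
  proof -
    have "Ad X (Ad X' M) = (E * D) * M * (E * D)"
      unfolding Ad_eq Ad'_eq using M E D by (simp add: assoc_mult_mat[of _ N N _ N _ N])
    then show "Ad X (Ad X' M) = M" using M by (simp add: DE)
    have "Ad X' (Ad X M) = (D * E) * M * (D * E)"
      unfolding Ad_eq Ad'_eq using M E D by (simp add: assoc_mult_mat[of _ N N _ N _ N])
    then show "Ad X' (Ad X M) = M" using M by (simp add: DE)
  qed
  define f' where "f' M = f (Ad X M)" for M
  show ?thesis
  proof (rule that)
    have Ad_add: "Ad X (x + y) = Ad X x + Ad X y" if "x \<in> carrier_mat N N" "y \<in> carrier_mat N N" for x y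
      unfolding Ad_eq using that E D
      by (simp add: mult_add_distrib_mat[of _ N N _ N] add_mult_distrib_mat[of _ N N _ _ N])
    have Ad_smult: "Ad X (c \<cdot>\<^sub>m x) = c \<cdot>\<^sub>m Ad X x" if "x \<in> carrier_mat N N" for c x
      unfolding Ad_eq using that E D
      by (simp add: mult_smult_distrib[of _ N N _ N] mult_smult_assoc_mat[of _ N N _ N])
    show "linear_functional g f'"
      unfolding linear_functional_def f'_def
      using Ad_add Ad_smult Ad_g[OF X] g_carrier lin_add[OF f] lin_smult[OF f] by simp
    show "f' M = f M + f (lie_bracket X M) + 1/2 * f (lie_bracket X (lie_bracket X M))" if M: "M \<in> g" for M
      unfolding f'_def Ad_expand[OF Xc X(2) g_carrier[OF M]]
      using M X(1) by (simp add: lin_add[OF f] lin_smult[OF f] bracket g_add g_smult)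
    fix x assume x: "x \<in> g" and ker: "\<And>y. y \<in> g \<Longrightarrow> f' (lie_bracket x y) = 0"
    have "Ad X x = 0\<^sub>m N N"
    proof (rule nondeg)
      show "Ad X x \<in> g" by (rule Ad_g[OF X x])
      fix y assume y: "y \<in> g"
      have y': "Ad X' y \<in> g" by (rule Ad_g[OF X' X'X' y])
      have "f (lie_bracket (Ad X x) y) = f' (lie_bracket x (Ad X' y))"
        unfolding f'_def using Ad_bracket[OF g_carrier[OF x] g_carrier[OF y']] cancel(1)[OF g_carrier[OF y]] by simp
      then show "f (lie_bracket (Ad X x) y) = 0" using ker[OF y'] by simp
    qed
    then have "x = Ad X' (0\<^sub>m N N)" using cancel(2)[OF g_carrier[OF x]] by simp
    then show "x = 0\<^sub>m N N" unfolding Ad'_eq using E D by simp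
  qed
qed

end

section \<open>Type-D seaweeds described by the support of their entries\<close>

fun block_index :: "nat list \<Rightarrow> nat \<Rightarrow> nat" where
  "block_index [] i = 0"
| "block_index (s # ss) i = (if i < s then 0 else Suc (block_index ss (i - s)))"

lemma diag_block_mat_iff:
  fixes M :: "'a :: zero mat"
  shows "(\<exists>Bs. M = diag_block_mat Bs \<and> map dim_row Bs = ss \<and> map dim_col Bs = ss) \<longleftrightarrow>
    M \<in> carrier_mat (sum_list ss) (sum_list ss) \<and>
    (\<forall>i<sum_list ss. \<forall>j<sum_list ss. M $$ (i, j) \<noteq> 0 \<longrightarrow> block_index ss i = block_index ss j)"
proof (induction ss arbitrary: M)
  case Nil
  show ?case by (auto intro!: eq_matI)
next
  case (Cons s ss)
  let ?S = "sum_list ss"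
  show ?case
  proof
    assume "\<exists>Bs. M = diag_block_mat Bs \<and> map dim_row Bs = s # ss \<and> map dim_col Bs = s # ss"
    then obtain B Bs where M: "M = diag_block_mat (B # Bs)" and B: "dim_row B = s" "dim_col B = s"
      and Bs: "map dim_row Bs = ss" "map dim_col Bs = ss"
      by (auto simp: map_eq_Cons_conv)
    define D where "D = diag_block_mat Bs"
    have D: "D \<in> carrier_mat ?S ?S"
      "\<And>i j. i < ?S \<Longrightarrow> j < ?S \<Longrightarrow> D $$ (i, j) \<noteq> 0 \<Longrightarrow> block_index ss i = block_index ss j"
      using Cons.IH[of D] Bs D_def by blast+
    have M': "M = four_block_mat B (0\<^sub>m s ?S) (0\<^sub>m ?S s) D"
      using D(1) B unfolding M by (simp add: Let_def D_def[symmetric])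
    show "M \<in> carrier_mat (sum_list (s # ss)) (sum_list (s # ss)) \<and>
      (\<forall>i<sum_list (s # ss). \<forall>j<sum_list (s # ss). M $$ (i, j) \<noteq> 0 \<longrightarrow>
        block_index (s # ss) i = block_index (s # ss) j)"
      using D B unfolding M' by (auto split: if_splits)
  next
    assume R: "M \<in> carrier_mat (sum_list (s # ss)) (sum_list (s # ss)) \<and>
      (\<forall>i<sum_list (s # ss). \<forall>j<sum_list (s # ss). M $$ (i, j) \<noteq> 0 \<longrightarrow>
        block_index (s # ss) i = block_index (s # ss) j)"
    define B where "B = mat s s (\<lambda>p. M $$ p)"
    define D where "D = mat ?S ?S (\<lambda>(i, j). M $$ (i + s, j + s))"
    have "D \<in> carrier_mat ?S ?S" by (simp add: D_def)
    moreover have "block_index ss i = block_index ss j"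
      if "i < ?S" "j < ?S" "D $$ (i, j) \<noteq> 0" for i j
      using R[THEN conjunct2, rule_format, of "i + s" "j + s"] that by (simp add: D_def)
    ultimately obtain Bs where Bs: "D = diag_block_mat Bs" "map dim_row Bs = ss" "map dim_col Bs = ss"
      using Cons.IH[of D] by blast
    have dim: "dim_row M = s + ?S" "dim_col M = s + ?S" using R by auto
    have "M = diag_block_mat (B # Bs)"
    proof (rule eq_matI)
      show dims: "dim_row M = dim_row (diag_block_mat (B # Bs))" "dim_col M = dim_col (diag_block_mat (B # Bs))"
        using dim Bs(1)[symmetric] by (simp_all add: Let_def B_def D_def)
      fix i j assume "i < dim_row (diag_block_mat (B # Bs))" "j < dim_col (diag_block_mat (B # Bs))"
      then have ij: "i < s + ?S" "j < s + ?S" using Bs(1)[symmetric] by (simp_all add: Let_def B_def D_def)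
      have off: "M $$ (i, j) = 0" if "(i < s) \<noteq> (j < s)"
      proof (rule ccontr)
        assume "M $$ (i, j) \<noteq> 0"
        then have "block_index (s # ss) i = block_index (s # ss) j" using R ij by simp
        then show False using that by (auto split: if_splits)
      qed
      show "M $$ (i, j) = diag_block_mat (B # Bs) $$ (i, j)"
        using ij off Bs(1)[symmetric] by (auto simp: Let_def B_def D_def)
    qed
    then show "\<exists>Bs. M = diag_block_mat Bs \<and> map dim_row Bs = s # ss \<and> map dim_col Bs = s # ss"
      using Bs by (intro exI[of _ "B # Bs"]) (simp add: B_def)
  qed
qed

lemma block_diagonal_iff:
  assumes "2 * sum_list as \<le> 2 * n"
  shows "M \<in> block_diagonal n as \<longleftrightarrow> M \<in> carrier_mat (2 * n) (2 * n) \<and>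
    (\<forall>i<2 * n. \<forall>j<2 * n. M $$ (i, j) \<noteq> 0 \<longrightarrow>
      block_index (sym_blocks n as) i = block_index (sym_blocks n as) j)"
proof -
  have "sum_list (sym_blocks n as) = 2 * n" using assms by (simp add: sym_blocks_def)
  then show ?thesis
    unfolding block_diagonal_def using diag_block_mat_iff[of M "sym_blocks n as"] by simp
qed

text \<open>A matrix with the right support is split at the diagonal, the diagonal going to the
  lower part; both parts are generators. So the span is cut out by a condition on single
  entries.\<close>

lemma seaweed_D_iff:
  assumes "sum_list as \<le> n" "sum_list bs \<le> n"
  shows "M \<in> seaweed_D n as bs \<longleftrightarrow> M \<in> carrier_mat (2 * n) (2 * n) \<and>
    (\<forall>i<2 * n. \<forall>j<2 * n. M $$ (i, j) = - M $$ (2 * n - 1 - j, 2 * n - 1 - i)) \<and>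
    (\<forall>i<2 * n. \<forall>j<2 * n. M $$ (i, j) \<noteq> 0 \<longrightarrow>
      j \<le> i \<and> block_index (sym_blocks n as) i = block_index (sym_blocks n as) j \<or>
      i \<le> j \<and> block_index (sym_blocks n bs) i = block_index (sym_blocks n bs) j)"
proof -
  interpret V: vectorspace class_ring "cmat_space (2 * n)" by (rule matrix_vs)
  define P where "P i j \<longleftrightarrow>
      j \<le> i \<and> block_index (sym_blocks n as) i = block_index (sym_blocks n as) j \<or>
      i \<le> j \<and> block_index (sym_blocks n bs) i = block_index (sym_blocks n bs) j" for i j
  define X where "X = {M \<in> block_diagonal n as. lower_triangular M} \<union>
        {M \<in> block_diagonal n bs. upper_triangular M}"
  define W :: "complex mat set" where "W = {M \<in> carrier_mat (2 * n) (2 * n). \<forall>i<2 * n. \<forall>j<2 * n. M $$ (i, j) \<noteq> 0 \<longrightarrow> P i j}"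
  have bd: "M \<in> block_diagonal n cs \<longleftrightarrow> M \<in> carrier_mat (2 * n) (2 * n) \<and>
    (\<forall>i<2 * n. \<forall>j<2 * n. M $$ (i, j) \<noteq> 0 \<longrightarrow>
      block_index (sym_blocks n cs) i = block_index (sym_blocks n cs) j)" if "sum_list cs \<le> n" for M cs
    using that by (intro block_diagonal_iff) simp
  have triangle: "(\<forall>i<m. \<forall>j<i. T i j) \<longleftrightarrow> (\<forall>i<m. \<forall>j<m. \<not> T i j \<longrightarrow> i \<le> j)"
    for T :: "nat \<Rightarrow> nat \<Rightarrow> bool" and m :: nat
  proof -
    have "(\<forall>j<i. T i j) \<longleftrightarrow> (\<forall>j<m. \<not> T i j \<longrightarrow> i \<le> j)" if "i < m" for i
      using that by (meson leD leI less_trans)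
    then show ?thesis by blast
  qed
  have low: "lower_triangular M \<longleftrightarrow> (\<forall>i<2 * n. \<forall>j<2 * n. M $$ (i, j) \<noteq> 0 \<longrightarrow> j \<le> i)"
    if "M \<in> carrier_mat (2 * n) (2 * n)" for M
  proof -
    have "lower_triangular M \<longleftrightarrow> (\<forall>i<2 * n. \<forall>j<i. M $$ (j, i) = 0)"
      using that unfolding lower_triangular_def upper_triangular_def by auto
    then show ?thesis unfolding triangle by blast
  qed
  have upp: "upper_triangular M \<longleftrightarrow> (\<forall>i<2 * n. \<forall>j<2 * n. M $$ (i, j) \<noteq> 0 \<longrightarrow> i \<le> j)"
    if "M \<in> carrier_mat (2 * n) (2 * n)" for M :: "complex mat"
  proof -
    have "upper_triangular M \<longleftrightarrow> (\<forall>i<2 * n. \<forall>j<i. M $$ (i, j) = 0)"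
      using that unfolding upper_triangular_def by auto
    then show ?thesis unfolding triangle .
  qed
  have X_iff: "M \<in> X \<longleftrightarrow> M \<in> carrier_mat (2 * n) (2 * n) \<and>
      ((\<forall>i<2 * n. \<forall>j<2 * n. M $$ (i, j) \<noteq> 0 \<longrightarrow>
          j \<le> i \<and> block_index (sym_blocks n as) i = block_index (sym_blocks n as) j) \<or>
       (\<forall>i<2 * n. \<forall>j<2 * n. M $$ (i, j) \<noteq> 0 \<longrightarrow>
          i \<le> j \<and> block_index (sym_blocks n bs) i = block_index (sym_blocks n bs) j))" for M
  proof (cases "M \<in> carrier_mat (2 * n) (2 * n)")
    case True
    show ?thesis
      unfolding X_def Un_iff mem_Collect_eq bd[OF assms(1)] bd[OF assms(2)] low[OF True] upp[OF True]
      using True by blast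
  next
    case False
    then show ?thesis unfolding X_def Un_iff mem_Collect_eq bd[OF assms(1)] bd[OF assms(2)] by blast
  qed
  have XW: "X \<subseteq> W" unfolding W_def P_def using X_iff by blast
  have "mat_subspace (2 * n) W"
    unfolding mat_subspace_def W_def by (auto, metis add_0)
  then have sub_W: "LinearCombinations.submodule class_ring W (cmat_space (2 * n))"
    by (simp add: submodule_mat_iff)
  have Xc: "X \<subseteq> carrier (cmat_space (2 * n))" using X_iff by (auto simp: module_mat_simps)
  have sub_span: "mat_subspace (2 * n) (V.span X)"
    using V.span_is_submodule[OF Xc] by (simp add: submodule_mat_iff)
  have "V.span X = W"
  proof
    show "V.span X \<subseteq> W" by (rule V.span_is_subset[OF XW sub_W])
    show "W \<subseteq> V.span X"
    proof
      fix M assume M: "M \<in> W"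
      define Q where "Q = (\<lambda>(i, j). j \<le> i \<and> block_index (sym_blocks n as) i = block_index (sym_blocks n as) j)"
      define L where "L = mat (2 * n) (2 * n) (\<lambda>p. if Q p then M $$ p else 0)"
      define U where "U = mat (2 * n) (2 * n) (\<lambda>p. if Q p then 0 else M $$ p)"
      have "L \<in> X" unfolding X_iff by (auto simp: L_def Q_def split: if_splits)
      moreover have "U \<in> X"
        unfolding X_iff using M by (auto simp: U_def Q_def W_def P_def split: if_splits)
      moreover have "M = L + U" using M by (intro eq_matI) (auto simp: W_def L_def U_def)
      ultimately show "M \<in> V.span X"
        using V.in_own_span[OF Xc] sub_span unfolding mat_subspace_def by blast
    qed
  qed
  then have "seaweed_D n as bs = so_even n \<inter> W" by (simp add: seaweed_D_def X_def)
  moreover have "M = - antidiag_transpose M \<longleftrightarrow>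
      (\<forall>i<2 * n. \<forall>j<2 * n. M $$ (i, j) = - M $$ (2 * n - 1 - j, 2 * n - 1 - i))"
    if "M \<in> carrier_mat (2 * n) (2 * n)"
    using that by (subst mat_eq_iff) (auto simp: antidiag_transpose_def)
  ultimately show ?thesis by (auto simp: so_even_def W_def P_def)
qed

section \<open>Elements of the type-D seaweed as pairs of matrices\<close>

lemma sum_mirror_split:
  fixes f :: "nat \<Rightarrow> 'a :: comm_monoid_add"
  shows "(\<Sum>k<2 * n. f k) = (\<Sum>k<n. f k) + (\<Sum>k<n. f (2 * n - 1 - k))"
proof -
  have "{..<2 * n} = {..<n} \<union> {n..<2 * n}" by auto
  then have "(\<Sum>k<2 * n. f k) = (\<Sum>k\<in>{..<n} \<union> {n..<2 * n}. f k)" by (rule arg_cong)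
  also have "\<dots> = (\<Sum>k<n. f k) + (\<Sum>k\<in>{n..<2 * n}. f k)"
    by (rule sum.union_disjoint) auto
  also have "(\<Sum>k\<in>{n..<2 * n}. f k) = (\<Sum>k<n. f (2 * n - 1 - k))"
    by (rule sum.reindex_bij_witness[of _ "\<lambda>k. 2 * n - 1 - k" "\<lambda>k. 2 * n - 1 - k"]) auto
  finally show ?thesis .
qed

definition unit_fun :: "nat \<Rightarrow> nat \<Rightarrow> nat \<Rightarrow> nat \<Rightarrow> complex" where
  "unit_fun u v i j = of_bool (i = u \<and> j = v)"

definition wedge :: "nat \<Rightarrow> nat \<Rightarrow> nat \<Rightarrow> nat \<Rightarrow> complex" where
  "wedge x y i j = of_bool (i = x \<and> j = y) - of_bool (i = y \<and> j = x)"

text \<open>In the basis \<open>e\<^sub>0, \<dots>, e\<^sub>n\<^sub>-\<^sub>1\<close> followed by the mirrored dual basis, an element of the seaweed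
  is a pair of \<open>A\<close> in \<open>gl(n)\<close> and an alternating matrix \<open>B\<close>, on which \<open>A\<close> acts as on the second
  exterior power.\<close>

definition so_mat :: "nat \<Rightarrow> (nat \<Rightarrow> nat \<Rightarrow> complex) \<Rightarrow> (nat \<Rightarrow> nat \<Rightarrow> complex) \<Rightarrow> complex mat" where
  "so_mat n A B = mat (2 * n) (2 * n) (\<lambda>(i, j).
     if i < n then (if j < n then A i j else B i (2 * n - 1 - j))
     else (if j < n then 0 else - A (2 * n - 1 - j) (2 * n - 1 - i)))"

definition act :: "nat \<Rightarrow> (nat \<Rightarrow> nat \<Rightarrow> complex) \<Rightarrow> (nat \<Rightarrow> nat \<Rightarrow> complex) \<Rightarrow> nat \<Rightarrow> nat \<Rightarrow> complex" where
  "act n A B i j = (\<Sum>k<n. A i k * B k j) + (\<Sum>k<n. A j k * B i k)"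

lemma so_mat_carrier [simp]: "so_mat n A B \<in> carrier_mat (2 * n) (2 * n)"
  "dim_row (so_mat n A B) = 2 * n" "dim_col (so_mat n A B) = 2 * n"
  by (simp_all add: so_mat_def)

lemma so_mat_index:
  assumes "i < n" "j < n"
  shows "so_mat n A B $$ (i, j) = A i j" "so_mat n A B $$ (i, 2 * n - 1 - j) = B i j"
    "so_mat n A B $$ (2 * n - 1 - i, j) = 0"
    "so_mat n A B $$ (2 * n - 1 - i, 2 * n - 1 - j) = - A j i"
  using assms by (auto simp: so_mat_def)

lemma mirror_cases:
  fixes i n :: nat
  assumes "i < 2 * n"
  obtains "i < n" | k where "k < n" "i = 2 * n - 1 - k"
proof (cases "i < n")
  case False
  have "2 * n - 1 - i < n" "i = 2 * n - 1 - (2 * n - 1 - i)" using False assms by auto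
  then show ?thesis by (rule that(2))
qed (rule that(1))

lemma mirror_mat_eqI:
  fixes M M' :: "'a mat"
  assumes M: "M \<in> carrier_mat (2 * n) (2 * n)" "M' \<in> carrier_mat (2 * n) (2 * n)"
    and eq: "\<And>i j. i < n \<Longrightarrow> j < n \<Longrightarrow> M $$ (i, j) = M' $$ (i, j)"
    "\<And>i j. i < n \<Longrightarrow> j < n \<Longrightarrow> M $$ (i, 2 * n - 1 - j) = M' $$ (i, 2 * n - 1 - j)"
    "\<And>i j. i < n \<Longrightarrow> j < n \<Longrightarrow> M $$ (2 * n - 1 - i, j) = M' $$ (2 * n - 1 - i, j)"
    "\<And>i j. i < n \<Longrightarrow> j < n \<Longrightarrow> M $$ (2 * n - 1 - i, 2 * n - 1 - j) = M' $$ (2 * n - 1 - i, 2 * n - 1 - j)"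
  shows "M = M'"
proof (rule eq_matI)
  fix i j assume "i < dim_row M'" "j < dim_col M'"
  then have ij: "i < 2 * n" "j < 2 * n" using M by auto
  show "M $$ (i, j) = M' $$ (i, j)"
    by (rule mirror_cases[OF ij(1)]; rule mirror_cases[OF ij(2)]) (use eq in auto)
qed (use M in auto)

lemma so_mat_mult_index:
  assumes ij: "i < n" "j < n" and P_def: "P = so_mat n A B * so_mat n A' B'"
  shows "P $$ (i, j) = mm n A A' i j"
    "P $$ (i, 2 * n - 1 - j) = (\<Sum>k<n. A i k * B' k j) - (\<Sum>k<n. A' j k * B i k)"
    "P $$ (2 * n - 1 - i, j) = 0" "P $$ (2 * n - 1 - i, 2 * n - 1 - j) = mm n A' A j i"
proof -
  have P: "P $$ (k, l) = (\<Sum>m<n. so_mat n A B $$ (k, m) * so_mat n A' B' $$ (m, l)) +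
      (\<Sum>m<n. so_mat n A B $$ (k, 2 * n - 1 - m) * so_mat n A' B' $$ (2 * n - 1 - m, l))"
    if "k < 2 * n" "l < 2 * n" for k l
  proof -
    have "P $$ (k, l) = (\<Sum>m<2 * n. so_mat n A B $$ (k, m) * so_mat n A' B' $$ (m, l))"
      using that by (simp add: P_def scalar_prod_def atLeast0LessThan)
    then show ?thesis by (simp only: sum_mirror_split)
  qed
  have l: "i < 2 * n" "j < 2 * n" "2 * n - 1 - i < 2 * n" "2 * n - 1 - j < 2 * n" using ij by auto
  have sums: "(\<Sum>m<n. f m) = (\<Sum>m<n. f' m)" if "\<And>m. m < n \<Longrightarrow> f m = f' m" for f f' :: "nat \<Rightarrow> complex"
    using that by (intro sum.cong) auto
  note row1 = so_mat_index[OF ij(1)] and col1 = so_mat_index[OF _ ij(2)]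
  have "P $$ (i, j) = (\<Sum>m<n. A i m * A' m j) + (\<Sum>m<n. B i m * 0)"
    unfolding P[OF l(1,2)] by (intro arg_cong2[of _ _ _ _ "(+)"] sums) (simp_all only: row1 col1)
  then show "P $$ (i, j) = mm n A A' i j" by (simp add: mm_def)
  have "P $$ (i, 2 * n - 1 - j) = (\<Sum>m<n. A i m * B' m j) + (\<Sum>m<n. B i m * - A' j m)"
    unfolding P[OF l(1,4)] by (intro arg_cong2[of _ _ _ _ "(+)"] sums) (simp_all only: row1 col1)
  then show "P $$ (i, 2 * n - 1 - j) = (\<Sum>k<n. A i k * B' k j) - (\<Sum>k<n. A' j k * B i k)"
    by (simp add: sum_negf mult.commute)
  have "P $$ (2 * n - 1 - i, j) = (\<Sum>m<n. 0 * A' m j) + (\<Sum>m<n. - A m i * 0)"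
    unfolding P[OF l(3,2)] by (intro arg_cong2[of _ _ _ _ "(+)"] sums) (simp_all only: row1 col1)
  then show "P $$ (2 * n - 1 - i, j) = 0" by simp
  have "P $$ (2 * n - 1 - i, 2 * n - 1 - j) = (\<Sum>m<n. 0 * B' m j) + (\<Sum>m<n. - A m i * - A' j m)"
    unfolding P[OF l(3,4)] by (intro arg_cong2[of _ _ _ _ "(+)"] sums) (simp_all only: row1 col1)
  then show "P $$ (2 * n - 1 - i, 2 * n - 1 - j) = mm n A' A j i"
    by (simp add: mm_def mult.commute)
qed

lemma so_mat_bracket:
  "lie_bracket (so_mat n A B) (so_mat n A' B') =
    so_mat n (mm n A A' - mm n A' A) (act n A B' - act n A' B)"
proof (rule mirror_mat_eqI[where n = n])
  have c: "so_mat n A B * so_mat n A' B' \<in> carrier_mat (2 * n) (2 * n)" for A B A' B'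
    by (simp add: mult_carrier_mat[of _ _ "2 * n"])
  show "lie_bracket (so_mat n A B) (so_mat n A' B') \<in> carrier_mat (2 * n) (2 * n)"
    unfolding lie_bracket_def by (rule minus_carrier_mat[OF c])
  fix i j assume ij: "i < n" "j < n"
  have minus: "lie_bracket (so_mat n A B) (so_mat n A' B') $$ (k, l) =
      (so_mat n A B * so_mat n A' B') $$ (k, l) - (so_mat n A' B' * so_mat n A B) $$ (k, l)"
    if "k < 2 * n" "l < 2 * n" for k l
    using that unfolding lie_bracket_def by simp
  have l: "i < 2 * n" "j < 2 * n" "2 * n - 1 - i < 2 * n" "2 * n - 1 - j < 2 * n" using ij by auto
  show "lie_bracket (so_mat n A B) (so_mat n A' B') $$ (i, j) =
      so_mat n (mm n A A' - mm n A' A) (act n A B' - act n A' B) $$ (i, j)"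
    unfolding minus[OF l(1,2)] so_mat_mult_index[OF ij refl] so_mat_index[OF ij] by simp
  show "lie_bracket (so_mat n A B) (so_mat n A' B') $$ (i, 2 * n - 1 - j) =
      so_mat n (mm n A A' - mm n A' A) (act n A B' - act n A' B) $$ (i, 2 * n - 1 - j)"
    unfolding minus[OF l(1,4)] so_mat_mult_index[OF ij refl] so_mat_index[OF ij] by (simp add: act_def)
  show "lie_bracket (so_mat n A B) (so_mat n A' B') $$ (2 * n - 1 - i, j) =
      so_mat n (mm n A A' - mm n A' A) (act n A B' - act n A' B) $$ (2 * n - 1 - i, j)"
    unfolding minus[OF l(3,2)] so_mat_mult_index[OF ij refl] so_mat_index[OF ij] by simp
  show "lie_bracket (so_mat n A B) (so_mat n A' B') $$ (2 * n - 1 - i, 2 * n - 1 - j) =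
      so_mat n (mm n A A' - mm n A' A) (act n A B' - act n A' B) $$ (2 * n - 1 - i, 2 * n - 1 - j)"
    unfolding minus[OF l(3,4)] so_mat_mult_index[OF ij refl] so_mat_index[OF ij] by simp
qed simp

lemma so_mat_add: "so_mat n A B + so_mat n A' B' = so_mat n (A + A') (B + B')"
  and so_mat_smult: "c \<cdot>\<^sub>m so_mat n A B = so_mat n (\<lambda>i j. c * A i j) (\<lambda>i j. c * B i j)"
  and so_mat_zero: "so_mat n 0 0 = 0\<^sub>m (2 * n) (2 * n)"
  by (rule eq_matI; simp add: so_mat_def)+

lemma so_mat_eq_zero:
  assumes "so_mat n A B = 0\<^sub>m (2 * n) (2 * n)" "i < n" "j < n"
  shows "A i j = 0" "B i j = 0"
  using so_mat_index(1,2)[OF assms(2,3), of A B] assms unfolding assms(1) by simp_all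

lemma wedge_swap: "wedge y x = - wedge x y"
  by (auto simp: wedge_def fun_eq_iff)

lemma act_unit_wedge:
  assumes "x < n" "y < n"
  shows "act n (\<lambda>i j. c * unit_fun u v i j) (wedge x y) =
    (\<lambda>i j. c * (of_bool (x = v) * wedge u y i j + of_bool (y = v) * wedge x u i j))"
proof (intro ext)
  fix i j
  have "(\<Sum>k<n. c * unit_fun u v i k * wedge x y k j) =
      (\<Sum>k<n. if k = v then c * of_bool (i = u) * wedge x y v j else 0)"
    by (intro sum.cong) (auto simp: unit_fun_def)
  moreover have "(\<Sum>k<n. c * unit_fun u v j k * wedge x y i k) =
      (\<Sum>k<n. if k = v then c * of_bool (j = u) * wedge x y i v else 0)"
    by (intro sum.cong) (auto simp: unit_fun_def)
  ultimately have eq: "act n (\<lambda>i j. c * unit_fun u v i j) (wedge x y) i j =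
      (if v < n then c * of_bool (i = u) * wedge x y v j + c * of_bool (j = u) * wedge x y i v else 0)"
    by (simp add: act_def)
  show "act n (\<lambda>i j. c * unit_fun u v i j) (wedge x y) i j =
      c * (of_bool (x = v) * wedge u y i j + of_bool (y = v) * wedge x u i j)"
  proof (cases "x = v"; cases "y = v")
    assume "x = v" "y = v"
    then show ?thesis unfolding eq by (simp add: wedge_def)
  next
    assume "x = v" "y \<noteq> v"
    then show ?thesis unfolding eq using assms by (simp add: wedge_def of_bool_conj algebra_simps)
  next
    assume "x \<noteq> v" "y = v"
    then show ?thesis unfolding eq using assms by (simp add: wedge_def of_bool_conj algebra_simps)
  next
    assume "x \<noteq> v" "y \<noteq> v"
    then show ?thesis unfolding eq by (simp add: wedge_def)
  qed
qed

section \<open>Reduction from the type-D seaweed to p\<close>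

context seaweed_meander
begin

text \<open>The pattern of the seaweed \<open>(a|b)/(c|3)\<close>. The pattern \<open>R\<close>
  omits exactly the positions \<open>(n - 3, n - 1)\<close> and \<open>(n - 2, n - 1)\<close> of
  it.\<close>

definition R3 :: "nat \<Rightarrow> nat \<Rightarrow> bool" where
  "R3 i j \<longleftrightarrow> i < n \<and> j < n \<and>
    (i = j \<or> j < i \<and> (a \<le> j \<or> i < a) \<or> i < j \<and> (j < n - 3 \<or> n - 3 \<le> i))"

lemma R3_trans: "R3 i j \<Longrightarrow> R3 j k \<Longrightarrow> R3 i k"
  unfolding R3_def using b_gt n_eq by auto

lemma R_R3: "R i j \<Longrightarrow> R3 i j"
  unfolding R3_def R_iff by auto

lemma R3_R: "R3 i j \<Longrightarrow> R i j \<or> j = n - 1 \<and> (i = n - 3 \<or> i = n - 2)"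
  unfolding R3_def R_iff using n_ge by auto

lemma not_R_tail: "\<not> R (n - 3) (n - 1)" "\<not> R (n - 2) (n - 1)"
  unfolding R_iff using n_ge by auto

definition tail :: "nat \<Rightarrow> bool" where "tail i \<longleftrightarrow> n - 3 \<le> i \<and> i < n"

lemma tail_cases:
  assumes "tail i" obtains "i = n - 3" | "i = n - 2" | "i = n - 1"
  using assms unfolding tail_def by linarith

lemma tail_R3: "tail i \<Longrightarrow> tail j \<Longrightarrow> R3 i j"
  unfolding tail_def R3_def using b_gt n_eq by auto

lemma R3_tail: "R3 i j \<Longrightarrow> tail j \<Longrightarrow> tail i"
  unfolding tail_def R3_def by auto

definition in_q :: "(nat \<Rightarrow> nat \<Rightarrow> complex) \<Rightarrow> bool" where
  "in_q A \<longleftrightarrow> (\<forall>i j. A i j \<noteq> 0 \<longrightarrow> R3 i j)"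

definition in_alt :: "(nat \<Rightarrow> nat \<Rightarrow> complex) \<Rightarrow> bool" where
  "in_alt B \<longleftrightarrow> (\<forall>i j. B i j = - B j i) \<and> (\<forall>i j. B i j \<noteq> 0 \<longrightarrow> tail i \<and> tail j)"

definition g :: "complex mat set" where
  "g = {so_mat n A B | A B. in_q A \<and> in_alt B}"

lemma so_mat_in_g: "in_q A \<Longrightarrow> in_alt B \<Longrightarrow> so_mat n A B \<in> g"
  unfolding g_def by blast

lemma in_alt_swap: "in_alt B \<Longrightarrow> B i j = - B j i"
  and in_alt_tail: "in_alt B \<Longrightarrow> B i j \<noteq> 0 \<Longrightarrow> tail i \<and> tail j"
  unfolding in_alt_def by blast+

lemma in_alt_diag: assumes "in_alt B" shows "B i i = 0"
  using in_alt_swap[OF assms, of i i] by simp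

lemma in_q_zero: "in_q 0" and in_alt_zero: "in_alt 0"
  by (simp_all add: in_q_def in_alt_def)

lemma in_q_unit: "R3 u v \<Longrightarrow> in_q (\<lambda>i j. c * unit_fun u v i j)"
  by (auto simp: in_q_def unit_fun_def)

lemma wedge_nonzero: "wedge x y i j \<noteq> 0 \<Longrightarrow> i = x \<and> j = y \<or> i = y \<and> j = x"
  unfolding wedge_def of_bool_def by (auto split: if_splits)

lemma in_alt_wedge:
  assumes "tail x" "tail y" shows "in_alt (wedge x y)"
proof -
  have "wedge x y i j = - wedge x y j i" for i j by (simp add: wedge_def conj_commute)
  moreover have "tail i \<and> tail j" if "wedge x y i j \<noteq> 0" for i j
    using wedge_nonzero[OF that] assms by blast
  ultimately show ?thesis unfolding in_alt_def by blast
qed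

lemma in_q_mm: "in_q A \<Longrightarrow> in_q A' \<Longrightarrow> in_q (mm n A A')"
  unfolding in_q_def mm_def
proof (intro allI impI)
  fix i j assume A: "\<forall>i j. A i j \<noteq> 0 \<longrightarrow> R3 i j" and A': "\<forall>i j. A' i j \<noteq> 0 \<longrightarrow> R3 i j"
    and nz: "(\<Sum>k<n. A i k * A' k j) \<noteq> 0"
  then obtain k where "A i k * A' k j \<noteq> 0" by (meson sum.neutral)
  then have "A i k \<noteq> 0" "A' k j \<noteq> 0" by auto
  then show "R3 i j" using A A' R3_trans by blast
qed

lemma in_alt_act: assumes A: "in_q A" and B: "in_alt B" shows "in_alt (act n A B)"
  unfolding in_alt_def
proof (intro conjI allI impI)
  fix i j
  have "(\<Sum>k<n. A i k * B k j) = - (\<Sum>k<n. A i k * B j k)"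
    unfolding sum_negf[symmetric] by (intro sum.cong refl) (subst in_alt_swap[OF B], simp)
  moreover have "(\<Sum>k<n. A j k * B i k) = - (\<Sum>k<n. A j k * B k i)"
    unfolding sum_negf[symmetric] by (intro sum.cong refl) (subst in_alt_swap[OF B], simp)
  ultimately show "act n A B i j = - act n A B j i" by (simp add: act_def)
  have 1: "tail i \<and> tail j" if nz: "(\<Sum>k<n. A i k * B k j) \<noteq> 0" for i j
  proof -
    obtain k where "A i k * B k j \<noteq> 0" using nz by (meson sum.neutral)
    then have "R3 i k" "tail k" "tail j" using A in_alt_tail[OF B, of k j] by (auto simp: in_q_def)
    then show ?thesis using R3_tail by blast
  qed
  have 2: "tail i \<and> tail j" if nz: "(\<Sum>k<n. A j k * B i k) \<noteq> 0" for i j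
  proof -
    obtain k where "A j k * B i k \<noteq> 0" using nz by (meson sum.neutral)
    then have "R3 j k" "tail i" "tail k" using A in_alt_tail[OF B, of i k] by (auto simp: in_q_def)
    then show ?thesis using R3_tail by blast
  qed
  assume nz: "act n A B i j \<noteq> 0"
  then have "(\<Sum>k<n. A i k * B k j) \<noteq> 0 \<or> (\<Sum>k<n. A j k * B i k) \<noteq> 0"
    by (auto simp: act_def)
  then show "tail i" "tail j" using 1[of i j] 2[of j i] by blast+
qed

lemma in_q_linear: "in_q A \<Longrightarrow> in_q A' \<Longrightarrow> in_q (A + A')" "in_q A \<Longrightarrow> in_q A' \<Longrightarrow> in_q (A - A')"
    "in_q A \<Longrightarrow> in_q (\<lambda>i j. c * A i j)"
  unfolding in_q_def by (auto, metis add_0, metis diff_self)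

lemma in_alt_linear: "in_alt B \<Longrightarrow> in_alt B' \<Longrightarrow> in_alt (B + B')" "in_alt B \<Longrightarrow> in_alt B' \<Longrightarrow> in_alt (B - B')"
    "in_alt B \<Longrightarrow> in_alt (\<lambda>i j. c * B i j)"
proof -
  assume B: "in_alt B"
  show "in_alt (\<lambda>i j. c * B i j)"
    using in_alt_swap[OF B] in_alt_tail[OF B] unfolding in_alt_def by (metis mult_minus_right mult_zero_right)
  assume B': "in_alt B'"
  have t: "tail i \<and> tail j" if "B i j \<noteq> 0 \<or> B' i j \<noteq> 0" for i j
    using in_alt_tail[OF B] in_alt_tail[OF B'] that by blast
  have s: "B i j = - B j i" "B' i j = - B' j i" for i j using in_alt_swap B B' by blast+
  show "in_alt (B + B')" unfolding in_alt_def
  proof (intro conjI allI impI)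
    fix i j show "(B + B') i j = - (B + B') j i" using s(1)[of i j] s(2)[of i j] by simp
    assume "(B + B') i j \<noteq> 0"
    then have "B i j \<noteq> 0 \<or> B' i j \<noteq> 0" by auto
    then show "tail i" "tail j" using t by blast+
  qed
  show "in_alt (B - B')" unfolding in_alt_def
  proof (intro conjI allI impI)
    fix i j show "(B - B') i j = - (B - B') j i" using s(1)[of i j] s(2)[of i j] by simp
    assume "(B - B') i j \<noteq> 0"
    then have "B i j \<noteq> 0 \<or> B' i j \<noteq> 0" by auto
    then show "tail i" "tail j" using t by blast+
  qed
qed

sublocale lie: mat_lie_algebra "2 * n" g
proof
  show "mat_subspace (2 * n) g"
    unfolding mat_subspace_def
  proof (intro conjI ballI allI)
    show "g \<subseteq> carrier_mat (2 * n) (2 * n)" unfolding g_def by auto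
    show "0\<^sub>m (2 * n) (2 * n) \<in> g" using so_mat_in_g[OF in_q_zero in_alt_zero] by (simp add: so_mat_zero)
    show "x + y \<in> g" if "x \<in> g" "y \<in> g" for x y
      using that unfolding g_def by (force simp: so_mat_add intro: in_q_linear in_alt_linear)
    show "c \<cdot>\<^sub>m x \<in> g" if "x \<in> g" for c x
      using that unfolding g_def by (force simp: so_mat_smult intro: in_q_linear in_alt_linear)
  qed
  show "lie_bracket x y \<in> g" if "x \<in> g" "y \<in> g" for x y
    using that unfolding g_def
    by (force simp: so_mat_bracket intro: in_q_linear in_alt_linear in_q_mm in_alt_act)
qed

text \<open>The blocks \<open>a\<close>, \<open>b\<close> fill the first \<open>n\<close> indices,
  so no lower entry crosses the middle and the lower left quarter is 0. The middle block of the
  upper part has size six; it contributes the alternating matrices on the last three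
  indices.\<close>

lemma g_eq_seaweed: "seaweed_D n [a, b] [n - 3] = g"
proof -
  define b1 where "b1 = block_index (sym_blocks n [a, b])"
  define b2 where "b2 = block_index (sym_blocks n [n - 3])"
  define P where "P i j \<longleftrightarrow> j \<le> i \<and> b1 i = b1 j \<or> i \<le> j \<and> b2 i = b2 j" for i j
  have "sym_blocks n [a, b] = [a, b, 0, b, a]" by (simp add: sym_blocks_def n_eq)
  \<comment> \<open>The empty middle block still takes the number 2, so the mirrored blocks are
    numbered 3 and 4.\<close>
  then have b1: "b1 i = (if i < a then 0 else if i < n then 1 else if i < n + b then 3 else 4)"
    if "i < 2 * n" for i
    using that n_eq unfolding b1_def by auto
  have "2 * (n - (n - 3)) = 6" using n_ge by simp
  then have "sym_blocks n [n - 3] = [n - 3, 6, n - 3]" by (simp add: sym_blocks_def)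
  then have b2: "b2 i = (if i < n - 3 then 0 else if i < n + 3 then 1 else 2)" if "i < 2 * n" for i
    using that n_ge unfolding b2_def by auto
  have R3_form: "j \<le> i \<and> (i < a \<longleftrightarrow> j < a) \<or> i \<le> j \<and> (i < n - 3 \<longleftrightarrow> j < n - 3) \<longleftrightarrow> R3 i j"
    if "i < n" "j < n" for i j
    using that unfolding R3_def by force
  have b1_mirror: "b1 (2 * n - 1 - k) = (if k < a then 4 else 3)"
    and b2_mirror: "b2 (2 * n - 1 - k) = (if k < n - 3 then 2 else 1)" if "k < n" for k
  proof -
    have k: "2 * n - 1 - k < 2 * n" "\<not> 2 * n - 1 - k < a" "\<not> 2 * n - 1 - k < n" "\<not> 2 * n - 1 - k < n - 3"
      "2 * n - 1 - k < n + b \<longleftrightarrow> \<not> k < a" "2 * n - 1 - k < n + 3 \<longleftrightarrow> \<not> k < n - 3"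
      using that n_eq n_ge by linarith+
    show "b1 (2 * n - 1 - k) = (if k < a then 4 else 3)" unfolding b1[OF k(1)] using k by simp
    show "b2 (2 * n - 1 - k) = (if k < n - 3 then 2 else 1)" unfolding b2[OF k(1)] using k by simp
  qed
  have P1: "P i j \<longleftrightarrow> R3 i j" if "i < n" "j < n" for i j
  proof -
    have "b1 i = b1 j \<longleftrightarrow> (i < a \<longleftrightarrow> j < a)" "b2 i = b2 j \<longleftrightarrow> (i < n - 3 \<longleftrightarrow> j < n - 3)"
      using that by (simp_all add: b1 b2)
    then show ?thesis unfolding P_def R3_form[OF that, symmetric] by simp
  qed
  have P2: "P i (2 * n - 1 - j) \<longleftrightarrow> tail i \<and> tail j" if "i < n" "j < n" for i j
  proof -
    have "b2 i = (if i < n - 3 then 0 else 1)" using that by (simp add: b2)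
    moreover have "i < 2 * n - 1 - j" using that by linarith
    ultimately show ?thesis unfolding P_def tail_def using that b2_mirror[OF that(2)] by (simp split: if_splits)
  qed
  have P3: "\<not> P (2 * n - 1 - i) j" if "i < n" "j < n" for i j
  proof -
    have "b1 j \<le> 1" using that by (simp add: b1)
    moreover have "3 \<le> b1 (2 * n - 1 - i)" using b1_mirror[OF that(1)] by simp
    moreover have "j < 2 * n - 1 - i" using that by linarith
    ultimately show ?thesis unfolding P_def by simp
  qed
  have P4: "P (2 * n - 1 - i) (2 * n - 1 - j) \<longleftrightarrow> R3 j i" if "i < n" "j < n" for i j
  proof -
    have "b1 (2 * n - 1 - i) = b1 (2 * n - 1 - j) \<longleftrightarrow> (j < a \<longleftrightarrow> i < a)"
      "b2 (2 * n - 1 - i) = b2 (2 * n - 1 - j) \<longleftrightarrow> (j < n - 3 \<longleftrightarrow> i < n - 3)"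
      unfolding b1_mirror[OF that(1)] b1_mirror[OF that(2)] b2_mirror[OF that(1)] b2_mirror[OF that(2)] by auto
    moreover have "2 * n - 1 - i \<le> 2 * n - 1 - j \<longleftrightarrow> j \<le> i" using that by linarith
    moreover have "2 * n - 1 - j \<le> 2 * n - 1 - i \<longleftrightarrow> i \<le> j" using that by linarith
    ultimately show ?thesis unfolding P_def R3_form[OF that(2,1), symmetric] by simp
  qed
  have iff: "M \<in> seaweed_D n [a, b] [n - 3] \<longleftrightarrow> M \<in> carrier_mat (2 * n) (2 * n) \<and>
    (\<forall>i<2 * n. \<forall>j<2 * n. M $$ (i, j) = - M $$ (2 * n - 1 - j, 2 * n - 1 - i)) \<and>
    (\<forall>i<2 * n. \<forall>j<2 * n. M $$ (i, j) \<noteq> 0 \<longrightarrow> P i j)" for M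
    using seaweed_D_iff[of "[a, b]" n "[n - 3]" M] n_eq unfolding P_def b1_def b2_def by simp
  show ?thesis
  proof (intro equalityI subsetI)
    fix M assume "M \<in> seaweed_D n [a, b] [n - 3]"
    then have M: "M \<in> carrier_mat (2 * n) (2 * n)"
      and anti: "\<And>i j. i < 2 * n \<Longrightarrow> j < 2 * n \<Longrightarrow> M $$ (i, j) = - M $$ (2 * n - 1 - j, 2 * n - 1 - i)"
      and supp: "\<And>i j. i < 2 * n \<Longrightarrow> j < 2 * n \<Longrightarrow> M $$ (i, j) \<noteq> 0 \<Longrightarrow> P i j"
      unfolding iff by blast+
    define A where "A i j = (if i < n \<and> j < n then M $$ (i, j) else 0)" for i j
    define B where "B i j = (if i < n \<and> j < n then M $$ (i, 2 * n - 1 - j) else 0)" for i j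
    have "in_q A"
      unfolding in_q_def
    proof (intro allI impI)
      fix i j assume "A i j \<noteq> 0"
      then have "i < n" "j < n" "M $$ (i, j) \<noteq> 0" unfolding A_def by (auto split: if_splits)
      then show "R3 i j" using supp[of i j] P1[of i j] by simp
    qed
    moreover have "in_alt B"
      unfolding in_alt_def
    proof (intro conjI allI impI)
      fix i j
      show "B i j = - B j i"
        using anti[of i "2 * n - 1 - j"] unfolding B_def by auto
      assume nz: "B i j \<noteq> 0"
      then have "i < n" "j < n" "M $$ (i, 2 * n - 1 - j) \<noteq> 0" unfolding B_def by (auto split: if_splits)
      then show "tail i" "tail j" using supp[of i "2 * n - 1 - j"] P2[of i j] by auto
    qed
    moreover have "M = so_mat n A B"
    proof (rule mirror_mat_eqI[where n = n])
      fix i j assume ij: "i < n" "j < n"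
      show "M $$ (i, j) = so_mat n A B $$ (i, j)" "M $$ (i, 2 * n - 1 - j) = so_mat n A B $$ (i, 2 * n - 1 - j)"
        unfolding so_mat_index[OF ij] using ij by (simp_all add: A_def B_def)
      show "M $$ (2 * n - 1 - i, j) = so_mat n A B $$ (2 * n - 1 - i, j)"
        unfolding so_mat_index[OF ij] using supp[of "2 * n - 1 - i" j] P3[OF ij] ij by auto
      show "M $$ (2 * n - 1 - i, 2 * n - 1 - j) = so_mat n A B $$ (2 * n - 1 - i, 2 * n - 1 - j)"
        unfolding so_mat_index[OF ij] using anti[of "2 * n - 1 - i" "2 * n - 1 - j"] ij by (simp add: A_def)
    qed (simp_all add: M)
    ultimately show "M \<in> g" by (simp add: so_mat_in_g)
  next
    fix M assume "M \<in> g"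
    then obtain A B where A: "in_q A" and B: "in_alt B" and M: "M = so_mat n A B" unfolding g_def by blast
    have anti: "M $$ (i, j) = - M $$ (2 * n - 1 - j, 2 * n - 1 - i)" if ij: "i < 2 * n" "j < 2 * n" for i j
    proof (rule mirror_cases[OF ij(1)]; rule mirror_cases[OF ij(2)])
      assume l: "i < n" "j < n"
      show ?thesis unfolding M so_mat_index[OF l] so_mat_index[OF l(2,1)] by simp
    next
      fix k assume l: "i < n" "k < n" "j = 2 * n - 1 - k"
      have "2 * n - 1 - j = k" using l by simp
      then show ?thesis unfolding M l(3) so_mat_index[OF l(1,2)]
        using l so_mat_index(2)[OF l(2,1)] in_alt_swap[OF B, of i k] by simp
    next
      fix k assume l: "k < n" "i = 2 * n - 1 - k" "j < n"
      have "2 * n - 1 - i = k" using l by simp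
      then show ?thesis unfolding M l(2) so_mat_index[OF l(1,3)]
        using l so_mat_index(3)[OF l(3,1)] by simp
    next
      fix k m assume l: "k < n" "i = 2 * n - 1 - k" "m < n" "j = 2 * n - 1 - m"
      have "2 * n - 1 - i = k" "2 * n - 1 - j = m" using l by auto
      then show ?thesis unfolding M l(2,4) so_mat_index[OF l(1,3)]
        using l so_mat_index(1)[OF l(3,1)] by simp
    qed
    have supp: "P i j" if ij: "i < 2 * n" "j < 2 * n" and nz: "M $$ (i, j) \<noteq> 0" for i j
    proof (rule mirror_cases[OF ij(1)]; rule mirror_cases[OF ij(2)])
      assume l: "i < n" "j < n"
      show ?thesis using nz A unfolding M so_mat_index[OF l] in_q_def P1[OF l] by blast
    next
      fix k assume l: "i < n" "k < n" "j = 2 * n - 1 - k"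
      show ?thesis using nz in_alt_tail[OF B] unfolding M l(3) so_mat_index[OF l(1,2)] P2[OF l(1,2)] by blast
    next
      fix k assume l: "k < n" "i = 2 * n - 1 - k" "j < n"
      show ?thesis using nz unfolding M l(2) so_mat_index[OF l(1,3)] by simp
    next
      fix k m assume l: "k < n" "i = 2 * n - 1 - k" "m < n" "j = 2 * n - 1 - m"
      show ?thesis using nz A unfolding M l(2,4) so_mat_index[OF l(1,3)] in_q_def P4[OF l(1,3)] by simp
    qed
    show "M \<in> seaweed_D n [a, b] [n - 3]" unfolding iff
    proof (intro conjI allI impI)
      show "M \<in> carrier_mat (2 * n) (2 * n)" unfolding M by simp
    qed (rule anti, assumption+, rule supp, assumption+)
  qed
qed

text \<open>The coefficients of the linear map that sends A' to the value of \<open>F\<close> on the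
  commutator of A and A', see \<open>trace_commutator\<close>.\<close>

definition comm :: "(nat \<Rightarrow> nat \<Rightarrow> complex) \<Rightarrow> (nat \<Rightarrow> nat \<Rightarrow> complex) \<Rightarrow> nat \<Rightarrow> nat \<Rightarrow> complex" where
  "comm F A u v = mm n (\<lambda>i j. A j i) F u v - mm n F (\<lambda>i j. A j i) u v"

lemma trace_commutator:
  "(\<Sum>i<n. \<Sum>j<n. F i j * (mm n A A' - mm n A' A) i j) = (\<Sum>u<n. \<Sum>v<n. A' u v * comm F A u v)"
proof -
  have "(\<Sum>i<n. \<Sum>j<n. F i j * mm n A A' i j) = (\<Sum>i<n. \<Sum>j<n. \<Sum>k<n. A' k j * (A i k * F i j))"
    by (simp add: mm_def sum_distrib_left algebra_simps)
  also have "\<dots> = (\<Sum>j<n. \<Sum>i<n. \<Sum>k<n. A' k j * (A i k * F i j))" by (rule sum.swap)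
  also have "\<dots> = (\<Sum>j<n. \<Sum>k<n. \<Sum>i<n. A' k j * (A i k * F i j))"
    by (rule sum.cong[OF refl]) (rule sum.swap)
  also have "\<dots> = (\<Sum>k<n. \<Sum>j<n. \<Sum>i<n. A' k j * (A i k * F i j))" by (rule sum.swap)
  finally have 1: "(\<Sum>i<n. \<Sum>j<n. F i j * mm n A A' i j) =
      (\<Sum>u<n. \<Sum>v<n. A' u v * mm n (\<lambda>i j. A j i) F u v)"
    by (simp add: mm_def sum_distrib_left)
  have "(\<Sum>i<n. \<Sum>j<n. F i j * mm n A' A i j) = (\<Sum>i<n. \<Sum>j<n. \<Sum>k<n. A' i k * (F i j * A k j))"
    by (simp add: mm_def sum_distrib_left algebra_simps)
  also have "\<dots> = (\<Sum>i<n. \<Sum>k<n. \<Sum>j<n. A' i k * (F i j * A k j))"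
    by (rule sum.cong[OF refl]) (rule sum.swap)
  finally have 2: "(\<Sum>i<n. \<Sum>j<n. F i j * mm n A' A i j) =
      (\<Sum>u<n. \<Sum>v<n. A' u v * mm n F (\<lambda>i j. A j i) u v)"
    by (simp add: mm_def sum_distrib_left)
  show ?thesis by (simp add: right_diff_distrib sum_subtractf 1 2 comm_def)
qed

text \<open>This is the pairing with the identity matrix, which commutes with everything.\<close>

lemma trace_comm: "(\<Sum>u<n. comm F A u u) = 0"
proof -
  have "(\<Sum>u<n. mm n F (\<lambda>i j. A j i) u u) = (\<Sum>u<n. \<Sum>k<n. F u k * A u k)"
    by (simp add: mm_def)
  also have "\<dots> = (\<Sum>k<n. \<Sum>u<n. F u k * A u k)" by (rule sum.swap)
  also have "\<dots> = (\<Sum>k<n. mm n (\<lambda>i j. A j i) F k k)" by (simp add: mm_def mult.commute)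
  finally show ?thesis by (simp add: comm_def sum_subtractf)
qed

lemma tail_mem: "tail (n - 3)" "tail (n - 2)" "tail (n - 1)" and tail_less: "tail i \<Longrightarrow> i < n"
  using n_ge by (auto simp: tail_def)

lemma tail_neq: "n - 3 \<noteq> n - 2" "n - 3 \<noteq> n - 1" "n - 2 \<noteq> n - 1" "n - 2 \<noteq> n - 3" "n - 1 \<noteq> n - 3" "n - 1 \<noteq> n - 2"
  using n_ge by auto

lemma tail_sum:
  assumes "\<And>k. k < n \<Longrightarrow> f k \<noteq> 0 \<Longrightarrow> tail k"
  shows "(\<Sum>k<n. f k) = f (n - 3) + f (n - 2) + (f (n - 1) :: complex)"
proof -
  have "(\<Sum>k<n. f k) = (\<Sum>k\<in>{n - 3, n - 2, n - 1}. f k)"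
  proof (rule sum.mono_neutral_right)
    show "{n - 3, n - 2, n - 1} \<subseteq> {..<n}" using n_ge by auto
    show "\<forall>k\<in>{..<n} - {n - 3, n - 2, n - 1}. f k = 0"
    proof
      fix k assume k: "k \<in> {..<n} - {n - 3, n - 2, n - 1}"
      then have "\<not> tail k" by (auto simp: tail_def)
      then show "f k = 0" using assms[of k] k by auto
    qed
  qed simp
  then show ?thesis using tail_neq by (simp add: add.assoc)
qed

lemma act_tail:
  assumes B: "in_alt B"
  shows "act n A B (n - 3) (n - 2) = (A (n - 3) (n - 3) + A (n - 2) (n - 2)) * B (n - 3) (n - 2)
    - A (n - 3) (n - 1) * B (n - 2) (n - 1) + A (n - 2) (n - 1) * B (n - 3) (n - 1)"
proof -
  have "(\<Sum>k<n. A (n - 3) k * B k (n - 2)) =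
      A (n - 3) (n - 3) * B (n - 3) (n - 2) + A (n - 3) (n - 2) * B (n - 2) (n - 2) + A (n - 3) (n - 1) * B (n - 1) (n - 2)"
    by (rule tail_sum) (use in_alt_tail[OF B] in fastforce)
  moreover have "(\<Sum>k<n. A (n - 2) k * B (n - 3) k) =
      A (n - 2) (n - 3) * B (n - 3) (n - 3) + A (n - 2) (n - 2) * B (n - 3) (n - 2) + A (n - 2) (n - 1) * B (n - 3) (n - 1)"
    by (rule tail_sum) (use in_alt_tail[OF B] in fastforce)
  ultimately show ?thesis
    unfolding act_def using in_alt_diag[OF B] in_alt_swap[OF B, of "n - 1" "n - 2"]
    by (simp add: algebra_simps)
qed

definition normal_form :: "(complex mat \<Rightarrow> complex) \<Rightarrow> (nat \<Rightarrow> nat \<Rightarrow> complex) \<Rightarrow> complex \<Rightarrow> bool" where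
  "normal_form f F w \<longleftrightarrow> (\<forall>A B. in_q A \<longrightarrow> in_alt B \<longrightarrow>
     f (so_mat n A B) = (\<Sum>i<n. \<Sum>j<n. F i j * A i j) + w * B (n - 3) (n - 2))"

lemma bracket_value:
  assumes f: "normal_form f F w" and A: "in_q A" "in_q A'" and B: "in_alt B" "in_alt B'"
  shows "f (lie_bracket (so_mat n A B) (so_mat n A' B')) = (\<Sum>u<n. \<Sum>v<n. A' u v * comm F A u v) +
    w * (act n A B' (n - 3) (n - 2) - act n A' B (n - 3) (n - 2))"
proof -
  have "in_q (mm n A A' - mm n A' A)" by (intro in_q_linear in_q_mm A)
  moreover have "in_alt (act n A B' - act n A' B)" by (intro in_alt_linear in_alt_act A B)
  ultimately have "f (lie_bracket (so_mat n A B) (so_mat n A' B')) =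
      (\<Sum>i<n. \<Sum>j<n. F i j * (mm n A A' - mm n A' A) i j) +
      w * (act n A B' - act n A' B) (n - 3) (n - 2)"
    using f unfolding normal_form_def so_mat_bracket by blast
  then show ?thesis unfolding trace_commutator by simp
qed

lemma sum_unit_fun:
  assumes "u < n" "v < n" shows "(\<Sum>i<n. \<Sum>j<n. unit_fun u v i j * G i j) = G u v"
proof -
  have "(\<Sum>i<n. \<Sum>j<n. unit_fun u v i j * G i j) = (\<Sum>i<n. if i = u then (\<Sum>j<n. if j = v then G u v else 0) else 0)"
    by (intro sum.cong refl) (auto simp: unit_fun_def intro!: sum.cong)
  then show ?thesis using assms by simp
qed

text \<open>Pairing a kernel element with the alternating part puts A into p and makes its trace on
  the indices \<open>n - 3\<close> and \<open>n - 2\<close> vanish. Pairing it with matrix units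
  then puts the transpose of A into the kernel for the arcs, so A is scalar, and the trace condition
  makes it 0.\<close>

lemma path_frobenius:
  assumes e: "2 * e < n" shows "frobenius (2 * n) g"
  unfolding lie.frobenius_iff
proof (intro exI conjI ballI impI)
  define F where "F = arc_mat {d. is_arc d}"
  define f where "f M = (\<Sum>i<n. \<Sum>j<n. F i j * M $$ (i, j)) + M $$ (n - 3, 2 * n - 1 - (n - 2))"
    for M :: "complex mat"
  have less: "n - 3 < n" "n - 2 < n" "n - 1 < n" "2 * n - 1 - (n - 2) < 2 * n" "n - 3 < 2 * n"
    using n_ge by auto
  have nf: "normal_form f F 1"
    unfolding normal_form_def
  proof (intro allI impI)
    fix A B
    have "(\<Sum>i<n. \<Sum>j<n. F i j * so_mat n A B $$ (i, j)) = (\<Sum>i<n. \<Sum>j<n. F i j * A i j)"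
      by (intro sum.cong refl) (simp add: so_mat_index)
    then show "f (so_mat n A B) = (\<Sum>i<n. \<Sum>j<n. F i j * A i j) + 1 * B (n - 3) (n - 2)"
      unfolding f_def so_mat_index(2)[OF less(1,2)] by simp
  qed
  show "linear_functional g f"
    unfolding linear_functional_def
  proof (intro conjI ballI allI)
    fix x y assume "x \<in> g" "y \<in> g"
    then have xy: "x \<in> carrier_mat (2 * n) (2 * n)" "y \<in> carrier_mat (2 * n) (2 * n)"
      using lie.g_carrier by auto
    have "(\<Sum>i<n. \<Sum>j<n. F i j * (x + y) $$ (i, j)) = (\<Sum>i<n. \<Sum>j<n. F i j * x $$ (i, j) + F i j * y $$ (i, j))"
      by (intro sum.cong refl) (use xy in \<open>auto simp: distrib_left\<close>)
    then show "f (x + y) = f x + f y"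
      unfolding f_def using xy less by (simp add: sum.distrib)
  next
    fix c x assume "x \<in> g"
    then have x: "x \<in> carrier_mat (2 * n) (2 * n)" using lie.g_carrier by auto
    have "(\<Sum>i<n. \<Sum>j<n. F i j * (c \<cdot>\<^sub>m x) $$ (i, j)) = (\<Sum>i<n. \<Sum>j<n. c * (F i j * x $$ (i, j)))"
      by (intro sum.cong refl) (use x in auto)
    then show "f (c \<cdot>\<^sub>m x) = c * f x"
      unfolding f_def using x less by (simp add: sum_distrib_left distrib_left)
  qed
  fix x assume "x \<in> g" and ker: "\<forall>y\<in>g. f (lie_bracket x y) = 0"
  then obtain A B where A: "in_q A" and B: "in_alt B" and x: "x = so_mat n A B" unfolding g_def by blast
  have val: "(\<Sum>u<n. \<Sum>v<n. A' u v * comm F A u v) +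
      (act n A B' (n - 3) (n - 2) - act n A' B (n - 3) (n - 2)) = 0" if "in_q A'" "in_alt B'" for A' B'
    using bracket_value[OF nf A that(1) B that(2)] ker so_mat_in_g[OF that] unfolding x by simp
  have act0: "act n A B' (n - 3) (n - 2) = 0" if "in_alt B'" for B'
    using val[OF in_q_zero that] act_tail[OF B, of 0] by simp
  have trA: "A (n - 3) (n - 3) + A (n - 2) (n - 2) = 0"
    using act0[OF in_alt_wedge[OF tail_mem(1,2)]] act_tail[OF in_alt_wedge[OF tail_mem(1,2)], of A] tail_neq
    by (simp add: wedge_def)
  have A13: "A (n - 3) (n - 1) = 0"
    using act0[OF in_alt_wedge[OF tail_mem(2,3)]] act_tail[OF in_alt_wedge[OF tail_mem(2,3)], of A] tail_neq
    by (simp add: wedge_def)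
  have A23: "A (n - 2) (n - 1) = 0"
    using act0[OF in_alt_wedge[OF tail_mem(1,3)]] act_tail[OF in_alt_wedge[OF tail_mem(1,3)], of A] tail_neq
    by (simp add: wedge_def)
  have unit: "comm F A u v = act n (unit_fun u v) B (n - 3) (n - 2)" if "R3 u v" for u v
  proof -
    have uv: "u < n" "v < n" using that by (auto simp: R3_def)
    have "in_q (unit_fun u v)" using in_q_unit[OF that, of 1] by simp
    from val[OF this in_alt_zero] show ?thesis
      using sum_unit_fun[OF uv, of "comm F A"] act_tail[OF in_alt_zero, of A] by simp
  qed
  have comm_diag: "comm F A u u = (of_bool (u = n - 3) + of_bool (u = n - 2)) * B (n - 3) (n - 2)" if "u < n" for u
    using unit[of u u] act_tail[OF B, of "unit_fun u u"] that tail_neq by (auto simp: R3_def unit_fun_def)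
  \<comment> \<open>The identity matrix acts on the alternating part as multiplication by 2, whereas
    its commutator with A is 0; this isolates one entry of B.\<close>
  have "0 = (\<Sum>u<n. (of_bool (u = n - 3) + of_bool (u = n - 2)) * B (n - 3) (n - 2))"
    using trace_comm[of F A] comm_diag by simp
  also have "\<dots> = (\<Sum>u<n. of_bool (u = n - 3) + of_bool (u = n - 2)) * B (n - 3) (n - 2)"
    by (rule sum_distrib_right[symmetric])
  also have "(\<Sum>u<n. of_bool (u = n - 3) + of_bool (u = n - 2)) = (2 :: complex)"
  proof -
    have "(\<Sum>u<n. of_bool (u = k)) = (1 :: complex)" if "k < n" for k
      using that by (simp add: of_bool_def)
    then show ?thesis using less by (simp add: sum.distrib)
  qed
  finally have B12: "B (n - 3) (n - 2) = 0" by simp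
  have "pat.form_ker F (\<lambda>i j. A j i)"
    unfolding pat.form_ker_def
  proof (intro conjI allI impI)
    show "pat.supported (\<lambda>i j. A j i)"
      unfolding pat.supported_def
    proof (intro allI impI)
      fix i j assume nz: "A j i \<noteq> 0"
      then have "R3 j i" using A by (simp add: in_q_def)
      then show "R j i" using R3_R[of j i] nz A13 A23 by auto
    qed
    fix u v assume uv: "R u v"
    have "comm F A u v = 0"
    proof (cases "u = v")
      case True
      then show ?thesis using comm_diag[of u] uv B12 by (simp add: R_def)
    next
      case False
      moreover have "\<not> (u = n - 3 \<and> v = n - 1)" "\<not> (u = n - 2 \<and> v = n - 1)"
        using uv not_R_tail by auto
      ultimately show ?thesis
        unfolding unit[OF R_R3[OF uv]] act_tail[OF B] by (auto simp: unit_fun_def)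
    qed
    then show "mm n (\<lambda>i j. A j i) F u v = mm n F (\<lambda>i j. A j i) u v" by (simp add: comm_def)
  qed
  then have "pat.scalar (\<lambda>i j. A j i)" unfolding F_def by (rule path_nondegenerate[OF e])
  then obtain c where c: "\<And>i j. i < n \<Longrightarrow> j < n \<Longrightarrow> A j i = (if i = j then c else 0)"
    unfolding pat.scalar_def by blast
  have "c + c = 0" using trA c[OF less(1,1)] c[OF less(2,2)] by simp
  then have "c = 0" by simp
  have A0: "A = 0"
  proof (intro ext)
    fix i j show "A i j = 0 i j"
      using c[of j i] \<open>c = 0\<close> A by (cases "i < n \<and> j < n") (auto simp: in_q_def R3_def)
  qed
  then have comm0: "comm F A u v = 0" for u v by (simp add: comm_def mm_def)
  \<comment> \<open>With A gone, the two positions of \<open>R3\<close> outside \<open>R\<close>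
    give the remaining entries of B.\<close>
  have B23: "B (n - 2) (n - 1) = 0"
    using unit[OF tail_R3[OF tail_mem(1,3)]] act_tail[OF B, of "unit_fun (n - 3) (n - 1)"] tail_neq
    by (simp add: comm0 unit_fun_def)
  have B13: "B (n - 3) (n - 1) = 0"
    using unit[OF tail_R3[OF tail_mem(2,3)]] act_tail[OF B, of "unit_fun (n - 2) (n - 1)"] tail_neq
    by (simp add: comm0 unit_fun_def)
  have "B = 0"
  proof (intro ext)
    fix i j show "B i j = 0 i j"
    proof (rule ccontr)
      assume nz: "B i j \<noteq> 0 i j"
      then have "tail i" "tail j" using in_alt_tail[OF B, of i j] by auto
      then show False
        using nz B12 B13 B23 in_alt_diag[OF B] in_alt_swap[OF B, of "n - 2" "n - 3"]
          in_alt_swap[OF B, of "n - 1" "n - 3"] in_alt_swap[OF B, of "n - 1" "n - 2"]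
        by (elim tail_cases) simp_all
    qed
  qed
  then show "x = 0\<^sub>m (2 * n) (2 * n)" unfolding x A0 by (simp add: so_mat_zero)
qed

definition nondegenerate :: "(complex mat \<Rightarrow> complex) \<Rightarrow> bool" where
  "nondegenerate f \<longleftrightarrow> linear_functional g f \<and>
     (\<forall>x\<in>g. (\<forall>y\<in>g. f (lie_bracket x y) = 0) \<longrightarrow> x = 0\<^sub>m (2 * n) (2 * n))"

text \<open>The restriction of \<open>f\<close> to the alternating part, read as an alternating form
  on the basis vectors with the given indices.\<close>

definition \<omega> :: "(complex mat \<Rightarrow> complex) \<Rightarrow> nat \<Rightarrow> nat \<Rightarrow> complex" where
  "\<omega> f x y = f (so_mat n 0 (wedge x y))"

lemma functional_linear:
  assumes "linear_functional g f" "in_q A" "in_q A'" "in_alt B" "in_alt B'"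
  shows "f (so_mat n (A + A') (B + B')) = f (so_mat n A B) + f (so_mat n A' B')"
    and "f (so_mat n (\<lambda>i j. c * A i j) (\<lambda>i j. c * B i j)) = c * f (so_mat n A B)"
  using lie.lin_add[OF assms(1) so_mat_in_g so_mat_in_g, OF assms(2,4,3,5)]
    lie.lin_smult[OF assms(1) so_mat_in_g[OF assms(2,4)], of c]
  by (simp_all add: so_mat_add so_mat_smult)

lemma zero_fun_eq: "(0 :: nat \<Rightarrow> nat \<Rightarrow> complex) + 0 = 0" "(\<lambda>i j. c * (0 :: nat \<Rightarrow> nat \<Rightarrow> complex) i j) = 0"
  by (simp_all add: fun_eq_iff)

lemma functional_gl_part:
  assumes f: "linear_functional g f" and A: "in_q A"
    and F: "\<And>i j. R3 i j \<Longrightarrow> F i j = f (so_mat n (unit_fun i j) 0)"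
  shows "f (so_mat n A 0) = (\<Sum>i<n. \<Sum>j<n. F i j * A i j)"
proof -
  define M where "M S i j = (if (i, j) \<in> S then A i j else 0)" for S i j
  have M: "in_q (M S)" for S using A by (auto simp: in_q_def M_def)
  have "f (so_mat n (M S) 0) = (\<Sum>(i, j)\<in>S. F i j * A i j)" if "finite S" for S
    using that
  proof (induction S)
    case empty
    have "M {} = 0" by (auto simp: M_def fun_eq_iff)
    then show ?case unfolding \<open>M {} = 0\<close> so_mat_zero using lie.lin_zero[OF f] by simp
  next
    case (insert p S)
    obtain u v where p: "p = (u, v)" by (cases p)
    show ?case
    proof (cases "A u v = 0")
      case True
      then have "M (insert p S) = M S" by (auto simp: M_def p fun_eq_iff)
      then show ?thesis using insert True by (simp add: p)
    next
      case False
      then have uv: "R3 u v" using A by (simp add: in_q_def)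
      have "M (insert p S) = M S + (\<lambda>i j. A u v * unit_fun u v i j)"
        using insert.hyps by (auto simp: M_def p unit_fun_def fun_eq_iff)
      then have "f (so_mat n (M (insert p S)) 0) =
          f (so_mat n (M S) 0) + f (so_mat n (\<lambda>i j. A u v * unit_fun u v i j) 0)"
        using functional_linear(1)[OF f M in_q_unit[OF uv] in_alt_zero in_alt_zero, of S "A u v"]
        unfolding zero_fun_eq by simp
      also have "f (so_mat n (\<lambda>i j. A u v * unit_fun u v i j) 0) = A u v * F u v"
        using functional_linear(2)[OF f _ in_q_zero in_alt_zero in_alt_zero, of "unit_fun u v" "A u v"]
          in_q_unit[OF uv, of 1] F[OF uv] unfolding zero_fun_eq by simp
      finally show ?thesis using insert by (simp add: p mult.commute add.commute)
    qed
  qed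
  from this[of "{..<n} \<times> {..<n}"] have "f (so_mat n (M ({..<n} \<times> {..<n})) 0) = (\<Sum>i<n. \<Sum>j<n. F i j * A i j)"
    by (simp add: sum.cartesian_product)
  moreover have "M ({..<n} \<times> {..<n}) = A"
    using A by (auto simp: M_def fun_eq_iff in_q_def R3_def)
  ultimately show ?thesis by simp
qed

lemma functional_alt_linear:
  assumes f: "linear_functional g f" and B: "in_alt B" "in_alt B'"
  shows "f (so_mat n 0 (B + B')) = f (so_mat n 0 B) + f (so_mat n 0 B')"
    and "f (so_mat n 0 (\<lambda>i j. c * B i j)) = c * f (so_mat n 0 B)"
  using functional_linear(1)[OF f in_q_zero in_q_zero B] functional_linear(2)[OF f in_q_zero in_q_zero B, of c]
  unfolding zero_fun_eq by blast+

lemma alt_decompose: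
  assumes B: "in_alt B"
  shows "B = (\<lambda>i j. B (n - 3) (n - 2) * wedge (n - 3) (n - 2) i j) +
    ((\<lambda>i j. B (n - 3) (n - 1) * wedge (n - 3) (n - 1) i j) +
     (\<lambda>i j. B (n - 2) (n - 1) * wedge (n - 2) (n - 1) i j))" (is "B = ?W")
proof (intro ext)
  fix i j
  show "B i j = ?W i j"
  proof (cases "tail i \<and> tail j")
    case True
    then show ?thesis
      using in_alt_diag[OF B] in_alt_swap[OF B, of "n - 2" "n - 3"] in_alt_swap[OF B, of "n - 1" "n - 3"]
        in_alt_swap[OF B, of "n - 1" "n - 2"] tail_neq
      by (elim conjE tail_cases) (simp_all add: wedge_def)
  next
    case False
    then have "B i j = 0" "wedge (n - 3) (n - 2) i j = 0" "wedge (n - 3) (n - 1) i j = 0" "wedge (n - 2) (n - 1) i j = 0"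
      using in_alt_tail[OF B] wedge_nonzero tail_mem by metis+
    then show ?thesis by simp
  qed
qed

lemma functional_alt_part:
  assumes f: "linear_functional g f" and B: "in_alt B"
  shows "f (so_mat n 0 B) = B (n - 3) (n - 2) * \<omega> f (n - 3) (n - 2) +
    B (n - 3) (n - 1) * \<omega> f (n - 3) (n - 1) + B (n - 2) (n - 1) * \<omega> f (n - 2) (n - 1)"
proof -
  note w = in_alt_wedge[OF tail_mem(1,2)] in_alt_wedge[OF tail_mem(1,3)] in_alt_wedge[OF tail_mem(2,3)]
  note s = in_alt_linear(3)[OF w(1)] in_alt_linear(3)[OF w(2)] in_alt_linear(3)[OF w(3)]
  show ?thesis
    by (subst alt_decompose[OF B])
      (simp add: functional_alt_linear(1)[OF f] functional_alt_linear(2)[OF f w(1,1)]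
        functional_alt_linear(2)[OF f w(2,2)] functional_alt_linear(2)[OF f w(3,3)]
        s w in_alt_linear(1) \<omega>_def add.assoc del: One_nat_def)
qed

lemma normal_form_exists:
  assumes f: "linear_functional g f"
    and zero: "\<omega> f (n - 3) (n - 1) = 0" "\<omega> f (n - 2) (n - 1) = 0"
  shows "\<exists>F. normal_form f F (\<omega> f (n - 3) (n - 2))"
proof -
  define F where "F i j = f (so_mat n (unit_fun i j) 0)" for i j
  have "normal_form f F (\<omega> f (n - 3) (n - 2))"
    unfolding normal_form_def
  proof (intro allI impI)
    fix A B assume A: "in_q A" and B: "in_alt B"
    have "A + 0 = A" "0 + B = B" by (auto simp: fun_eq_iff)
    then have "f (so_mat n A B) = f (so_mat n A 0) + f (so_mat n 0 B)"
      using functional_linear(1)[OF f A in_q_zero in_alt_zero B] by simp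
    then show "f (so_mat n A B) = (\<Sum>i<n. \<Sum>j<n. F i j * A i j) + \<omega> f (n - 3) (n - 2) * B (n - 3) (n - 2)"
      using functional_gl_part[OF f A, of F] functional_alt_part[OF f B] zero by (simp add: F_def)
  qed
  then show ?thesis by blast
qed

text \<open>A nonscalar kernel element for p is shifted by a scalar \<open>d\<close> to have trace 0
  on the indices \<open>n - 3\<close> and \<open>n - 2\<close>. The conditions still open are those
  at the two positions of \<open>R3\<close> outside \<open>R\<close>; two coordinates of B, namely
  \<open>\<beta>\<close> and \<open>\<gamma>\<close>, are free to meet them because the coefficient
  \<open>w\<close> is nonzero.\<close>

lemma cycle_not_nondegenerate:
  assumes e: "n < 2 * e" and f: "nondegenerate f"
    and zero: "\<omega> f (n - 3) (n - 1) = 0" "\<omega> f (n - 2) (n - 1) = 0"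
    and w: "\<omega> f (n - 3) (n - 2) \<noteq> 0"
  shows False
proof -
  define w where "w = \<omega> f (n - 3) (n - 2)"
  have "linear_functional g f" using f by (simp add: nondegenerate_def)
  then obtain F where nf: "normal_form f F w" using normal_form_exists zero unfolding w_def by blast
  obtain Z where Z: "pat.form_ker F Z" "\<not> pat.scalar Z" using cycle_degenerate[OF e] by blast
  define d where "d = (Z (n - 3) (n - 3) + Z (n - 2) (n - 2)) / 2"
  define A where "A i j = Z j i - (if i = j \<and> i < n then d else 0)" for i j
  have A_R: "R i j" if "A i j \<noteq> 0" for i j
  proof (cases "i = j \<and> i < n")
    case True
    then show ?thesis using R_def by simp
  next
    case False
    then have "A i j = Z j i" by (auto simp: A_def)
    then show ?thesis using that Z(1) by (simp add: pat.form_ker_def pat.supported_def)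
  qed
  have A: "in_q A" using A_R R_R3 unfolding in_q_def by blast
  have tr: "A (n - 3) (n - 3) + A (n - 2) (n - 2) = 0" using n_ge by (simp add: A_def d_def field_simps)
  have A13: "A (n - 3) (n - 1) = 0" and A23: "A (n - 2) (n - 1) = 0" using A_R not_R_tail by blast+
  have comm_R: "comm F A u v = 0" if uv: "R u v" for u v
  proof -
    have "u < n" "v < n" using uv by (auto simp: R_def)
    have "(\<Sum>k<n. A k u * F k v) = (\<Sum>k<n. Z u k * F k v - (if k = u then d * F u v else 0))"
    proof (rule sum.cong[OF refl])
      fix k assume "k \<in> {..<n}"
      then show "A k u * F k v = Z u k * F k v - (if k = u then d * F u v else 0)"
        by (cases "k = u") (simp_all add: A_def left_diff_distrib)
    qed
    then have 1: "mm n (\<lambda>i j. A j i) F u v = mm n Z F u v - d * F u v"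
      unfolding mm_def sum_subtractf using \<open>u < n\<close> by simp
    have "(\<Sum>k<n. F u k * A v k) = (\<Sum>k<n. F u k * Z k v - (if k = v then d * F u v else 0))"
    proof (rule sum.cong[OF refl])
      fix k assume "k \<in> {..<n}"
      then show "F u k * A v k = F u k * Z k v - (if k = v then d * F u v else 0)"
        using \<open>v < n\<close> by (cases "k = v") (simp_all add: A_def right_diff_distrib)
    qed
    then have 2: "mm n F (\<lambda>i j. A j i) u v = mm n F Z u v - d * F u v"
      unfolding mm_def sum_subtractf using \<open>v < n\<close> by simp
    have "mm n Z F u v = mm n F Z u v" using Z(1) uv unfolding pat.form_ker_def by blast
    then show ?thesis unfolding comm_def 1 2 by simp
  qed
  define \<beta> \<gamma> where "\<beta> = - comm F A (n - 3) (n - 1) / w" and "\<gamma> = comm F A (n - 2) (n - 1) / w"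
  define B where "B = (\<lambda>i j. \<beta> * wedge (n - 2) (n - 1) i j) + (\<lambda>i j. \<gamma> * wedge (n - 3) (n - 1) i j)"
  have B: "in_alt B" unfolding B_def by (intro in_alt_linear in_alt_wedge tail_mem)
  have B_vals: "B (n - 3) (n - 2) = 0" "B (n - 2) (n - 1) = \<beta>" "B (n - 3) (n - 1) = \<gamma>"
    using tail_neq by (simp_all add: B_def wedge_def)
  have "f (lie_bracket (so_mat n A B) y) = 0" if y: "y \<in> g" for y
  proof -
    obtain A' B' where A': "in_q A'" and B': "in_alt B'" and y: "y = so_mat n A' B'"
      using y unfolding g_def by blast
    have less: "n - 3 < n" "n - 2 < n" "n - 1 < n" using n_ge by auto
    have "(\<Sum>u<n. \<Sum>v<n. A' u v * comm F A u v) =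
        (\<Sum>u<n. \<Sum>v<n. unit_fun (n - 3) (n - 1) u v * (A' u v * comm F A u v) +
          unit_fun (n - 2) (n - 1) u v * (A' u v * comm F A u v))"
    proof (intro sum.cong refl)
      fix u v
      have "A' u v * comm F A u v = 0" if "\<not> (v = n - 1 \<and> (u = n - 3 \<or> u = n - 2))"
        using A' R3_R[of u v] comm_R[of u v] that unfolding in_q_def by auto
      then show "A' u v * comm F A u v = unit_fun (n - 3) (n - 1) u v * (A' u v * comm F A u v) +
          unit_fun (n - 2) (n - 1) u v * (A' u v * comm F A u v)"
        using tail_neq by (auto simp: unit_fun_def)
    qed
    also have "\<dots> = A' (n - 3) (n - 1) * comm F A (n - 3) (n - 1) + A' (n - 2) (n - 1) * comm F A (n - 2) (n - 1)"
      unfolding sum.distrib sum_unit_fun[OF less(1,3)] sum_unit_fun[OF less(2,3)] ..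
    finally have sum: "(\<Sum>u<n. \<Sum>v<n. A' u v * comm F A u v) = \<dots>" .
    have "act n A B' (n - 3) (n - 2) = 0" unfolding act_tail[OF B'] tr A13 A23 by simp
    moreover have "w * act n A' B (n - 3) (n - 2) =
        A' (n - 3) (n - 1) * comm F A (n - 3) (n - 1) + A' (n - 2) (n - 1) * comm F A (n - 2) (n - 1)"
      unfolding act_tail[OF B] B_vals \<beta>_def \<gamma>_def using w by (simp add: w_def field_simps)
    ultimately show ?thesis
      unfolding y bracket_value[OF nf A A' B B'] sum by (simp add: right_diff_distrib)
  qed
  then have "so_mat n A B = 0\<^sub>m (2 * n) (2 * n)"
    using f so_mat_in_g[OF A B] unfolding nondegenerate_def by blast
  then have "A i j = 0" if "i < n" "j < n" for i j using so_mat_eq_zero(1) that by blast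
  then have "Z i j = (if i = j then d else 0)" if "i < n" "j < n" for i j
    using that unfolding A_def by (metis eq_iff_diff_eq_0 diff_zero)
  then show False using Z(2) unfolding pat.scalar_def by blast
qed

text \<open>The new functional is \<open>f\<close> after conjugation by \<open>1 + X\<close>, where
  \<open>X\<close> is \<open>c\<close> times the matrix unit at \<open>(i, j)\<close>. The quadratic
  term drops out: for \<open>x \<noteq> y\<close> at most one factor of the wedge is moved, and its
  image has index \<open>i \<noteq> j\<close>.\<close>

lemma transvection:
  assumes f: "nondegenerate f" and ij: "tail i" "tail j" "i \<noteq> j"
  obtains f' where "nondegenerate f'"
    and "\<And>x y. tail x \<Longrightarrow> tail y \<Longrightarrow> x \<noteq> y \<Longrightarrow>
      \<omega> f' x y = \<omega> f x y + c * (of_bool (x = j) * \<omega> f i y + of_bool (y = j) * \<omega> f x i)"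
proof -
  have lin: "linear_functional g f" using f by (simp add: nondegenerate_def)
  define E where "E = (\<lambda>k l. c * unit_fun i j k l)"
  define X where "X = so_mat n E 0"
  have E: "in_q E" unfolding E_def by (intro in_q_unit tail_R3 ij)
  have X: "X \<in> g" unfolding X_def by (rule so_mat_in_g[OF E in_alt_zero])
  have EE: "mm n E E k l = 0" for k l
    unfolding mm_def E_def using ij(3) by (intro sum.neutral ballI) (auto simp: unit_fun_def)
  have XX: "X * X = 0\<^sub>m (2 * n) (2 * n)"
  proof (rule mirror_mat_eqI[where n = n])
    show "X * X \<in> carrier_mat (2 * n) (2 * n)" by (simp add: X_def mult_carrier_mat[of _ _ "2 * n"])
    fix k l assume kl: "k < n" "l < n"
    note P = so_mat_mult_index[OF kl X_def[THEN arg_cong2[where f = "(*)", OF X_def]]]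
    show "(X * X) $$ (k, l) = 0\<^sub>m (2 * n) (2 * n) $$ (k, l)"
      "(X * X) $$ (k, 2 * n - 1 - l) = 0\<^sub>m (2 * n) (2 * n) $$ (k, 2 * n - 1 - l)"
      "(X * X) $$ (2 * n - 1 - k, l) = 0\<^sub>m (2 * n) (2 * n) $$ (2 * n - 1 - k, l)"
      "(X * X) $$ (2 * n - 1 - k, 2 * n - 1 - l) = 0\<^sub>m (2 * n) (2 * n) $$ (2 * n - 1 - k, 2 * n - 1 - l)"
      unfolding P EE using kl by simp_all
  qed simp
  have bracket_X: "lie_bracket X (so_mat n 0 B) = so_mat n 0 (act n E B)" for B
  proof -
    have "mm n E 0 - mm n 0 E = 0" "act n E B - act n 0 0 = act n E B"
      by (auto simp: mm_distrib act_def fun_eq_iff)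
    then show ?thesis unfolding X_def so_mat_bracket by simp
  qed
  have nondeg: "x = 0\<^sub>m (2 * n) (2 * n)" if "x \<in> g" "\<And>y. y \<in> g \<Longrightarrow> f (lie_bracket x y) = 0" for x
    using f that unfolding nondegenerate_def by blast
  obtain f' where f': "nondegenerate f'"
    and val: "\<And>M. M \<in> g \<Longrightarrow> f' M = f M + f (lie_bracket X M) + 1/2 * f (lie_bracket X (lie_bracket X M))"
  proof (rule lie.Ad_nondegenerate[OF lin nondeg X XX])
    fix h assume h: "linear_functional g h"
      "\<And>x. x \<in> g \<Longrightarrow> (\<And>y. y \<in> g \<Longrightarrow> h (lie_bracket x y) = 0) \<Longrightarrow> x = 0\<^sub>m (2 * n) (2 * n)"
      "\<And>M. M \<in> g \<Longrightarrow> h M = f M + f (lie_bracket X M) + 1/2 * f (lie_bracket X (lie_bracket X M))"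
    have "nondegenerate h" unfolding nondegenerate_def using h(1,2) by blast
    then show thesis by (rule that) (rule h(3))
  qed
  show ?thesis
  proof (rule that[OF f'])
    fix x y assume xy: "tail x" "tail y" "x \<noteq> y"
    note less = tail_less[OF xy(1)] tail_less[OF xy(2)] tail_less[OF ij(1)]
    have act1: "act n E (wedge x y) =
        (\<lambda>k l. c * (of_bool (x = j) * wedge i y k l + of_bool (y = j) * wedge x i k l))"
      unfolding E_def by (rule act_unit_wedge[OF less(1,2)])
    have act_smult: "act n E (\<lambda>k l. a' * B k l) = (\<lambda>k l. a' * act n E B k l)" for a' B
      by (auto simp: act_def fun_eq_iff sum_distrib_left algebra_simps)
    have act2: "act n E (act n E (wedge x y)) = 0"
    proof -
      consider "x = j" "y \<noteq> j" | "y = j" "x \<noteq> j" | "x \<noteq> j" "y \<noteq> j" using xy(3) by blast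
      then show ?thesis
      proof cases
        case 1
        have "act n E (wedge x y) = (\<lambda>k l. c * wedge i y k l)" unfolding act1 using 1 by simp
        moreover have "act n E (wedge i y) = 0"
          unfolding E_def act_unit_wedge[OF less(3,2)] using 1 ij(3) by (simp add: fun_eq_iff)
        ultimately show ?thesis by (simp only: act_smult) (simp add: fun_eq_iff)
      next
        case 2
        have "act n E (wedge x y) = (\<lambda>k l. c * wedge x i k l)" unfolding act1 using 2 by simp
        moreover have "act n E (wedge x i) = 0"
          unfolding E_def act_unit_wedge[OF less(1,3)] using 2 ij(3) by (simp add: fun_eq_iff)
        ultimately show ?thesis by (simp only: act_smult) (simp add: fun_eq_iff)
      next
        case 3
        have "act n E (wedge x y) = (\<lambda>k l. 0 * wedge x y k l)" unfolding act1 using 3 by simp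
        then show ?thesis by (simp only: act_smult) (simp add: fun_eq_iff)
      qed
    qed
    have w: "in_alt (wedge x y)" "in_alt (wedge i y)" "in_alt (wedge x i)"
      by (intro in_alt_wedge xy ij)+
    have dec: "act n E (wedge x y) = (\<lambda>k l. (c * of_bool (x = j)) * wedge i y k l) +
        (\<lambda>k l. (c * of_bool (y = j)) * wedge x i k l)"
      unfolding act1 by (auto simp: fun_eq_iff algebra_simps)
    have 1: "f (so_mat n 0 (act n E (wedge x y))) =
        c * (of_bool (x = j) * \<omega> f i y + of_bool (y = j) * \<omega> f x i)"
      unfolding dec functional_alt_linear(1)[OF lin in_alt_linear(3)[OF w(2)] in_alt_linear(3)[OF w(3)]]
        functional_alt_linear(2)[OF lin w(2,2)] functional_alt_linear(2)[OF lin w(3,3)]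
      by (simp add: \<omega>_def algebra_simps)
    have 2: "f (so_mat n 0 0) = 0" using lie.lin_zero[OF lin] by (simp add: so_mat_zero)
    show "\<omega> f' x y = \<omega> f x y + c * (of_bool (x = j) * \<omega> f i y + of_bool (y = j) * \<omega> f x i)"
      unfolding \<omega>_def[of f'] val[OF so_mat_in_g[OF in_q_zero w(1)]] bracket_X act2 1 2
      by (simp add: \<omega>_def)
  qed
qed

lemma \<omega>_swap:
  assumes "linear_functional g f" "tail x" "tail y" shows "\<omega> f y x = - \<omega> f x y"
proof -
  have "wedge y x = (\<lambda>i j. - 1 * wedge x y i j)" unfolding wedge_swap[of y x] by (auto simp: fun_eq_iff)
  then show ?thesis
    unfolding \<omega>_def using functional_alt_linear(2)[OF assms(1) in_alt_wedge[OF assms(2,3)] in_alt_wedge[OF assms(2,3)], of "- 1"]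
    by simp
qed

text \<open>The form \<open>\<omega>\<close> lives on a space of dimension three. It is nonzero,
  since otherwise an alternating matrix would lie in the kernel. So its radical is a line, and
  transvections move that line to the last basis vector.\<close>

lemma cycle_not_frobenius:
  assumes e: "n < 2 * e" shows "\<not> frobenius (2 * n) g"
proof
  assume "frobenius (2 * n) g"
  then obtain f0 where f0: "nondegenerate f0"
    unfolding lie.frobenius_iff nondegenerate_def by blast
  note t = tail_mem and tn = tail_neq
  have lin0: "linear_functional g f0" using f0 by (simp add: nondegenerate_def)
  have "\<omega> f0 (n - 3) (n - 2) \<noteq> 0 \<or> \<omega> f0 (n - 3) (n - 1) \<noteq> 0 \<or> \<omega> f0 (n - 2) (n - 1) \<noteq> 0"
  proof (rule ccontr)
    assume z: "\<not> ?thesis"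
    define b0 where "b0 = so_mat n 0 (wedge (n - 3) (n - 2))"
    note w = in_alt_wedge[OF t(1,2)]
    have "f0 (lie_bracket b0 y) = 0" if y: "y \<in> g" for y
    proof -
      obtain A B where A: "in_q A" and B: "in_alt B" and y: "y = so_mat n A B" using y unfolding g_def by blast
      have "mm n 0 A - mm n A 0 = 0" "act n 0 B - act n A (wedge (n - 3) (n - 2)) = - act n A (wedge (n - 3) (n - 2))"
        by (auto simp: mm_distrib act_def fun_eq_iff)
      moreover have "in_alt (- act n A (wedge (n - 3) (n - 2)))"
        using in_alt_linear(3)[OF in_alt_act[OF A w], of "- 1"] by (simp add: fun_Compl_def)
      ultimately show ?thesis
        using functional_alt_part[OF lin0] z unfolding b0_def y so_mat_bracket by simp
    qed
    then have "b0 = 0\<^sub>m (2 * n) (2 * n)"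
      using f0 so_mat_in_g[OF in_q_zero w] unfolding nondegenerate_def b0_def by blast
    then have "wedge (n - 3) (n - 2) (n - 3) (n - 2) = 0"
      unfolding b0_def using so_mat_eq_zero(2)[of n 0 "wedge (n - 3) (n - 2)" "n - 3" "n - 2"] n_ge by simp
    then show False using tn by (simp add: wedge_def)
  qed
  then obtain f1 where f1: "nondegenerate f1" and w1: "\<omega> f1 (n - 3) (n - 2) \<noteq> 0"
  proof -
    assume thesis: "\<And>f1. nondegenerate f1 \<Longrightarrow> \<omega> f1 (n - 3) (n - 2) \<noteq> 0 \<Longrightarrow> thesis"
    assume "\<omega> f0 (n - 3) (n - 2) \<noteq> 0 \<or> \<omega> f0 (n - 3) (n - 1) \<noteq> 0 \<or> \<omega> f0 (n - 2) (n - 1) \<noteq> 0"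
    then consider "\<omega> f0 (n - 3) (n - 2) \<noteq> 0" | "\<omega> f0 (n - 3) (n - 2) = 0" "\<omega> f0 (n - 3) (n - 1) \<noteq> 0"
      | "\<omega> f0 (n - 3) (n - 2) = 0" "\<omega> f0 (n - 2) (n - 1) \<noteq> 0" by blast
    then show thesis
    proof cases
      case 1
      then show ?thesis by (rule thesis[OF f0])
    next
      case 2
      obtain f' where f': "nondegenerate f'"
        and v: "\<And>x y. tail x \<Longrightarrow> tail y \<Longrightarrow> x \<noteq> y \<Longrightarrow> \<omega> f' x y = \<omega> f0 x y +
          1 * (of_bool (x = n - 2) * \<omega> f0 (n - 1) y + of_bool (y = n - 2) * \<omega> f0 x (n - 1))"
        using transvection[OF f0 t(3,2) tn(6), where c = 1] by blast
      show ?thesis by (rule thesis[OF f']) (use v[OF t(1,2) tn(1)] 2 tn in simp)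
    next
      case 3
      obtain f' where f': "nondegenerate f'"
        and v: "\<And>x y. tail x \<Longrightarrow> tail y \<Longrightarrow> x \<noteq> y \<Longrightarrow> \<omega> f' x y = \<omega> f0 x y +
          1 * (of_bool (x = n - 3) * \<omega> f0 (n - 1) y + of_bool (y = n - 3) * \<omega> f0 x (n - 1))"
        using transvection[OF f0 t(3,1) tn(5), where c = 1] by blast
      show ?thesis
        by (rule thesis[OF f']) (use v[OF t(1,2) tn(1)] 3 tn \<omega>_swap[OF lin0 t(2,3)] in simp)
    qed
  qed
  \<comment> \<open>The coefficients in this transvection and the next are chosen to cancel the
    entries of \<open>\<omega>\<close> at \<open>(n - 3, n - 1)\<close> and at
    \<open>(n - 2, n - 1)\<close>.\<close>
  obtain f2 where f2: "nondegenerate f2"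
    and v2: "\<And>x y. tail x \<Longrightarrow> tail y \<Longrightarrow> x \<noteq> y \<Longrightarrow> \<omega> f2 x y = \<omega> f1 x y +
      (- \<omega> f1 (n - 3) (n - 1) / \<omega> f1 (n - 3) (n - 2)) *
        (of_bool (x = n - 1) * \<omega> f1 (n - 2) y + of_bool (y = n - 1) * \<omega> f1 x (n - 2))"
    using transvection[OF f1 t(2,3) tn(3)] by blast
  have w2: "\<omega> f2 (n - 3) (n - 2) \<noteq> 0" "\<omega> f2 (n - 3) (n - 1) = 0"
    using v2[OF t(1,2) tn(1)] v2[OF t(1,3) tn(2)] w1 tn by simp_all
  obtain f3 where f3: "nondegenerate f3"
    and v3: "\<And>x y. tail x \<Longrightarrow> tail y \<Longrightarrow> x \<noteq> y \<Longrightarrow> \<omega> f3 x y = \<omega> f2 x y +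
      (\<omega> f2 (n - 2) (n - 1) / \<omega> f2 (n - 3) (n - 2)) *
        (of_bool (x = n - 1) * \<omega> f2 (n - 3) y + of_bool (y = n - 1) * \<omega> f2 x (n - 3))"
    using transvection[OF f2 t(1,3) tn(2)] by blast
  have lin2: "linear_functional g f2" using f2 by (simp add: nondegenerate_def)
  have "wedge (n - 3) (n - 3) = 0" by (auto simp: wedge_def fun_eq_iff)
  then have "\<omega> f2 (n - 3) (n - 3) = 0"
    unfolding \<omega>_def using lie.lin_zero[OF lin2] by (simp add: so_mat_zero)
  then have "\<omega> f3 (n - 3) (n - 2) \<noteq> 0" "\<omega> f3 (n - 3) (n - 1) = 0" "\<omega> f3 (n - 2) (n - 1) = 0"
    using v3[OF t(1,2) tn(1)] v3[OF t(1,3) tn(2)] v3[OF t(2,3) tn(3)] w2 tn \<omega>_swap[OF lin2 t(1,2)] by simp_all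
  then show False using cycle_not_nondegenerate[OF e f3] by blast
qed

end

section \<open>Delta, the fractional part, and the theorem\<close>

text \<open>Counting from 1 and modulo the sum of the blocks, the bottom reversal is
  \<open>- 2 - i\<close> and the top reversal is \<open>a + 1 - j\<close>; their composition is a
  shift by \<open>a + 3\<close>.\<close>

lemma delta_A_eq:
  assumes "0 < a" "3 < b"
  shows "delta_A a b (a + b - 3) 3 = a + 3"
proof -
  define m where "m = a + b"
  define P where "P r \<longleftrightarrow> r < m \<and> (\<forall>i\<in>{1..m}.
      (int (block_reverse a b (block_reverse (m - 3) 3 i)) - int i) mod int m = int r)" for r
  have shift: "(int (block_reverse a b (block_reverse (m - 3) 3 i)) - int i) mod int m = int (a + 3)"
    if i: "i \<in> {1..m}" for i
  proof -
    define j where "j = block_reverse (m - 3) 3 i"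
    have j: "1 \<le> j" "j \<le> m" and "\<exists>k. int j = int m - 2 - int i + k * int m"
    proof -
      consider "i \<le> m - 3" | "m - 3 < i" by linarith
      then have "1 \<le> j \<and> j \<le> m \<and> (\<exists>k. int j = int m - 2 - int i + k * int m)"
      proof cases
        case 1
        then have "j = m - 2 - i" using i assms by (simp add: j_def block_reverse_def m_def)
        then show ?thesis using 1 i assms by (intro conjI exI[of _ 0]) (auto simp: m_def)
      next
        case 2
        then have "j = 2 * m - 2 - i" using i assms by (simp add: j_def block_reverse_def m_def)
        then show ?thesis using 2 i assms by (intro conjI exI[of _ 1]) (auto simp: m_def)
      qed
      then show "1 \<le> j" "j \<le> m" "\<exists>k. int j = int m - 2 - int i + k * int m" by auto
    qed
    then obtain k where k: "int j = int m - 2 - int i + k * int m" by blast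
    have "\<exists>l. int (block_reverse a b j) = int a + 1 - int j + l * int m"
    proof (cases "j \<le> a")
      case True
      then show ?thesis by (intro exI[of _ 0]) (simp add: block_reverse_def)
    next
      case False
      then show ?thesis using j by (intro exI[of _ 1]) (simp add: block_reverse_def m_def)
    qed
    then obtain l where "int (block_reverse a b j) = int a + 1 - int j + l * int m" by blast
    then have "int (block_reverse a b j) - int i = int (a + 3) + (l - k - 1) * int m"
      unfolding k by (simp add: algebra_simps)
    then show ?thesis using assms unfolding j_def[symmetric] by (simp add: m_def)
  qed
  have "(THE r. P r) = a + 3"
  proof (rule the_equality)
    show "P (a + 3)" using shift assms by (simp add: P_def m_def)
    fix r assume "P r"
    moreover have one: "(1 :: nat) \<in> {1..m}" using assms by (simp add: m_def)
    ultimately have "int r = int (a + 3)" unfolding P_def using shift[OF one] by metis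
    then show "r = a + 3" by simp
  qed
  then show ?thesis unfolding delta_A_def P_def m_def by simp
qed

lemma xi_eq: "xi n r = real (r ^ (totient n - 1) mod n) / real n"
proof -
  define m where "m = r ^ (totient n - 1)"
  have "\<lfloor>real m / real n\<rfloor> = int (m div n)" by (rule floor_divide_of_nat_eq)
  moreover have "real m / real n = real (m div n) + real (m mod n) / real n"
    by (rule of_nat_of_nat_div_aux)
  ultimately show ?thesis unfolding xi_def m_def[symmetric] by simp
qed

theorem theorem6p18:
  fixes a b c n :: nat
  assumes "a > 0" and "b > 0" and "c > 0" and "n > 0"
    and "a + b = n" and "c = n - 3" and "b > n - c" and "n - c = 3"
    and "gcd (a + b) (b + c) = 1"
  shows "frobenius (2 * n) (seaweed_D n [a, b] [c]) \<longleftrightarrow>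
           0 < xi n (delta_A a b c 3) \<and> xi n (delta_A a b c 3) < 0.5"
proof -
  have n_eq: "n = a + b" and b: "3 < b" using assms by simp_all
  have c: "c = a + b - 3" using assms by simp
  have "coprime n (a + 3)"
  proof (rule coprimeI)
    fix d assume d: "d dvd n" "d dvd a + 3"
    \<comment> \<open>Modulo \<open>n\<close> the numbers \<open>a + 3\<close> and
      \<open>b + c\<close> are opposite, which converts the given gcd condition.\<close>
    have "b + c + (a + 3) = 2 * n" using c n_eq b by simp
    then have "d dvd (b + c) + (a + 3)" using d(1) by (metis dvd_mult)
    then have "d dvd b + c" using d(2) by (simp add: dvd_add_left_iff)
    then have "d dvd gcd (a + b) (b + c)" using d(1) n_eq by simp
    then show "is_unit d" using assms(9) by simp
  qed
  \<comment> \<open>By Euler's theorem this power inverts \<open>a + 3\<close> modulo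
    \<open>n\<close>; its residue is the numerator of the fractional part in
    \<open>xi\<close>.\<close>
  define e where "e = (a + 3) ^ (totient n - 1) mod n"
  have n5: "5 \<le> n" using n_eq b assms(1) by simp
  have "[(a + 3) ^ totient n = 1] (mod n)"
    using euler_theorem[of "a + 3" n] \<open>coprime n (a + 3)\<close> by (simp add: coprime_commute)
  moreover have "(a + 3) ^ totient n = (a + 3) ^ (totient n - 1) * (a + 3)"
    using n5 by (metis power_minus_mult totient_gt_0_iff not_numeral_le_zero gr0I)
  ultimately have "[e * (a + 3) = 1] (mod n)"
    unfolding e_def by (metis cong_def mod_mult_left_eq)
  then have "[int (e * (a + 3)) = int 1] (mod int n)" by (simp only: cong_int_iff)
  then have e_inv: "[int e * (int a + 3) = 1] (mod int n)" by simp
  interpret seaweed_meander a b n e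
  proof
    show "e < n" using n5 by (simp add: e_def)
  qed (rule assms(1) b n_eq e_inv)+
  \<comment> \<open>If \<open>2 * e = n\<close>, then \<open>e\<close> divides \<open>n\<close> and
    is invertible modulo \<open>n\<close>, so \<open>e = 1\<close> and \<open>n = 2\<close>. This
    closes the gap between the two strict cases.\<close>
  have ne: "2 * e \<noteq> n"
  proof
    assume "2 * e = n"
    then have "int e dvd int n" "int e dvd int e * (int a + 3)" by auto
    then have "int e dvd 1" using e_inv by (metis cong_dvd_iff cong_dvd_modulus)
    then show False using \<open>2 * e = n\<close> n5 by simp
  qed
  have g: "seaweed_D n [a, b] [c] = g" using g_eq_seaweed assms(6) by simp
  have xi: "xi n (delta_A a b c 3) = real e / real n"
    unfolding c delta_A_eq[OF assms(1) b] xi_eq e_def ..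
  have "frobenius (2 * n) g \<longleftrightarrow> 2 * e < n"
    using path_frobenius cycle_not_frobenius ne by (meson linorder_neqE_nat)
  also have "\<dots> \<longleftrightarrow> 0 < real e / real n \<and> real e / real n < 0.5"
    using e_pos n5 by (auto simp: field_simps)
  finally show ?thesis unfolding g xi .
qed

end
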